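(* Let $b\ge\beta$ and assume that $\beta>1$. Then there exists some positive constant $d$ such that $$\liminf_{n\to\infty}\ \inf_{\tilde f}\ \sup_{f\in\mathcal{F}(\beta,b)}\mathbb{E}_f\big[\|f-\tilde f\|^2\big]\,n^{\frac{2\beta-1}{2bK}}\ \ge\ d>0,$$ where the infimum is taken over all estimators $\tilde f$ of $f$ based on the observations $Y_j$, $j=1,\dots,n$.
   Context: Setting: $X$ is a real random variable with a square integrable Lebesgue density $f$; $K\ge 2$ is a known integer. One observes $Y_1,\dots,Y_n$, where $Y_j=\sum_{k=1}^K X_{j,k}$ and the $X_{j,k}$ are independent copies of $X$ (so the $Y_j$ are i.i.d. with density the $K$-fold convolution $f^{\ast K}$). $\varphi_X(u)=\mathbb{E}[e^{iuX}]$; $\mathbb{E}_f$ is expectation when $X$ has density $f$; $\|g\|^2=\int|g(x)|^2dx$. For $b\ge\beta>\frac12$ and constants $C,C',C_X,C_f>0$, which are fixed and suppressed in the notation, $\mathcal{F}(\beta,b)=\mathcal{F}(\beta,b,C,C',C_X,C_f)$ is the class of densities $f$ such that $(1+C|u|)^{-b}\le|\varphi_X(u)|\le(1+C'|u|)^{-\beta}$ for all $u\in\mathbb{R}$, $\mathbb{E}[X^2]\le C_X$ and $\|f\|\le C_f$.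
   Formalization: As stated, the class F(β,b) is empty: its upper bound on |φ_X| near u=0 contradicts E[X²]≤C_X. Here that bound is required only for |u|≥R (any fixed R>0), and C, C_X, C_f must be large enough and C' small enough, with thresholds depending only on β, b, R. *)

theory Defs
  imports "HOL-Probability.Probability"
begin

abbreviation law_of :: "(real \<Rightarrow> real) \<Rightarrow> real measure" where
  "law_of f \<equiv> density lborel (\<lambda>x. ennreal (f x))"

definition is_density :: "(real \<Rightarrow> real) \<Rightarrow> bool" where
  "is_density f \<longleftrightarrow> f \<in> borel_measurable borel \<and> (\<forall>x. 0 \<le> f x) \<and> prob_space (law_of f)"

text \<open>
  The class of densities with polynomially decaying characteristic function. The upper bound on the
  characteristic function is required for \<open>\<bar>u\<bar> \<ge> R\<close> only. Required for all \<open>u\<close> (that is, \<open>R = 0\<close>) it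
  contradicts the moment condition: \<open>\<bar>\<phi>(u)\<bar> \<ge> 1 - C\<^sub>X u\<^sup>2 / 2\<close>, whereas \<open>(1 + C' u) powr - \<beta>\<close> leaves 1
  linearly at \<open>u = 0\<close>. Lemma \<open>density_class_0_empty\<close> below records this. The integrability conjuncts
  are needed because the Bochner integral of a non-integrable function is 0.
\<close>
definition density_class ::
  "real \<Rightarrow> real \<Rightarrow> real \<Rightarrow> real \<Rightarrow> real \<Rightarrow> real \<Rightarrow> real \<Rightarrow> (real \<Rightarrow> real) set" where
  "density_class R \<beta> b C C' C\<^sub>X C\<^sub>f = {f. is_density f \<and>
     (\<forall>u. (1 + C * \<bar>u\<bar>) powr (- b) \<le> cmod (char (law_of f) u)) \<and>
     (\<forall>u. R \<le> \<bar>u\<bar> \<longrightarrow> cmod (char (law_of f) u) \<le> (1 + C' * \<bar>u\<bar>) powr (- \<beta>)) \<and>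
     integrable (law_of f) (\<lambda>x. x\<^sup>2) \<and> (LINT x|law_of f. x\<^sup>2) \<le> C\<^sub>X \<and>
     integrable lborel (\<lambda>x. (f x)\<^sup>2) \<and> sqrt (LINT x|lborel. (f x)\<^sup>2) \<le> C\<^sub>f}"

text \<open>
  Joint law of \<open>(Y\<^sub>0, \<dots>, Y\<^sub>n\<^sub>-\<^sub>1)\<close>, where \<open>Y\<^sub>j\<close> is the sum of the \<open>K\<close> coordinates \<open>(j, k)\<close> of an
  i.i.d. array with density \<open>f\<close>.
\<close>
definition obs_law :: "(real \<Rightarrow> real) \<Rightarrow> nat \<Rightarrow> nat \<Rightarrow> (nat \<Rightarrow> real) measure" where
  "obs_law f K n =
     distr (\<Pi>\<^sub>M jk\<in>{..<n} \<times> {..<K}. law_of f) (\<Pi>\<^sub>M j\<in>{..<n}. borel)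
       (\<lambda>\<omega>. \<lambda>j\<in>{..<n}. \<Sum>k<K. \<omega> (j, k))"

text \<open>
  An estimator maps the sample \<open>y\<close> to a function \<open>t y\<close> on the line, jointly measurably. It need not
  be a density, nor square integrable: in the latter case its loss is infinite.
\<close>
definition estimators :: "nat \<Rightarrow> ((nat \<Rightarrow> real) \<Rightarrow> real \<Rightarrow> real) set" where
  "estimators n =
     {t. (\<lambda>(y, x). t y x) \<in> borel_measurable ((\<Pi>\<^sub>M j\<in>{..<n}. borel) \<Otimes>\<^sub>M borel)}"

definition risk ::
  "nat \<Rightarrow> nat \<Rightarrow> (real \<Rightarrow> real) \<Rightarrow> ((nat \<Rightarrow> real) \<Rightarrow> real \<Rightarrow> real) \<Rightarrow> ennreal" where
  "risk K n f t = (\<integral>\<^sup>+ y. (\<integral>\<^sup>+ x. ennreal ((f x - t y x)\<^sup>2) \<partial>lborel) \<partial>obs_law f K n)"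

definition minimax_risk :: "(real \<Rightarrow> real) set \<Rightarrow> nat \<Rightarrow> nat \<Rightarrow> ennreal" where
  "minimax_risk F K n = (INF t\<in>estimators n. SUP f\<in>F. risk K n f t)"

lemma char_ge_second_moment:
  assumes "prob_space M" "sets M = sets borel" "integrable M (\<lambda>x. x\<^sup>2)"
  shows "1 - u\<^sup>2 * (LINT x|M. x\<^sup>2) / 2 \<le> cmod (char M u)"
proof -
  interpret prob_space M by fact
  have meas [measurable]: "(\<lambda>x. x) \<in> borel_measurable M"
    using assms(2) measurable_ident_sets by blast
  have cos_ge: "1 - y\<^sup>2 / 2 \<le> cos y" for y :: real
  proof -
    have "\<bar>sin (y / 2)\<bar>\<^sup>2 \<le> \<bar>y / 2\<bar>\<^sup>2"
      by (rule power_mono[OF abs_sin_x_le_abs_x]) simp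
    then show ?thesis
      using cos_double_sin[of "y / 2"] by (simp add: power2_eq_square)
  qed
  have int_cos: "integrable M (\<lambda>x. cos (u * x))"
    by (rule integrable_const_bound[where B = 1]) auto
  have "1 - u\<^sup>2 * (LINT x|M. x\<^sup>2) / 2 = (LINT x|M. 1 - u\<^sup>2 / 2 * x\<^sup>2)"
    using assms(3) by (simp add: prob_space)
  also have "\<dots> \<le> (LINT x|M. cos (u * x))"
  proof (rule integral_mono[OF _ int_cos])
    show "integrable M (\<lambda>x. 1 - u\<^sup>2 / 2 * x\<^sup>2)"
      using assms(3) by simp
    show "1 - u\<^sup>2 / 2 * x\<^sup>2 \<le> cos (u * x)" for x
      using cos_ge[of "u * x"] by (simp add: power_mult_distrib)
  qed
  also have "\<dots> = Re (char M u)"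
  proof -
    have "integrable M (\<lambda>x. iexp (u * x))"
      by (rule integrable_iexp) auto
    from integral_Re[OF this] show ?thesis
      unfolding char_def by (simp add: Re_exp)
  qed
  also have "\<dots> \<le> cmod (char M u)"
    by (rule complex_Re_le_cmod)
  finally show ?thesis .
qed

lemma density_class_0_empty:
  assumes "0 < \<beta>" "0 < C'" "0 < C\<^sub>X"
  shows "density_class 0 \<beta> b C C' C\<^sub>X C\<^sub>f = {}"
proof (rule ccontr)
  assume "density_class 0 \<beta> b C C' C\<^sub>X C\<^sub>f \<noteq> {}"
  then obtain f where f: "f \<in> density_class 0 \<beta> b C C' C\<^sub>X C\<^sub>f" by auto
  let ?M = "law_of f"
  define a where "a = \<beta> * C' / 2"
  have a: "0 < a" using assms by (simp add: a_def)
  define u where "u = min (1 / (2 * C')) (min (1 / a) (a / (2 * C\<^sub>X)))"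
  have u: "0 < u" "u \<le> 1 / (2 * C')" "u \<le> 1 / a" "u \<le> a / (2 * C\<^sub>X)"
    using assms a by (auto simp: u_def)
  have u': "C' * u \<le> 1 / 2" "a * u \<le> 1" "u * C\<^sub>X \<le> a / 2"
    using u assms a by (auto simp: field_simps)
  have "1 - u\<^sup>2 * C\<^sub>X / 2 \<le> 1 - u\<^sup>2 * (LINT x|?M. x\<^sup>2) / 2"
    using f by (simp add: density_class_def mult_left_mono)
  also have "\<dots> \<le> cmod (char ?M u)"
    using f by (intro char_ge_second_moment) (auto simp: density_class_def is_density_def)
  also have "\<dots> \<le> (1 + C' * u) powr (- \<beta>)"
    using f u(1) by (auto simp: density_class_def dest!: spec[of _ u])
  also have "\<dots> = exp (- (\<beta> * ln (1 + C' * u)))"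
  proof -
    have "0 < 1 + C' * u" using assms u(1) by (simp add: add_pos_pos)
    then show ?thesis by (simp add: powr_def)
  qed
  also have "\<dots> \<le> exp (- (a * u))"
  proof -
    have "C' * u / 2 \<le> C' * u - (C' * u)\<^sup>2"
    proof -
      have "(C' * u) * (C' * u) \<le> 1 / 2 * (C' * u)"
        using u' assms u(1) by (intro mult_right_mono) auto
      then show ?thesis by (simp add: power2_eq_square)
    qed
    also have "\<dots> \<le> ln (1 + C' * u)"
      using assms u(1) u' by (intro ln_one_plus_pos_lower_bound) auto
    finally have "\<beta> * (C' * u / 2) \<le> \<beta> * ln (1 + C' * u)"
      using assms by (intro mult_left_mono) auto
    then show ?thesis by (simp add: a_def)
  qed
  also have "\<dots> \<le> 1 / (1 + a * u)"
  proof -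
    have "inverse (exp (a * u)) \<le> inverse (1 + a * u)"
      using a u(1) by (intro le_imp_inverse_le exp_ge_add_one_self) (simp add: add_pos_pos)
    then show ?thesis by (simp add: exp_minus inverse_eq_divide)
  qed
  finally have "(1 - u\<^sup>2 * C\<^sub>X / 2) * (1 + a * u) \<le> 1"
    using a u(1) by (simp add: pos_le_divide_eq add_pos_pos)
  then have "u * a \<le> u * (u * C\<^sub>X / 2 * (1 + a * u))"
    by (simp add: algebra_simps power2_eq_square)
  then have "a \<le> u * C\<^sub>X / 2 * (1 + a * u)"
    using u(1) by simp
  also have "\<dots> \<le> u * C\<^sub>X / 2 * 2"
    using u' u(1) assms by (intro mult_left_mono) auto
  finally show False using u' a by simp
qed

end

theory Submission
  imports Defs
begin

text \<open>
  The observations determine \<open>\<phi>\<^sup>K\<close>, hence \<open>\<phi>\<close> up to \<open>K\<close>-th roots of unity, and the branch can be switched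
  unnoticed at a frequency \<open>m\<close> where \<open>\<phi>\<close> is small. Take \<open>f\<^sub>\<tau> = s p\<^sub>\<tau> / Z\<close>, where \<open>s \<ge> 0\<close> is integrable
  with nonnegative, compactly supported Fourier transform and
  \<open>p\<^sub>\<tau>(x) = 1 + 2 (\<Sum>j\<ge>1. a\<^sub>j cos (j x - \<theta>\<^sub>j))\<close> with \<open>\<theta>\<^sub>j = 0\<close> for \<open>j < m\<close> and \<open>\<theta>\<^sub>j = \<tau>\<close> for \<open>j \<ge> m\<close>. The amplitudes are
  of order \<open>j powr - \<beta>\<close>, except in a window of bounded length around \<open>m\<close>, where they drop to \<open>j powr - b\<close>.
  For \<open>\<tau> = \<pi> / K\<close> and \<open>- \<pi> / K\<close> the characteristic functions have the same \<open>K\<close>-th power outside the window,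
  although \<open>f\<^sub>\<tau>\<close> and \<open>f\<^sub>-\<^sub>\<tau>\<close> are at squared distance of order \<open>m powr (1 - 2 \<beta>)\<close>.

  Since \<open>p\<^sub>\<tau> \<ge> 1/2\<close> (here \<open>\<beta> > 1\<close> is used), the law of the sum under \<open>- \<tau>\<close> is the image of the \<open>K\<close>-fold product
  law under \<open>\<tau>\<close>, reweighted by a density \<open>1 + O(m powr (- b K))\<close>: by uniqueness of characteristic functions
  only the window contributes to the correction. So the laws of \<open>n\<close> observations stay close in the
  chi-square sense as long as \<open>n \<le> const * m powr (2 b K)\<close>, and Le Cam's two-point argument gives the rate.
\<close>

subsection \<open>The law of a sum of independent copies\<close>

text \<open>The reweighting lives on the K-fold product because a comparison on the line would
  divide by the density of the sum, for whose tails no lower bound is at hand; on the product it is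
  enough that 1 / p_\<tau> is bounded. Passing from the sums to the summands only makes the two
  hypotheses easier to tell apart, which is harmless for a lower bound. The window is forced by the
  kernel: the transform of s vanishes only from some distance L on, so unshifted and phase-shifted
  frequencies overlap for ||u| - m| < L, and the K-th power of such a mixture does depend on the
  sign of \<tau>. The class tolerates characteristic functions as small as |u| powr - b, and this
  freedom is spent exactly there. Compact support makes the agreement elsewhere exact, so no tail
  has to be estimated. A product of K factors of size m powr - b has a square of order m powr (- 2 b
  K); this is where the K in the exponent of the rate comes from. Since m grows with n, every
  constant that places the hypotheses in the class has to be uniform in m.\<close>

definition sum_law :: "nat \<Rightarrow> real measure \<Rightarrow> real measure" where
  "sum_law K \<mu> = distr (\<Pi>\<^sub>M k\<in>{..<K}. \<mu>) borel (\<lambda>\<omega>. \<Sum>k<K. \<omega> k)"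

lemma measurable_sum_coordinates:
  assumes "sets \<mu> = sets borel"
  shows "(\<lambda>\<omega>. \<Sum>k<K. \<omega> k :: real) \<in> borel_measurable (\<Pi>\<^sub>M k\<in>{..<K}. \<mu>)"
proof -
  have "(\<lambda>\<omega>. \<omega> k) \<in> borel_measurable (\<Pi>\<^sub>M k\<in>{..<K}. \<mu>)" if "k \<in> {..<K}" for k
    using measurable_component_singleton[OF that, of "\<lambda>_. \<mu>"] assms
    by (simp cong: measurable_cong_sets)
  then show ?thesis by (intro borel_measurable_sum) auto
qed

lemma real_distribution_sum_law:
  assumes "real_distribution \<mu>"
  shows "real_distribution (sum_law K \<mu>)"
proof -
  interpret real_distribution \<mu> by fact
  interpret P: prob_space "\<Pi>\<^sub>M k\<in>{..<K}. \<mu>"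
    by (intro prob_space_PiM) (rule prob_space_axioms)
  show ?thesis
    unfolding sum_law_def
    by (intro P.real_distribution_distr measurable_sum_coordinates) simp
qed

lemma (in real_distribution) integrable_iexp_mult: "complex_integrable M (\<lambda>x. iexp (t * x))"
  by (rule integrable_const_bound[where B = 1]) (auto simp del: of_real_mult)

lemma char_sum_law:
  assumes "real_distribution \<mu>"
  shows "char (sum_law K \<mu>) t = char \<mu> t ^ K"
proof -
  interpret real_distribution \<mu> by fact
  interpret product_prob_space "\<lambda>_::nat. \<mu>" by standard
  have "char (sum_law K \<mu>) t = (CLINT \<omega>|(\<Pi>\<^sub>M k\<in>{..<K}. \<mu>). iexp (t * (\<Sum>k<K. \<omega> k)))"
    unfolding char_def sum_law_def
    by (subst integral_distr) (auto intro: measurable_sum_coordinates)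
  also have "\<dots> = (CLINT \<omega>|(\<Pi>\<^sub>M k\<in>{..<K}. \<mu>). (\<Prod>k<K. iexp (t * \<omega> k)))"
    by (simp add: exp_sum sum_distrib_left)
  also have "\<dots> = (\<Prod>k<K. CLINT x|\<mu>. iexp (t * x))"
    by (rule product_integral_prod) (simp_all only: finite_lessThan integrable_iexp_mult)
  finally show ?thesis by (simp add: char_def)
qed

text \<open>The rows \<open>{j} \<times> {..<K}\<close> of the array are disjoint, so the row sums
  are independent, and each row is a reindexed copy of the K-fold product.\<close>

lemma obs_law_eq_PiM:
  assumes "prob_space (law_of f)" "0 < n" "0 < K"
  shows "obs_law f K n = (\<Pi>\<^sub>M j\<in>{..<n}. sum_law K (law_of f))"
proof -
  let ?\<mu> = "law_of f"
  interpret mu: prob_space ?\<mu> by fact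
  let ?I = "{..<n} \<times> {..<K}"
  let ?\<Omega> = "\<Pi>\<^sub>M jk\<in>?I. ?\<mu>"
  interpret P: prob_space ?\<Omega> by (intro prob_space_PiM) (rule mu.prob_space_axioms)
  have ne: "?I \<noteq> {}" using assms by auto
  \<comment> \<open>The coordinates are independent because their joint law is the product itself:
    restriction to the index set is the identity on extensional functions.\<close>
  have "P.indep_vars (\<lambda>_. ?\<mu>) (\<lambda>i \<omega>. \<omega> i) ?I"
  proof (subst P.indep_vars_iff_distr_eq_PiM'[OF ne])
    have "distr ?\<Omega> ?\<Omega> (\<lambda>x. restrict x ?I) = distr ?\<Omega> ?\<Omega> (\<lambda>x. x)"
      by (intro distr_cong) (auto simp: space_PiM)
    also have "\<dots> = ?\<Omega>" by (rule distr_id2) simp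
    also have "\<dots> = (\<Pi>\<^sub>M i\<in>?I. distr ?\<Omega> ?\<mu> (\<lambda>\<omega>. \<omega> i))"
      by (intro PiM_cong refl distr_PiM_component[symmetric] mu.prob_space_axioms) 
    finally show "distr ?\<Omega> ?\<Omega> (\<lambda>x. \<lambda>i\<in>?I. x i) = (\<Pi>\<^sub>M i\<in>?I. distr ?\<Omega> ?\<mu> (\<lambda>\<omega>. \<omega> i))" .
  qed (auto intro: measurable_component_singleton)
  then have "P.indep_vars (\<lambda>j. \<Pi>\<^sub>M i\<in>{j} \<times> {..<K}. ?\<mu>) (\<lambda>j \<omega>. restrict (\<lambda>i. \<omega> i) ({j} \<times> {..<K})) {..<n}"
    by (rule P.indep_vars_restrict) (auto simp: disjoint_family_on_def)
  then have "P.indep_vars (\<lambda>j. borel)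
      (\<lambda>j \<omega>. (\<lambda>x. \<Sum>k<K. x (j, k) :: real) (restrict (\<lambda>i. \<omega> i) ({j} \<times> {..<K}))) {..<n}"
  proof (rule P.indep_vars_compose2)
    fix j
    have "(\<lambda>x. x (j, k)) \<in> borel_measurable (\<Pi>\<^sub>M i\<in>{j} \<times> {..<K}. ?\<mu>)" if "k < K" for k
      using measurable_component_singleton[of "(j, k)" "{j} \<times> {..<K}" "\<lambda>_. ?\<mu>"] that
      by (simp cong: measurable_cong_sets)
    then show "(\<lambda>x. \<Sum>k<K. x (j, k) :: real) \<in> borel_measurable (\<Pi>\<^sub>M i\<in>{j} \<times> {..<K}. ?\<mu>)"
      by (intro borel_measurable_sum) auto
  qed
  then have ind: "P.indep_vars (\<lambda>j. borel) (\<lambda>j \<omega>. \<Sum>k<K. \<omega> (j, k)) {..<n}"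
    by (rule P.indep_vars_cong[THEN iffD1, rotated -1]) auto
  have "obs_law f K n = (\<Pi>\<^sub>M j\<in>{..<n}. distr ?\<Omega> borel (\<lambda>\<omega>. \<Sum>k<K. \<omega> (j, k)))"
    unfolding obs_law_def
    by (subst P.indep_vars_iff_distr_eq_PiM'[symmetric]) (use assms ind in \<open>auto dest: P.indep_vars_def[THEN iffD1]\<close>)
  also have "\<dots> = (\<Pi>\<^sub>M j\<in>{..<n}. sum_law K ?\<mu>)"
  proof (intro PiM_cong refl)
    fix j assume j: "j \<in> {..<n}"
    let ?r = "\<lambda>\<omega>. \<lambda>k\<in>{..<K}. \<omega> (j, k)"
    have r: "distr ?\<Omega> (\<Pi>\<^sub>M k\<in>{..<K}. ?\<mu>) ?r = (\<Pi>\<^sub>M k\<in>{..<K}. ?\<mu>)"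
      using distr_PiM_reindex[of ?I "\<lambda>_. ?\<mu>" "\<lambda>k. (j, k)" "{..<K}"] mu.prob_space_axioms j
      by (auto simp: inj_on_def)
    have "sum_law K ?\<mu> = distr (distr ?\<Omega> (\<Pi>\<^sub>M k\<in>{..<K}. ?\<mu>) ?r) borel (\<lambda>\<omega>. \<Sum>k<K. \<omega> k)"
      by (simp add: r sum_law_def)
    also have "\<dots> = distr ?\<Omega> borel (\<lambda>\<omega>. \<Sum>k<K. \<omega> (j, k))"
      by (subst distr_distr)
        (use j in \<open>auto intro!: measurable_sum_coordinates measurable_restrict measurable_component_singleton simp: comp_def intro!: distr_cong sum.cong\<close>)
    finally show "distr ?\<Omega> borel (\<lambda>\<omega>. \<Sum>k<K. \<omega> (j, k)) = sum_law K ?\<mu>" ..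
  qed
  finally show ?thesis .
qed

subsection \<open>Two-point lower bound\<close>

text \<open>The functions \<open>r\<^sub>0\<close> and \<open>r\<^sub>1\<close> carry the parts of
  the two transforms whose K-th powers differ. A product of one function of each coordinate
  contributes a K-th power to the transform of the sum, so adding the product of the
  \<open>r\<^sub>1\<close> and subtracting that of the \<open>r\<^sub>0\<close> repairs exactly the
  discrepancy in \<open>eq\<close>. With K factors the correction is of size \<delta> ^ K.\<close>

lemma sum_law_perturbation:
  fixes r\<^sub>0 r\<^sub>1 :: "real \<Rightarrow> real"
  assumes "real_distribution \<nu>\<^sub>0" "real_distribution \<nu>\<^sub>1"
    and [measurable]: "r\<^sub>0 \<in> borel_measurable borel" "r\<^sub>1 \<in> borel_measurable borel"
    and bound: "\<And>x. \<bar>r\<^sub>0 x\<bar> \<le> \<delta>" "\<And>x. \<bar>r\<^sub>1 x\<bar> \<le> \<delta>" and small: "2 * \<delta> ^ K \<le> 1"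
    and eq: "\<And>u. char \<nu>\<^sub>1 u ^ K - char \<nu>\<^sub>0 u ^ K =
      (CLINT x|\<nu>\<^sub>0. r\<^sub>1 x * iexp (u * x)) ^ K - (CLINT x|\<nu>\<^sub>0. r\<^sub>0 x * iexp (u * x)) ^ K"
  obtains h where "h \<in> borel_measurable (\<Pi>\<^sub>M k\<in>{..<K}. \<nu>\<^sub>0)" "\<And>\<omega>. 0 \<le> h \<omega>"
    "(\<integral>\<^sup>+\<omega>. ennreal (h \<omega>) \<partial>(\<Pi>\<^sub>M k\<in>{..<K}. \<nu>\<^sub>0)) = 1"
    "(\<integral>\<^sup>+\<omega>. ennreal ((h \<omega>)\<^sup>2) \<partial>(\<Pi>\<^sub>M k\<in>{..<K}. \<nu>\<^sub>0)) \<le> ennreal (1 + (2 * \<delta> ^ K)\<^sup>2)"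
    "sum_law K \<nu>\<^sub>1 = distr (density (\<Pi>\<^sub>M k\<in>{..<K}. \<nu>\<^sub>0) (\<lambda>\<omega>. ennreal (h \<omega>))) borel (\<lambda>\<omega>. \<Sum>k<K. \<omega> k)"
proof -
  interpret n0: real_distribution \<nu>\<^sub>0 by fact
  interpret n1: real_distribution \<nu>\<^sub>1 by fact
  interpret pp: product_prob_space "\<lambda>_::nat. \<nu>\<^sub>0" by standard
  define M where "M = (\<Pi>\<^sub>M k\<in>{..<K}. \<nu>\<^sub>0)"
  interpret M: prob_space M
    unfolding M_def by (intro prob_space_PiM) (rule n0.prob_space_axioms)
  define h where "h = (\<lambda>\<omega>. 1 + (\<Prod>k<K. r\<^sub>1 (\<omega> k)) - (\<Prod>k<K. r\<^sub>0 (\<omega> k)))"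
  have [measurable]: "h \<in> borel_measurable M"
    unfolding h_def M_def by measurable
  have S [measurable]: "(\<lambda>\<omega>. \<Sum>k<K. \<omega> k) \<in> borel_measurable M"
    unfolding M_def by (intro measurable_sum_coordinates) simp
  have prod_le: "\<bar>\<Prod>k<K. r (\<omega> k)\<bar> \<le> \<delta> ^ K" if "\<And>x. \<bar>r x\<bar> \<le> \<delta>" for r :: "real \<Rightarrow> real" and \<omega> :: "nat \<Rightarrow> real"
    using prod_mono[where A = "{..<K}" and f = "\<lambda>k. \<bar>r (\<omega> k)\<bar>" and g = "\<lambda>_. \<delta>"] that by (simp add: abs_prod)
  have h1: "\<bar>h \<omega> - 1\<bar> \<le> 2 * \<delta> ^ K" for \<omega>
    using prod_le[of r\<^sub>0 \<omega>, OF bound(1)] prod_le[of r\<^sub>1 \<omega>, OF bound(2)] unfolding h_def by linarith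
  have h0: "0 \<le> h \<omega>" for \<omega>
    using h1[of \<omega>] small by linarith
  have h_le: "h \<omega> \<le> 2" for \<omega>
    using h1[of \<omega>] small by linarith
  have int_h: "integrable M h"
    by (rule M.integrable_const_bound[where B = 2]) (use h0 h_le in auto)
  have int_r: "complex_integrable \<nu>\<^sub>0 (\<lambda>x. r x * iexp (u * x))"
    if [measurable]: "r \<in> borel_measurable borel" and "\<And>x. \<bar>r x\<bar> \<le> \<delta>" for u r
    by (rule n0.integrable_const_bound[where B = \<delta>])
      (use that in \<open>auto simp: norm_mult simp del: of_real_mult\<close>)
  have prod_r: "complex_integrable M (\<lambda>\<omega>. \<Prod>k<K. r (\<omega> k) * iexp (u * \<omega> k))"
    "(CLINT \<omega>|M. (\<Prod>k<K. r (\<omega> k) * iexp (u * \<omega> k))) = (CLINT x|\<nu>\<^sub>0. r x * iexp (u * x)) ^ K"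
    if r: "r \<in> borel_measurable borel" "\<And>x. \<bar>r x\<bar> \<le> \<delta>" for u and r :: "real \<Rightarrow> real"
    unfolding M_def
    using pp.product_integrable_prod[of "{..<K}" "\<lambda>_ x. r x * iexp (u * x)", OF _ int_r[OF r]]
      pp.product_integral_prod[of "{..<K}" "\<lambda>_ x. r x * iexp (u * x)", OF _ int_r[OF r]]
    by simp_all
  have prod_1: "complex_integrable M (\<lambda>\<omega>. \<Prod>k<K. iexp (u * \<omega> k))"
    "(CLINT \<omega>|M. (\<Prod>k<K. iexp (u * \<omega> k))) = char \<nu>\<^sub>0 u ^ K" for u
    unfolding M_def char_def
    using pp.product_integrable_prod[of "{..<K}" "\<lambda>_ x. iexp (u * x)", OF _ n0.integrable_iexp_mult]
      pp.product_integral_prod[of "{..<K}" "\<lambda>_ x. iexp (u * x)", OF _ n0.integrable_iexp_mult]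
    by simp_all
  have char_h: "(CLINT \<omega>|M. h \<omega> *\<^sub>R iexp (u * (\<Sum>k<K. \<omega> k))) = char \<nu>\<^sub>1 u ^ K" for u
  proof -
    have "h \<omega> *\<^sub>R iexp (u * (\<Sum>k<K. \<omega> k)) = (\<Prod>k<K. iexp (u * \<omega> k))
        + (\<Prod>k<K. r\<^sub>1 (\<omega> k) * iexp (u * \<omega> k)) - (\<Prod>k<K. r\<^sub>0 (\<omega> k) * iexp (u * \<omega> k))" for \<omega>
    proof -
      have "iexp (u * (\<Sum>k<K. \<omega> k)) = (\<Prod>k<K. iexp (u * \<omega> k))"
        by (simp add: exp_sum sum_distrib_left)
      then show ?thesis
        by (simp add: h_def scaleR_conv_of_real prod.distrib algebra_simps del: of_real_mult)
    qed
    then have "(CLINT \<omega>|M. h \<omega> *\<^sub>R iexp (u * (\<Sum>k<K. \<omega> k))) = char \<nu>\<^sub>0 u ^ K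
        + (CLINT x|\<nu>\<^sub>0. r\<^sub>1 x * iexp (u * x)) ^ K - (CLINT x|\<nu>\<^sub>0. r\<^sub>0 x * iexp (u * x)) ^ K"
      using prod_1[of u] prod_r[OF assms(3) bound(1), of u] prod_r[OF assms(4) bound(2), of u]
      by (simp del: of_real_mult)
    then show ?thesis
      by (simp only: add_diff_eq[symmetric] eq[symmetric]) simp
  qed
  \<comment> \<open>Total mass one is the identity \<open>char_h\<close> read at u = 0.\<close>
  have Lh: "(LINT \<omega>|M. h \<omega>) = 1"
  proof -
    have "(CLINT \<omega>|M. complex_of_real (h \<omega>)) = 1"
      using char_h[of 0] n1.char_zero by (simp add: scaleR_conv_of_real)
    then show ?thesis by simp
  qed
  have nn_h: "(\<integral>\<^sup>+\<omega>. ennreal (h \<omega>) \<partial>M) = 1"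
    using nn_integral_eq_integral[OF int_h] h0 Lh by simp
  define N where "N = distr (density M (\<lambda>\<omega>. ennreal (h \<omega>))) borel (\<lambda>\<omega>. \<Sum>k<K. \<omega> k)"
  have pd: "prob_space (density M (\<lambda>\<omega>. ennreal (h \<omega>)))"
    by (rule prob_spaceI) (simp add: emeasure_density nn_h cong: nn_integral_cong_simp)
  have rN: "real_distribution N"
    unfolding N_def by (intro prob_space.real_distribution_distr[OF pd]) simp
  have "char N u = char (sum_law K \<nu>\<^sub>1) u" for u
  proof -
    have "char N u = (CLINT \<omega>|M. h \<omega> *\<^sub>R iexp (u * (\<Sum>k<K. \<omega> k)))"
      unfolding char_def N_def
      by (subst integral_distr, simp, simp, subst integral_density) (auto simp: h0 simp del: of_real_mult of_real_sum)
    then show ?thesis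
      using char_h char_sum_law[OF assms(2)] by simp
  qed
  then have N: "sum_law K \<nu>\<^sub>1 = N"
    using real_distribution_sum_law[OF assms(2)] rN by (intro Levy_uniqueness) auto
  have "(\<integral>\<^sup>+\<omega>. ennreal ((h \<omega>)\<^sup>2) \<partial>M) \<le> ennreal (1 + (2 * \<delta> ^ K)\<^sup>2)"
  proof -
    have int2: "integrable M (\<lambda>\<omega>. (h \<omega>)\<^sup>2)"
      by (rule M.integrable_const_bound[where B = "2\<^sup>2"]) (use power_mono[OF h_le h0, of _ 2] in auto)
    \<comment> \<open>Expanding (h - 1)^2 isolates h^2 against a term linear in h; as h has mean
      one, the uniform bound on h - 1 becomes a chi-square bound.\<close>
    have "(h \<omega>)\<^sup>2 \<le> 2 * h \<omega> - 1 + (2 * \<delta> ^ K)\<^sup>2" for \<omega>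
    proof -
      have "(h \<omega> - 1)\<^sup>2 \<le> (2 * \<delta> ^ K)\<^sup>2"
        using power_mono[OF h1[of \<omega>], of 2] by simp
      then show ?thesis by (simp add: power2_eq_square algebra_simps)
    qed
    then have "(LINT \<omega>|M. (h \<omega>)\<^sup>2) \<le> (LINT \<omega>|M. 2 * h \<omega> - 1 + (2 * \<delta> ^ K)\<^sup>2)"
      using int2 int_h by (intro integral_mono) auto
    also have "\<dots> = 1 + (2 * \<delta> ^ K)\<^sup>2"
      using int_h by (simp add: Lh M.prob_space)
    finally show ?thesis
      using nn_integral_eq_integral[OF int2] by (simp add: ennreal_leI del: ennreal_plus)
  qed
  note i2 = this
  have m: "h \<in> borel_measurable M" by measurable
  show thesis
    by (rule that[OF m[unfolded M_def] h0 nn_h[unfolded M_def] i2[unfolded M_def] N[unfolded N_def M_def]])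
qed

section \<open>Densities and images of finite product measures\<close>

lemma PiM_density:
  fixes h :: "'a \<Rightarrow> real"
  assumes "prob_space M" and [measurable]: "h \<in> borel_measurable M" and "\<And>x. 0 \<le> h x"
    and "(\<integral>\<^sup>+x. ennreal (h x) \<partial>M) = 1" and "finite I"
  shows "(\<Pi>\<^sub>M i\<in>I. density M (\<lambda>x. ennreal (h x))) =
    density (\<Pi>\<^sub>M i\<in>I. M) (\<lambda>\<omega>. ennreal (\<Prod>i\<in>I. h (\<omega> i)))"
proof -
  interpret M: prob_space M by fact
  interpret pp: product_prob_space "\<lambda>_::'b. M" by standard
  have pd: "prob_space (density M (\<lambda>x. ennreal (h x)))"
    by (rule prob_spaceI) (simp add: emeasure_density assms cong: nn_integral_cong_simp)
  interpret pd: product_prob_space "\<lambda>_::'b. density M (\<lambda>x. ennreal (h x))"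
    by (intro product_prob_spaceI pd)
  show ?thesis
  proof (rule pd.PiM_eqI[symmetric])
    fix A :: "'b \<Rightarrow> 'a set"
    assume "\<And>i. i \<in> I \<Longrightarrow> A i \<in> sets (density M (\<lambda>x. ennreal (h x)))"
    then have A [measurable]: "\<And>i. i \<in> I \<Longrightarrow> A i \<in> sets M" by simp
    have box [measurable]: "Pi\<^sub>E I A \<in> sets (\<Pi>\<^sub>M i\<in>I. M)"
      using A assms by (intro sets_PiM_I_finite) auto
    have "emeasure (density (\<Pi>\<^sub>M i\<in>I. M) (\<lambda>\<omega>. ennreal (\<Prod>i\<in>I. h (\<omega> i)))) (Pi\<^sub>E I A)
        = (\<integral>\<^sup>+\<omega>. ennreal (\<Prod>i\<in>I. h (\<omega> i)) * indicator (Pi\<^sub>E I A) \<omega> \<partial>(\<Pi>\<^sub>M i\<in>I. M))"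
      by (rule emeasure_density) (auto simp: assms)
    also have "\<dots> = (\<integral>\<^sup>+\<omega>. (\<Prod>i\<in>I. ennreal (h (\<omega> i)) * indicator (A i) (\<omega> i)) \<partial>(\<Pi>\<^sub>M i\<in>I. M))"
    proof (rule nn_integral_cong)
      fix \<omega> assume "\<omega> \<in> space (\<Pi>\<^sub>M i\<in>I. M)"
      then have "indicator (Pi\<^sub>E I A) \<omega> = (\<Prod>i\<in>I. indicator (A i) (\<omega> i) :: ennreal)"
        using assms(5) by (auto simp: indicator_def space_PiM PiE_iff prod_zero_iff)
      then show "ennreal (\<Prod>i\<in>I. h (\<omega> i)) * indicator (Pi\<^sub>E I A) \<omega> =
          (\<Prod>i\<in>I. ennreal (h (\<omega> i)) * indicator (A i) (\<omega> i))"
        using assms by (simp add: prod.distrib prod_ennreal)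
    qed
    also have "\<dots> = (\<Prod>i\<in>I. \<integral>\<^sup>+x. ennreal (h x) * indicator (A i) x \<partial>M)"
      by (rule pp.product_nn_integral_prod) (use assms in auto)
    also have "\<dots> = (\<Prod>i\<in>I. emeasure (density M (\<lambda>x. ennreal (h x))) (A i))"
      by (intro prod.cong refl emeasure_density[symmetric]) auto
    finally show "emeasure (density (\<Pi>\<^sub>M i\<in>I. M) (\<lambda>\<omega>. ennreal (\<Prod>i\<in>I. h (\<omega> i)))) (Pi\<^sub>E I A) =
        (\<Prod>i\<in>I. emeasure (density M (\<lambda>x. ennreal (h x))) (A i))" .
  next
    show "sets (density (\<Pi>\<^sub>M i\<in>I. M) (\<lambda>\<omega>. ennreal (\<Prod>i\<in>I. h (\<omega> i))))
        = sets (\<Pi>\<^sub>M i\<in>I. density M (\<lambda>x. ennreal (h x)))"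
      by (simp cong: sets_PiM_cong)
  qed fact
qed

lemma PiM_distr:
  assumes "prob_space M" and [measurable]: "S \<in> borel_measurable M" and "finite I"
  shows "(\<Pi>\<^sub>M i\<in>I. distr M borel S) = distr (\<Pi>\<^sub>M i\<in>I. M) (\<Pi>\<^sub>M i\<in>I. borel) (compose I S)"
proof -
  \<comment> \<open>\<open>distr_PiM_finite_prob_space'\<close> asks for probability measures as
    targets, and only their sigma-algebras matter, so a point mass on the Borel sets stands in for
    \<open>borel\<close>.\<close>
  let ?b = "return borel (undefined :: 'b)"
  have "distr (\<Pi>\<^sub>M i\<in>I. M) (\<Pi>\<^sub>M i\<in>I. ?b) (compose I S) = (\<Pi>\<^sub>M i\<in>I. distr M ?b S)"
    using assms by (intro distr_PiM_finite_prob_space') (auto intro: prob_space_return)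
  moreover have "distr M ?b S = distr M borel S"
    by (rule distr_cong) auto
  moreover have "distr (\<Pi>\<^sub>M i\<in>I. M) (\<Pi>\<^sub>M i\<in>I. ?b) (compose I S) = distr (\<Pi>\<^sub>M i\<in>I. M) (\<Pi>\<^sub>M i\<in>I. borel) (compose I S)"
    by (intro distr_cong sets_PiM_cong) auto
  ultimately show ?thesis by simp
qed

text \<open>Both sample laws are images under the same map \<open>S\<close>, of \<open>M\<close> and
  of its reweighting by \<open>h\<close>. The likelihood ratio \<open>L\<close> can therefore be
  taken upstairs, where it is a product, and the sum of the two risks is at least \<open>D\<close>
  times the mean of min 1 L.\<close>

lemma two_point_lower_bound:
  fixes h :: "'a \<Rightarrow> real" and S :: "'a \<Rightarrow> real"
  assumes "prob_space M" and [measurable]: "h \<in> borel_measurable M" "S \<in> borel_measurable M"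
    and h: "\<And>x. 0 \<le> h x" "(\<integral>\<^sup>+x. ennreal (h x) \<partial>M) = 1"
    and h2: "(\<integral>\<^sup>+x. ennreal ((h x)\<^sup>2) \<partial>M) \<le> ennreal (1 + e)" and e: "0 \<le> e" "(1 + e) ^ n \<le> 2"
    and \<mu>: "\<mu>\<^sub>0 = distr M borel S" "\<mu>\<^sub>1 = distr (density M (\<lambda>x. ennreal (h x))) borel S"
    and [measurable]: "A \<in> borel_measurable (\<Pi>\<^sub>M i\<in>{..<n}. borel)" "B \<in> borel_measurable (\<Pi>\<^sub>M i\<in>{..<n}. borel)"
    and AB: "\<And>y. D \<le> A y + B y"
  shows "D / 2 \<le> (\<integral>\<^sup>+y. A y \<partial>(\<Pi>\<^sub>M i\<in>{..<n}. \<mu>\<^sub>0)) + (\<integral>\<^sup>+y. B y \<partial>(\<Pi>\<^sub>M i\<in>{..<n}. \<mu>\<^sub>1))"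
proof -
  interpret M: prob_space M by fact
  interpret pp: product_prob_space "\<lambda>_::nat. M" by standard
  have pd: "prob_space (density M (\<lambda>x. ennreal (h x)))"
    by (rule prob_spaceI) (simp add: emeasure_density h cong: nn_integral_cong_simp)
  define P where "P = (\<Pi>\<^sub>M i\<in>{..<n}. M)"
  define L where "L = (\<lambda>\<omega>. \<Prod>i<n. h (\<omega> i))"
  define T where "T = compose {..<n} S"
  have [measurable]: "T \<in> measurable P (\<Pi>\<^sub>M i\<in>{..<n}. borel)"
    unfolding T_def P_def compose_def by measurable
  have [measurable]: "L \<in> borel_measurable P"
    unfolding L_def P_def by measurable
  have L0: "0 \<le> L \<omega>" for \<omega>
    unfolding L_def by (intro prod_nonneg) (simp add: h)
  have P0: "(\<Pi>\<^sub>M i\<in>{..<n}. \<mu>\<^sub>0) = distr P (\<Pi>\<^sub>M i\<in>{..<n}. borel) T"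
    unfolding \<mu> P_def T_def by (rule PiM_distr) (auto simp: assms)
  have P1: "(\<Pi>\<^sub>M i\<in>{..<n}. \<mu>\<^sub>1) = distr (density P (\<lambda>\<omega>. ennreal (L \<omega>))) (\<Pi>\<^sub>M i\<in>{..<n}. borel) T"
    unfolding \<mu> P_def T_def L_def
    by (subst PiM_density[symmetric]) (auto intro!: PiM_distr simp: assms pd)
  have A: "(\<integral>\<^sup>+y. A y \<partial>(\<Pi>\<^sub>M i\<in>{..<n}. \<mu>\<^sub>0)) = (\<integral>\<^sup>+\<omega>. A (T \<omega>) \<partial>P)"
    unfolding P0 by (rule nn_integral_distr) measurable
  have B: "(\<integral>\<^sup>+y. B y \<partial>(\<Pi>\<^sub>M i\<in>{..<n}. \<mu>\<^sub>1)) = (\<integral>\<^sup>+\<omega>. ennreal (L \<omega>) * B (T \<omega>) \<partial>P)"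
    unfolding P1 by (subst nn_integral_distr) (auto simp: nn_integral_density)
  have IL: "(\<integral>\<^sup>+\<omega>. ennreal (L \<omega>) \<partial>P) = 1"
  proof -
    have "(\<integral>\<^sup>+\<omega>. ennreal (L \<omega>) \<partial>P) = (\<integral>\<^sup>+\<omega>. (\<Prod>i<n. ennreal (h (\<omega> i))) \<partial>P)"
      by (simp add: L_def prod_ennreal h)
    also have "\<dots> = (\<Prod>i<n. \<integral>\<^sup>+x. ennreal (h x) \<partial>M)"
      unfolding P_def by (rule pp.product_nn_integral_prod) auto
    finally show ?thesis by (simp add: h)
  qed
  have IL2: "(\<integral>\<^sup>+\<omega>. ennreal ((L \<omega>)\<^sup>2) \<partial>P) \<le> 2"
  proof -
    have "(\<integral>\<^sup>+\<omega>. ennreal ((L \<omega>)\<^sup>2) \<partial>P) = (\<integral>\<^sup>+\<omega>. (\<Prod>i<n. ennreal ((h (\<omega> i))\<^sup>2)) \<partial>P)"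
      by (simp add: L_def prod_ennreal prod_power_distrib)
    also have "\<dots> = (\<Prod>i<n. \<integral>\<^sup>+x. ennreal ((h x)\<^sup>2) \<partial>M)"
      unfolding P_def by (rule pp.product_nn_integral_prod) auto
    also have "\<dots> \<le> ennreal (1 + e) ^ n"
      using power_mono[OF h2, of n] by simp
    also have "\<dots> \<le> ennreal 2"
      using e by (simp add: ennreal_power ennreal_leI del: ennreal_numeral ennreal_plus)
    finally show ?thesis by simp
  qed
  have Imin: "1 / 2 \<le> (\<integral>\<^sup>+\<omega>. ennreal (min 1 (L \<omega>)) \<partial>P)"
  proof -
    have "1 = (\<integral>\<^sup>+\<omega>. ennreal (L \<omega>) \<partial>P)" by (simp add: IL)
    also have "\<dots> \<le> (\<integral>\<^sup>+\<omega>. ennreal (min 1 (L \<omega>)) + ennreal (1 / 4) * ennreal ((L \<omega>)\<^sup>2) \<partial>P)"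
    proof (rule nn_integral_mono)
      fix \<omega>
      \<comment> \<open>Gives L \<le> 1 + L^2 / 4, the case L \<le> 1 being trivial. With mean 1 and
        second moment at most 2 this leaves 1 - 2 / 4 for the mean of min 1 L.\<close>
      have "0 \<le> (L \<omega> / 2 - 1)\<^sup>2" by simp
      then have "L \<omega> \<le> min 1 (L \<omega>) + 1 / 4 * (L \<omega>)\<^sup>2"
        by (auto simp: min_def power2_eq_square algebra_simps)
      then show "ennreal (L \<omega>) \<le> ennreal (min 1 (L \<omega>)) + ennreal (1 / 4) * ennreal ((L \<omega>)\<^sup>2)"
        using L0[of \<omega>] ennreal_leI[of "L \<omega>" "min 1 (L \<omega>) + 1 / 4 * (L \<omega>)\<^sup>2"]
        by (simp add: ennreal_plus ennreal_mult[symmetric])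
    qed
    also have "\<dots> = (\<integral>\<^sup>+\<omega>. ennreal (min 1 (L \<omega>)) \<partial>P) + ennreal (1 / 4) * (\<integral>\<^sup>+\<omega>. ennreal ((L \<omega>)\<^sup>2) \<partial>P)"
      by (subst nn_integral_add) (auto simp: nn_integral_cmult)
    also have "\<dots> \<le> (\<integral>\<^sup>+\<omega>. ennreal (min 1 (L \<omega>)) \<partial>P) + ennreal (1 / 4) * ennreal 2"
      using IL2 by (intro add_left_mono mult_left_mono) auto
    also have "ennreal (1 / 4) * ennreal 2 = ennreal (1 / 2)"
      by (subst ennreal_mult[symmetric]) auto
    finally have *: "1 \<le> (\<integral>\<^sup>+\<omega>. ennreal (min 1 (L \<omega>)) \<partial>P) + ennreal (1 / 2)" .
    show ?thesis
    proof (cases "\<integral>\<^sup>+\<omega>. ennreal (min 1 (L \<omega>)) \<partial>P")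
      case (real x)
      then have "ennreal 1 \<le> ennreal (x + 1 / 2)"
        using * by (simp add: ennreal_plus del: ennreal_half)
      then have "1 / 2 \<le> x" using real by (subst (asm) ennreal_le_iff) auto
      then have "ennreal (1 / 2) \<le> ennreal x" by (rule ennreal_leI)
      then show ?thesis unfolding real by (simp add: divide_ennreal_def)
    qed (simp add: top_unique)
  qed
  have "D / 2 = D * (1 / 2)" by (simp add: ennreal_times_divide)
  also have "\<dots> \<le> D * (\<integral>\<^sup>+\<omega>. ennreal (min 1 (L \<omega>)) \<partial>P)"
    by (intro mult_left_mono Imin) auto
  also have "\<dots> = (\<integral>\<^sup>+\<omega>. D * ennreal (min 1 (L \<omega>)) \<partial>P)"
    by (rule nn_integral_cmult[symmetric]) measurable
  also have "\<dots> \<le> (\<integral>\<^sup>+\<omega>. A (T \<omega>) + ennreal (L \<omega>) * B (T \<omega>) \<partial>P)"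
  proof (rule nn_integral_mono)
    fix \<omega>
    have "D * ennreal (min 1 (L \<omega>)) \<le> (A (T \<omega>) + B (T \<omega>)) * ennreal (min 1 (L \<omega>))"
      by (intro mult_right_mono AB) auto
    also have "\<dots> = ennreal (min 1 (L \<omega>)) * A (T \<omega>) + ennreal (min 1 (L \<omega>)) * B (T \<omega>)"
      by (simp add: algebra_simps)
    also have "\<dots> \<le> 1 * A (T \<omega>) + ennreal (L \<omega>) * B (T \<omega>)"
      by (intro add_mono mult_right_mono) (auto simp: ennreal_leI)
    finally show "D * ennreal (min 1 (L \<omega>)) \<le> A (T \<omega>) + ennreal (L \<omega>) * B (T \<omega>)" by simp
  qed
  also have "\<dots> = (\<integral>\<^sup>+\<omega>. A (T \<omega>) \<partial>P) + (\<integral>\<^sup>+\<omega>. ennreal (L \<omega>) * B (T \<omega>) \<partial>P)"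
    by (rule nn_integral_add) measurable
  finally show ?thesis by (simp add: A B)
qed

subsection \<open>A band-limited kernel\<close>

lemma integrable_inverse_1_plus_sq: "integrable lborel (\<lambda>x::real. 1 / (1 + x\<^sup>2))"
  using integrable_inverse_1_plus_square
  by (simp add: set_integrable_def einterval_def inverse_eq_divide)

lemma gaussian_fourier:
  fixes \<delta> v :: real
  assumes "0 < \<delta>"
  shows "(CLBINT t. of_real (exp (- (\<delta>\<^sup>2 * t\<^sup>2 / 2))) * iexp (t * v)) = of_real (sqrt (2 * pi) / \<delta> * exp (- (v\<^sup>2 / (2 * \<delta>\<^sup>2))))"
proof -
  have *: "(CLBINT y. of_real (exp (- (y\<^sup>2 / 2))) * iexp (w * y)) = of_real (sqrt (2 * pi) * exp (- (w\<^sup>2 / 2)))" for w :: real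
  proof -
    have "char std_normal_distribution w = (CLBINT y. std_normal_density y *\<^sub>R iexp (w * y))"
      unfolding char_def by (rule integral_density) auto
    also have "\<dots> = (CLBINT y. of_real (1 / sqrt (2 * pi)) * (of_real (exp (- (y\<^sup>2 / 2))) * iexp (w * y)))"
      by (intro Bochner_Integration.integral_cong) (simp_all add: std_normal_density_def scaleR_conv_of_real)
    also have "\<dots> = of_real (1 / sqrt (2 * pi)) * (CLBINT y. of_real (exp (- (y\<^sup>2 / 2))) * iexp (w * y))"
      by (rule integral_mult_right_zero)
    finally have "of_real (exp (- (w\<^sup>2 / 2))) = of_real (1 / sqrt (2 * pi)) * (CLBINT y. of_real (exp (- (y\<^sup>2 / 2))) * iexp (w * y))"
      by (simp add: char_std_normal_distribution)
    then show ?thesis by (simp add: field_simps)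
  qed
  have "(CLBINT t. of_real (exp (- (\<delta>\<^sup>2 * t\<^sup>2 / 2))) * iexp (t * v)) =
      \<bar>1 / \<delta>\<bar> *\<^sub>R (CLBINT y. of_real (exp (- (\<delta>\<^sup>2 * (0 + 1 / \<delta> * y)\<^sup>2 / 2))) * iexp ((0 + 1 / \<delta> * y) * v))"
    by (rule lborel_integral_real_affine) (use assms in simp)
  also have "\<dots> = (1 / \<delta>) *\<^sub>R (CLBINT y. of_real (exp (- (y\<^sup>2 / 2))) * iexp (v / \<delta> * y))"
    using assms by (simp add: power_divide mult.commute)
  also have "\<dots> = of_real (sqrt (2 * pi) / \<delta> * exp (- (v\<^sup>2 / (2 * \<delta>\<^sup>2))))"
    unfolding * using assms by (simp add: scaleR_conv_of_real power_divide mult.commute)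
  finally show ?thesis .
qed

lemma integrable_gaussian:
  fixes \<delta> :: real
  assumes "0 < \<delta>"
  shows "integrable lborel (\<lambda>t. exp (- (\<delta>\<^sup>2 * t\<^sup>2 / 2)))"
proof (rule Bochner_Integration.integrable_bound)
  show "integrable lborel (\<lambda>t. (1 + 2 / \<delta>\<^sup>2) * (1 / (1 + t\<^sup>2)))"
    by (intro integrable_mult_right integrable_inverse_1_plus_sq)
  show "AE t in lborel. norm (exp (- (\<delta>\<^sup>2 * t\<^sup>2 / 2))) \<le> norm ((1 + 2 / \<delta>\<^sup>2) * (1 / (1 + t\<^sup>2)))"
  proof (rule AE_I2)
    fix t :: real
    let ?y = "\<delta>\<^sup>2 * t\<^sup>2 / 2"
    have "exp (- ?y) * (1 + ?y) \<le> exp (- ?y) * exp ?y"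
      by (intro mult_left_mono) auto
    then have "exp (- ?y) * (1 + ?y) \<le> 1" by (simp add: exp_minus)
    moreover have "exp (- ?y) \<le> 1" by simp
    moreover have "t\<^sup>2 = 2 / \<delta>\<^sup>2 * ?y" using assms by simp
    then have "exp (- ?y) * (1 + t\<^sup>2) = exp (- ?y) + 2 / \<delta>\<^sup>2 * (exp (- ?y) * ?y)"
      by (simp only: distrib_left mult_1_right mult.left_commute[of "2 / \<delta>\<^sup>2"])
    moreover have "exp (- ?y) * ?y \<le> 1"
    proof -
      have "exp (- ?y) * (1 + ?y) = exp (- ?y) + exp (- ?y) * ?y" by (rule distrib_left[THEN trans]) simp
      with \<open>exp (- ?y) * (1 + ?y) \<le> 1\<close> show ?thesis using exp_gt_zero[of "- ?y"] by linarith
    qed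
    then have "2 / \<delta>\<^sup>2 * (exp (- ?y) * ?y) \<le> 2 / \<delta>\<^sup>2 * 1"
      using assms by (intro mult_left_mono) auto
    ultimately have "exp (- ?y) * (1 + t\<^sup>2) \<le> 1 + 2 / \<delta>\<^sup>2" by linarith
    then have "exp (- ?y) \<le> (1 + 2 / \<delta>\<^sup>2) / (1 + t\<^sup>2)"
      by (subst pos_le_divide_eq) (auto simp: add_pos_nonneg)
    then show "norm (exp (- ?y)) \<le> norm ((1 + 2 / \<delta>\<^sup>2) * (1 / (1 + t\<^sup>2)))"
      by simp
  qed
qed simp

text \<open>Inserting a Gaussian factor and letting its width grow avoids Fourier inversion.\<close>
lemma fourier_of_char:
  assumes "real_distribution M" and int: "complex_integrable lborel (char M)"
    and supp: "AE x in M. \<bar>x\<bar> \<le> a"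
  shows "(CLBINT t. char M t * iexp (t * u)) \<in> \<real>\<^sub>\<ge>\<^sub>0"
    and "a < \<bar>u\<bar> \<Longrightarrow> (CLBINT t. char M t * iexp (t * u)) = 0"
proof -
  interpret real_distribution M by fact
  interpret pair_sigma_finite M lborel by standard
  let ?\<phi> = "char M"
  define g where "g = (\<lambda>n t. exp (- ((1 / Suc n)\<^sup>2 * t\<^sup>2 / 2)) :: real)"
  \<comment> \<open>This is 2 \<pi> times the density at - u of \<open>M\<close> convolved with a
    centred Gaussian of standard deviation 1 / Suc n; Fubini will identify it with the damped
    integral. Nonnegativity is then visible.\<close>
  define c where "c = (\<lambda>n. LINT x|M. sqrt (2 * pi) * Suc n * exp (- ((x + u)\<^sup>2 * (Suc n)\<^sup>2 / 2)))"
  have g_meas [measurable]: "g n \<in> borel_measurable borel" for n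
    unfolding g_def by measurable
  have g01: "0 < g n t" "g n t \<le> 1" for n t
    unfolding g_def by auto
  have int_g: "integrable lborel (g n)" for n
    unfolding g_def by (rule integrable_gaussian) simp
  have lim: "(\<lambda>n. CLBINT t. ?\<phi> t * iexp (t * u) * g n t) \<longlonglongrightarrow> (CLBINT t. ?\<phi> t * iexp (t * u))"
  proof (rule integral_dominated_convergence[where w = "\<lambda>t. norm (?\<phi> t)"])
    show "integrable lborel (\<lambda>t. norm (?\<phi> t))" using int by (rule integrable_norm)
    show "AE t in lborel. (\<lambda>n. ?\<phi> t * iexp (t * u) * g n t) \<longlonglongrightarrow> ?\<phi> t * iexp (t * u)"
    proof (rule AE_I2)
      fix t
      have "(\<lambda>n. 1 / real (Suc n)) \<longlonglongrightarrow> 0" by (rule LIMSEQ_Suc[OF lim_1_over_n])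
      then have "(\<lambda>n. g n t) \<longlonglongrightarrow> exp (- (0\<^sup>2 * t\<^sup>2 / 2))"
        unfolding g_def by (intro tendsto_intros) auto
      then have "(\<lambda>n. ?\<phi> t * iexp (t * u) * of_real (g n t)) \<longlonglongrightarrow> ?\<phi> t * iexp (t * u) * of_real (exp (- (0\<^sup>2 * t\<^sup>2 / 2)))"
        by (intro tendsto_intros)
      then show "(\<lambda>n. ?\<phi> t * iexp (t * u) * g n t) \<longlonglongrightarrow> ?\<phi> t * iexp (t * u)" by simp
    qed
    show "AE t in lborel. norm (?\<phi> t * iexp (t * u) * g n t) \<le> norm (?\<phi> t)" for n
      using g01[of n] by (intro AE_I2) (auto simp: norm_mult abs_of_pos intro!: mult_left_le simp del: of_real_mult)
  qed (auto simp del: of_real_mult)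
  have eq: "(CLBINT t. ?\<phi> t * iexp (t * u) * g n t) = of_real (c n)" for n
  proof -
    let ?F = "\<lambda>x t. iexp (t * x) * (iexp (t * u) * of_real (g n t))"
    have nF: "norm (?F x t) = g n t" for x t
      using g01[of n t] by (simp add: norm_mult del: of_real_mult)
    have int_F: "integrable (M \<Otimes>\<^sub>M lborel) (case_prod ?F)"
    proof (rule Fubini_integrable)
      show "case_prod ?F \<in> borel_measurable (M \<Otimes>\<^sub>M lborel)" by measurable
      show "integrable M (\<lambda>x. \<integral>y. norm (case_prod ?F (x, y)) \<partial>lborel)"
        by (simp add: nF del: of_real_mult)
      show "AE x in M. integrable lborel (\<lambda>y. case_prod ?F (x, y))"
      proof (rule AE_I2)
        fix x
        show "integrable lborel (\<lambda>y. case_prod ?F (x, y))"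
          by (rule Bochner_Integration.integrable_bound[OF int_g[of n]])
            (use g01[of n] in \<open>auto simp: norm_mult less_imp_le simp del: of_real_mult\<close>)
      qed
    qed
    have "(CLBINT t. ?\<phi> t * iexp (t * u) * g n t) = (CLBINT t. (CLINT x|M. ?F x t))"
      unfolding char_def
      by (subst integral_mult_left_zero) (simp add: mult.assoc del: of_real_mult)
    also have "\<dots> = (CLINT x|M. (CLBINT t. ?F x t))"
      by (rule Fubini_integral[OF int_F])
    also have "\<dots> = (CLINT x|M. of_real (sqrt (2 * pi) * Suc n * exp (- ((x + u)\<^sup>2 * (Suc n)\<^sup>2 / 2))))"
    proof (rule Bochner_Integration.integral_cong[OF refl])
      fix x
      have "(CLBINT t. ?F x t) = (CLBINT t. of_real (exp (- ((1 / Suc n)\<^sup>2 * t\<^sup>2 / 2))) * iexp (t * (x + u)))"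
        unfolding g_def
        by (intro Bochner_Integration.integral_cong refl)
          (simp add: distrib_left exp_add mult_ac)
      also have "\<dots> = of_real (sqrt (2 * pi) / (1 / Suc n) * exp (- ((x + u)\<^sup>2 / (2 * (1 / Suc n)\<^sup>2))))"
        by (rule gaussian_fourier) simp
      also have "(x + u)\<^sup>2 / (2 * (1 / Suc n)\<^sup>2) = (x + u)\<^sup>2 * (Suc n)\<^sup>2 / 2"
        by (simp add: power_divide)
      finally show "(CLBINT t. ?F x t) = of_real (sqrt (2 * pi) * Suc n * exp (- ((x + u)\<^sup>2 * (Suc n)\<^sup>2 / 2)))"
        by simp
    qed
    also have "\<dots> = of_real (c n)"
      unfolding c_def by (rule integral_complex_of_real)
    finally show ?thesis .
  qed
  have lim': "(\<lambda>n. of_real (c n)) \<longlonglongrightarrow> (CLBINT t. ?\<phi> t * iexp (t * u))"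
    using lim unfolding eq .
  have c0: "0 \<le> c n" for n
    unfolding c_def by (intro Bochner_Integration.integral_nonneg) auto
  show "(CLBINT t. ?\<phi> t * iexp (t * u)) \<in> \<real>\<^sub>\<ge>\<^sub>0"
    using lim' c0 by (intro Lim_in_closed_set[OF closed_nonneg_Reals_complex _ _ lim']) auto
  assume u: "a < \<bar>u\<bar>"
  define e where "e = (\<bar>u\<bar> - a)\<^sup>2"
  have e: "0 < e" using u by (simp add: e_def)
  \<comment> \<open>At distance at least |u| - a from the support, exp (- y) \<le> 1 / y with y of
    order (Suc n)^2 outweighs the factor \<open>Suc n\<close> in \<open>c\<close>.\<close>
  have c_le: "c n \<le> 2 * sqrt (2 * pi) / e * (1 / Suc n)" for n
  proof -
    have ineq: "sqrt (2 * pi) * Suc n * exp (- ((x + u)\<^sup>2 * (Suc n)\<^sup>2 / 2)) \<le> 2 * sqrt (2 * pi) / e * (1 / Suc n)"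
      if "\<bar>x\<bar> \<le> a" for x
    proof -
      have "\<bar>u\<bar> - a \<le> \<bar>x + u\<bar>" using that by linarith
      then have "e \<le> (x + u)\<^sup>2" unfolding e_def using u by (subst abs_le_square_iff[symmetric]) auto
      then have "e * (Suc n)\<^sup>2 / 2 \<le> (x + u)\<^sup>2 * (Suc n)\<^sup>2 / 2"
        by (intro divide_right_mono mult_right_mono) auto
      then have "exp (- ((x + u)\<^sup>2 * (Suc n)\<^sup>2 / 2)) \<le> exp (- (e * (Suc n)\<^sup>2 / 2))" by simp
      also have "\<dots> \<le> 1 / (e * (Suc n)\<^sup>2 / 2)"
      proof -
        have pos: "0 < e * (Suc n)\<^sup>2 / 2" using e by simp
        have "e * (Suc n)\<^sup>2 / 2 \<le> exp (e * (Suc n)\<^sup>2 / 2)"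
          using exp_ge_add_one_self[of "e * (Suc n)\<^sup>2 / 2"] by linarith
        then have "inverse (exp (e * (Suc n)\<^sup>2 / 2)) \<le> inverse (e * (Suc n)\<^sup>2 / 2)"
          using pos by (rule le_imp_inverse_le)
        then show ?thesis by (simp add: exp_minus inverse_eq_divide)
      qed
      finally have "sqrt (2 * pi) * Suc n * exp (- ((x + u)\<^sup>2 * (Suc n)\<^sup>2 / 2))
          \<le> sqrt (2 * pi) * Suc n * (1 / (e * (Suc n)\<^sup>2 / 2))"
        by (intro mult_left_mono) auto
      also have "\<dots> = 2 * sqrt (2 * pi) / e * (1 / Suc n)"
        using e by (simp add: divide_simps del: of_nat_Suc) (simp add: power2_eq_square)
      finally show ?thesis .
    qed
    have "c n \<le> (LINT x|M. 2 * sqrt (2 * pi) / e * (1 / Suc n))"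
      unfolding c_def
    proof (rule integral_mono_AE)
      show "integrable M (\<lambda>x. sqrt (2 * pi) * Suc n * exp (- ((x + u)\<^sup>2 * (Suc n)\<^sup>2 / 2)))"
        by (rule integrable_const_bound[where B = "sqrt (2 * pi) * Suc n"]) (auto simp: mult_left_le)
      show "AE x in M. sqrt (2 * pi) * Suc n * exp (- ((x + u)\<^sup>2 * (Suc n)\<^sup>2 / 2)) \<le> 2 * sqrt (2 * pi) / e * (1 / Suc n)"
        using supp by eventually_elim (rule ineq)
    qed simp
    then show ?thesis by (simp add: prob_space del: space_eq_univ)
  qed
  have "c \<longlonglongrightarrow> 0"
  proof (rule tendsto_sandwich[OF _ _ tendsto_const])
    show "(\<lambda>n. 2 * sqrt (2 * pi) / e * (1 / Suc n)) \<longlonglongrightarrow> 0"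
      by (intro tendsto_mult_right_zero LIMSEQ_Suc[OF lim_1_over_n])
  qed (use c0 c_le in auto)
  then have "(\<lambda>n. complex_of_real (c n)) \<longlonglongrightarrow> of_real 0"
    by (rule tendsto_of_real)
  with lim' show "(CLBINT t. ?\<phi> t * iexp (t * u)) = 0"
    by (metis LIMSEQ_unique of_real_0)
qed

section \<open>The fourth power of sinc and its transform\<close>

definition uniform_law :: "real measure" where
  "uniform_law = density lborel (\<lambda>x. ennreal (indicator {-1..1} x / 2))"

lemma real_distribution_uniform_law: "real_distribution uniform_law"
proof -
  have "prob_space uniform_law"
  proof (rule prob_spaceI)
    have "emeasure uniform_law (space uniform_law) = (\<integral>\<^sup>+x. ennreal (1 / 2) * indicator {-1..1::real} x \<partial>lborel)"
      unfolding uniform_law_def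
      by (subst emeasure_density) (auto intro!: nn_integral_cong simp: indicator_def)
    also have "\<dots> = ennreal (1 / 2) * 2"
      by (subst nn_integral_cmult_indicator) auto
    also have "\<dots> = ennreal (1 / 2) * ennreal 2" by simp
    also have "\<dots> = 1" by (subst ennreal_mult[symmetric]) auto
    finally show "emeasure uniform_law (space uniform_law) = 1" .
  qed
  then show ?thesis
    by (simp add: real_distribution_def real_distribution_axioms_def uniform_law_def)
qed

lemma char_uniform_law: "char uniform_law t = of_real (sinc t)"
proof -
  have "char uniform_law t = (CLBINT x. (indicator {-1..1} x / 2) *\<^sub>R iexp (t * x))"
    unfolding char_def uniform_law_def by (rule integral_density) auto
  also have "\<dots> = (CLBINT x. of_real (1 / 2) * (indicator {-1..1} x *\<^sub>R iexp (t * x)))"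
    by (intro Bochner_Integration.integral_cong) (auto simp: indicator_def scaleR_conv_of_real)
  also have "\<dots> = of_real (1 / 2) * (CLBINT x. indicator {-1..1} x *\<^sub>R iexp (t * x))"
    by (rule integral_mult_right_zero)
  also have "(CLBINT x. indicator {-1..1} x *\<^sub>R iexp (t * x)) = 2 * of_real (sinc t)"
  proof (cases "t = 0")
    case True
    then have "(CLBINT x. indicator {-1..1::real} x *\<^sub>R iexp (t * x)) = (CLBINT x. complex_of_real (indicator {-1..1::real} x))"
      by (intro Bochner_Integration.integral_cong) (auto simp: indicator_def)
    also have "\<dots> = of_real (LBINT x. indicator {-1..1::real} x)"
      by (rule integral_complex_of_real)
    finally show ?thesis using True by simp
  next
    case False
    have "((\<lambda>x. iexp (t * x) / (\<i> * t)) has_vector_derivative iexp (t * x)) (at x within {-1..1})" for x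
    proof -
      have "((\<lambda>z. exp (\<i> * (t * z)) / (\<i> * t)) has_field_derivative exp (\<i> * (t * of_real x))) (at (of_real x))"
        using False by (auto intro!: derivative_eq_intros simp: mult_ac)
      from has_vector_derivative_real_field[OF this]
      show ?thesis by (simp add: o_def)
    qed
    then have "(CLBINT x. indicator {-1..1} x *\<^sub>R iexp (t * x)) = iexp (t * 1) / (\<i> * t) - iexp (t * (-1)) / (\<i> * t)"
      by (intro integral_FTC_Icc) (auto intro!: continuous_intros)
    also have "\<dots> = 2 * of_real (sin t / t)"
      using False by (simp add: exp_Euler cos_of_real sin_of_real exp_minus_Euler field_simps)
    finally show ?thesis using False by simp
  qed
  finally show ?thesis by simp
qed

lemma AE_sum_uniform_law: "AE x in sum_law K uniform_law. \<bar>x\<bar> \<le> K"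
proof -
  interpret U: real_distribution uniform_law by (rule real_distribution_uniform_law)
  have "AE x in uniform_law. \<bar>x\<bar> \<le> 1"
    unfolding uniform_law_def
    by (subst AE_density) (auto intro!: AE_I2 simp: indicator_def split: if_splits)
  then have "AE \<omega> in (\<Pi>\<^sub>M k\<in>{..<K}. uniform_law). \<bar>\<omega> k\<bar> \<le> 1" if "k < K" for k
    using that by (intro AE_PiM_component U.prob_space_axioms) auto
  then have "AE \<omega> in (\<Pi>\<^sub>M k\<in>{..<K}. uniform_law). \<forall>k\<in>{..<K}. \<bar>\<omega> k\<bar> \<le> 1"
    by (intro AE_finite_allI) auto
  then have "AE \<omega> in (\<Pi>\<^sub>M k\<in>{..<K}. uniform_law). \<bar>\<Sum>k<K. \<omega> k\<bar> \<le> K"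
  proof eventually_elim
    case (elim \<omega>)
    have "\<bar>\<Sum>k<K. \<omega> k\<bar> \<le> (\<Sum>k<K. \<bar>\<omega> k\<bar>)" by (rule sum_abs)
    also have "\<dots> \<le> (\<Sum>k<K. 1)" using elim by (intro sum_mono) auto
    finally show ?case by simp
  qed
  then show ?thesis
    unfolding sum_law_def
    by (subst AE_distr_iff) (auto intro: measurable_sum_coordinates)
qed

lemma sinc_squared_le: "(sinc x)\<^sup>2 \<le> 2 / (1 + x\<^sup>2)"
proof (cases "x = 0")
  case False
  have 1: "(sin x)\<^sup>2 \<le> x\<^sup>2"
    using power_mono[OF abs_sin_x_le_abs_x[of x], of 2] by simp
  have "(sin x)\<^sup>2 \<le> 1" using power_mono[OF abs_sin_le_one[of x], of 2] by simp
  then have "(sin x)\<^sup>2 * x\<^sup>2 \<le> 1 * x\<^sup>2" by (intro mult_right_mono) auto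
  with 1 have "(sin x)\<^sup>2 * (1 + x\<^sup>2) \<le> 2 * x\<^sup>2" by (simp add: algebra_simps)
  then have "(sin x)\<^sup>2 / x\<^sup>2 \<le> 2 / (1 + x\<^sup>2)"
    using False by (simp add: field_simps add_pos_pos)
  then show ?thesis using False by (simp add: power_divide)
qed simp

text \<open>The characteristic function of a sum of four uniform variables on [-1, 1]. A square
  would already be nonnegative with compactly supported transform, but x^2 (sinc x)^2 is not
  integrable, and the class demands a second moment.\<close>

definition sinc4 :: "real \<Rightarrow> real" where "sinc4 x = sinc x ^ 4"

lemma sinc4_measurable [measurable]: "sinc4 \<in> borel_measurable borel"
  unfolding sinc4_def by measurable

lemma sinc4_nonneg: "0 \<le> sinc4 x"
  unfolding sinc4_def by simp

lemma sinc4_le: "(1 + x\<^sup>2) * sinc4 x \<le> 4 * (1 / (1 + x\<^sup>2))"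
proof -
  have "sinc4 x = (sinc x)\<^sup>2 * (sinc x)\<^sup>2" by (simp add: sinc4_def power2_eq_square power4_eq_xxxx)
  also have "\<dots> \<le> 2 / (1 + x\<^sup>2) * (2 / (1 + x\<^sup>2))"
    by (intro mult_mono sinc_squared_le) auto
  finally have "(1 + x\<^sup>2) * sinc4 x \<le> (1 + x\<^sup>2) * (2 / (1 + x\<^sup>2) * (2 / (1 + x\<^sup>2)))"
    by (intro mult_left_mono) auto
  moreover have "1 + x\<^sup>2 > 0" by (simp add: add_pos_nonneg)
  ultimately show ?thesis
    by (simp only: times_divide_eq_right times_divide_eq_left nonzero_mult_div_cancel_left)
qed

lemma sinc4_le_1: "sinc4 x \<le> 1"
proof -
  have "\<bar>sinc x\<bar> \<le> 1" using abs_sin_x_le_abs_x[of x] by (simp add: divide_le_eq)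
  then have "\<bar>sinc x\<bar> ^ 4 \<le> 1" by (intro power_le_one) auto
  then show ?thesis by (simp add: sinc4_def)
qed

lemma integrable_sinc4_weighted: "integrable lborel (\<lambda>x. (1 + x\<^sup>2) * sinc4 x)"
proof (rule Bochner_Integration.integrable_bound)
  show "integrable lborel (\<lambda>x::real. 4 * (1 / (1 + x\<^sup>2)))"
    by (intro integrable_mult_right integrable_inverse_1_plus_sq)
  show "AE x in lborel. norm ((1 + x\<^sup>2) * sinc4 x) \<le> norm (4 * (1 / (1 + x\<^sup>2)))"
    using sinc4_le by (intro AE_I2) (auto simp: abs_mult sinc4_nonneg abs_of_nonneg)
qed measurable

lemma integrable_sinc4: "integrable lborel sinc4" "integrable lborel (\<lambda>x. x\<^sup>2 * sinc4 x)"
  by (rule Bochner_Integration.integrable_bound[OF integrable_sinc4_weighted];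
      simp add: abs_mult sinc4_nonneg algebra_simps)+

lemma sinc4_pos: obtains c where "0 < c" "\<And>x. \<bar>x\<bar> \<le> 1 \<Longrightarrow> c \<le> sinc4 x"
proof -
  have "\<exists>x\<in>{-1..1}. \<forall>y\<in>{-1..1}. sinc4 x \<le> sinc4 y"
    unfolding sinc4_def
    by (intro continuous_attains_inf continuous_intros) auto
  then obtain z where z: "z \<in> {-1..1}" "\<And>y. y \<in> {-1..1} \<Longrightarrow> sinc4 z \<le> sinc4 y" by blast
  have "sinc z \<noteq> 0"
  proof (cases "z = 0")
    case False
    have "0 < sin \<bar>z\<bar>" using z False pi_gt3 by (intro sin_gt_zero) auto
    then have "sin z \<noteq> 0" by (auto simp: abs_if split: if_splits)
    then show ?thesis using False by simp
  qed simp
  then have "0 < sinc4 z" using sinc4_nonneg[of z] by (simp add: sinc4_def less_le)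
  with z show thesis by (intro that[of "sinc4 z"]) (auto simp: abs_le_iff)
qed

text \<open>Up to the factor 2 \<pi> this is the density of the sum of four uniform variables on
  [-1, 1], a cubic B-spline. The integral form lets \<open>fourier_of_char\<close> supply its sign
  and support without the piecewise polynomial.\<close>

definition spline :: "real \<Rightarrow> real" where
  "spline u = Re (CLBINT t. sinc4 t * iexp (u * t))"

lemma spline_fourier: "(CLBINT t. sinc4 t * iexp (u * t)) = spline u"
  and spline_nonneg: "0 \<le> spline u"
  and spline_eq_0: "4 < \<bar>u\<bar> \<Longrightarrow> spline u = 0"
proof -
  have char: "char (sum_law 4 uniform_law) t = of_real (sinc4 t)" for t
    by (simp add: char_sum_law[OF real_distribution_uniform_law] char_uniform_law sinc4_def flip: of_real_power)
  have int: "complex_integrable lborel (char (sum_law 4 uniform_law))"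
    using integrable_sinc4(1) by (simp add: char[abs_def] complex_of_real_integrable_eq)
  note F = fourier_of_char[OF real_distribution_sum_law[OF real_distribution_uniform_law] int, of "4" u]
  have AE: "AE x in sum_law 4 uniform_law. \<bar>x\<bar> \<le> 4" using AE_sum_uniform_law[of 4] by simp
  have N: "(CLBINT t. sinc4 t * iexp (u * t)) \<in> \<real>\<^sub>\<ge>\<^sub>0"
    and Z: "4 < \<bar>u\<bar> \<Longrightarrow> (CLBINT t. sinc4 t * iexp (u * t)) = 0"
    using F[OF AE] by (simp_all only: char mult.commute[of u])
  show "(CLBINT t. sinc4 t * iexp (u * t)) = spline u"
    using N by (auto simp: spline_def complex_eq_iff elim!: nonneg_Reals_cases)
  show "0 \<le> spline u" using N by (auto simp: spline_def elim!: nonneg_Reals_cases)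
  show "spline u = 0" if "4 < \<bar>u\<bar>" using Z[OF that] by (simp add: spline_def)
qed

lemma spline_pos: obtains \<eta> c where "0 < \<eta>" "0 < c" "\<And>u. \<bar>u\<bar> \<le> \<eta> \<Longrightarrow> c \<le> spline u"
proof -
  obtain a where a: "0 < a" "\<And>x. \<bar>x\<bar> \<le> 1 \<Longrightarrow> a \<le> sinc4 x" using sinc4_pos by blast
  let ?I = "LBINT t. sinc4 t" and ?J = "LBINT t. t\<^sup>2 * sinc4 t"
  have "(LBINT t. a * indicator {-1..1::real} t) \<le> ?I"
  proof (rule integral_mono)
    show "integrable lborel (\<lambda>t. a * indicator {-1..1::real} t)" by simp
    show "a * indicator {-1..1} t \<le> sinc4 t" for t
      using a sinc4_nonneg[of t] by (auto simp: indicator_def abs_le_iff)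
  qed (rule integrable_sinc4)
  then have I: "0 < ?I" using a by simp
  have J: "0 \<le> ?J" by (intro Bochner_Integration.integral_nonneg) (simp add: sinc4_nonneg)
  have lower: "?I - u\<^sup>2 / 2 * ?J \<le> spline u" for u
  proof -
    have cos_ge: "1 - y\<^sup>2 / 2 \<le> cos y" for y :: real
    proof -
      have "\<bar>sin (y / 2)\<bar>\<^sup>2 \<le> \<bar>y / 2\<bar>\<^sup>2"
        by (rule power_mono[OF abs_sin_x_le_abs_x]) simp
      then show ?thesis
        using cos_double_sin[of "y / 2"] by (simp add: power2_eq_square)
    qed
    have int_e: "complex_integrable lborel (\<lambda>t. sinc4 t * iexp (u * t))"
      by (rule Bochner_Integration.integrable_bound[OF integrable_sinc4(1)])
        (auto simp: norm_mult sinc4_nonneg simp del: of_real_mult)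
    have re: "Re (sinc4 t * iexp (u * t)) = sinc4 t * cos (u * t)" for t
      by (simp add: Re_exp)
    have "?I - u\<^sup>2 / 2 * ?J = (LBINT t. sinc4 t - u\<^sup>2 / 2 * (t\<^sup>2 * sinc4 t))"
      using integrable_sinc4 by simp
    also have "\<dots> \<le> (LBINT t. sinc4 t * cos (u * t))"
    proof (rule integral_mono)
      show "integrable lborel (\<lambda>t. sinc4 t - u\<^sup>2 / 2 * (t\<^sup>2 * sinc4 t))"
        using integrable_sinc4 by simp
      show "integrable lborel (\<lambda>t. sinc4 t * cos (u * t))"
        using integrable_Re[OF int_e] by (simp only: re)
      fix t
      have "sinc4 t * (1 - (u * t)\<^sup>2 / 2) \<le> sinc4 t * cos (u * t)"
        by (intro mult_left_mono cos_ge sinc4_nonneg)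
      then show "sinc4 t - u\<^sup>2 / 2 * (t\<^sup>2 * sinc4 t) \<le> sinc4 t * cos (u * t)"
        by (simp add: algebra_simps power_mult_distrib)
    qed
    also have "\<dots> = spline u"
      unfolding spline_def integral_Re[OF int_e, symmetric] re ..
    finally show ?thesis .
  qed
  \<comment> \<open>Chosen so that the loss \<eta>^2 J / 2 in \<open>lower\<close> is at most half
    of \<open>?I\<close>; the summand 1 keeps the denominator positive.\<close>
  define \<eta> where "\<eta> = sqrt (?I / (?J + 1))"
  have \<eta>2: "\<eta>\<^sup>2 = ?I / (?J + 1)" using I J by (simp add: \<eta>_def)
  show thesis
  proof (rule that[of \<eta> "?I / 2"])
    show "0 < \<eta>" unfolding \<eta>_def using I J by simp
    fix u assume "\<bar>u\<bar> \<le> \<eta>"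
    then have "\<bar>u\<bar>\<^sup>2 \<le> \<eta>\<^sup>2" by (intro power_mono) auto
    then have "u\<^sup>2 / 2 * ?J \<le> ?I / (?J + 1) / 2 * ?J"
      unfolding \<eta>2 using J by (intro mult_right_mono divide_right_mono) auto
    also have "\<dots> \<le> ?I / 2" using I J by (simp add: field_simps)
    finally show "?I / 2 \<le> spline u" using lower[of u] by linarith
  qed (use I in simp)
qed

text \<open>Each requirement serves one later bound: the weighted integrability gives the second
  moment, \<open>D\<close> the L2 norm, \<open>s_ge\<close> the distance of the hypotheses through
  orthogonality over one period, \<open>B_ge\<close> the lower bound on characteristic functions,
  since every point has an integer within distance 1, and \<open>B_eq_0\<close> the locality in
  frequency.\<close>

locale band_limited_kernel =
  fixes s B :: "real \<Rightarrow> real" and L c D :: real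
  assumes s_measurable [measurable]: "s \<in> borel_measurable borel"
    and s_nonneg: "0 \<le> s x" and s_le: "s x \<le> D"
    and integrable_s_weighted: "integrable lborel (\<lambda>x. (1 + x\<^sup>2) * s x)"
    and fourier_s: "(CLBINT x. s x * iexp (u * x)) = of_real (B u)"
    and B_nonneg: "0 \<le> B u" and B_eq_0: "L \<le> \<bar>u\<bar> \<Longrightarrow> B u = 0"
    and c_pos: "0 < c" and s_ge: "\<bar>x\<bar> \<le> pi \<Longrightarrow> c \<le> s x" and B_ge: "\<bar>u\<bar> \<le> 1 \<Longrightarrow> c \<le> B u"
    and L_pos: "1 \<le> L"

text \<open>The wide summand is positive on \<open>[-\<pi>, \<pi>]\<close>; the narrow one has a wide Fourier transform.\<close>
lemma band_limited_kernel_exists: "\<exists>s B L c D. band_limited_kernel s B L c D"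
proof -
  obtain c1 where c1: "0 < c1" "\<And>x. \<bar>x\<bar> \<le> 1 \<Longrightarrow> c1 \<le> sinc4 x" using sinc4_pos by blast
  obtain \<eta> c2 where c2: "0 < \<eta>" "0 < c2" "\<And>u. \<bar>u\<bar> \<le> \<eta> \<Longrightarrow> c2 \<le> spline u" using spline_pos by blast
  \<comment> \<open>Stretching the transform by \<open>N\<close> brings all of [-1, 1] into the
    interval on which \<open>spline\<close> is known to be at least \<open>c2\<close>.\<close>
  define N where "N = max 1 (1 / \<eta>)"
  have N: "1 \<le> N" "1 / N \<le> \<eta>" using c2 by (auto simp: N_def field_simps max_def)
  \<comment> \<open>The dilation 1 / 4 maps [-\<pi>, \<pi>] into [-1, 1], because \<pi> < 4.\<close>
  define s where "s = (\<lambda>x. sinc4 (1 / 4 * x) + sinc4 (N * x))"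
  define B where "B = (\<lambda>u. 4 * spline (4 * u) + 1 / N * spline (u / N))"
  have weighted: "integrable lborel (\<lambda>x. (1 + x\<^sup>2) * sinc4 (a * x))" if "0 < a" for a
  proof (rule Bochner_Integration.integrable_bound)
    show "integrable lborel (\<lambda>x. (1 + 1 / a\<^sup>2) * ((1 + (0 + a * x)\<^sup>2) * sinc4 (0 + a * x)))"
      by (intro integrable_mult_right lborel_integrable_real_affine integrable_sinc4_weighted) (use that in simp)
    show "AE x in lborel. norm ((1 + x\<^sup>2) * sinc4 (a * x)) \<le> norm ((1 + 1 / a\<^sup>2) * ((1 + (0 + a * x)\<^sup>2) * sinc4 (0 + a * x)))"
    proof (rule AE_I2)
      fix x
      have "1 + x\<^sup>2 \<le> (1 + 1 / a\<^sup>2) * (1 + (a * x)\<^sup>2)"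
        using that by (simp add: field_simps power2_eq_square)
      then have "(1 + x\<^sup>2) * sinc4 (a * x) \<le> (1 + 1 / a\<^sup>2) * (1 + (a * x)\<^sup>2) * sinc4 (a * x)"
        by (intro mult_right_mono sinc4_nonneg)
      then show "norm ((1 + x\<^sup>2) * sinc4 (a * x)) \<le> norm ((1 + 1 / a\<^sup>2) * ((1 + (0 + a * x)\<^sup>2) * sinc4 (0 + a * x)))"
        by (simp add: abs_mult sinc4_nonneg abs_of_nonneg mult.assoc)
    qed
  qed measurable
  have int1: "complex_integrable lborel (\<lambda>x. sinc4 (a * x) * iexp (u * x))" if "0 < a" for a u
    by (rule Bochner_Integration.integrable_bound[OF weighted[OF that]])
      (auto simp: norm_mult sinc4_nonneg abs_mult intro!: mult_left_le[where c = "_ ::real"] simp del: of_real_mult, simp add: distrib_right sinc4_nonneg)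
  have fourier: "(CLBINT x. sinc4 (a * x) * iexp (u * x)) = of_real (1 / a * spline (u / a))" if "0 < a" for a u
  proof -
    have "(CLBINT x. sinc4 (a * x) * iexp (u * x)) =
        \<bar>1 / a\<bar> *\<^sub>R (CLBINT x. sinc4 (a * (0 + 1 / a * x)) * iexp (u * (0 + 1 / a * x)))"
      by (rule lborel_integral_real_affine) (use that in simp)
    also have "\<dots> = (1 / a) *\<^sub>R (CLBINT x. sinc4 x * iexp (u / a * x))"
      using that by simp
    also have "\<dots> = (1 / a) *\<^sub>R of_real (spline (u / a))" by (simp only: spline_fourier)
    finally show ?thesis by (simp add: scaleR_conv_of_real)
  qed
  \<comment> \<open>The transform of the narrow summand may reach up to |u| = 4 N; 5 N leaves room
    for the strict inequality in \<open>spline_eq_0\<close>. The bound 2 counts two summands, each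
    at most 1.\<close>
  have "band_limited_kernel s B (5 * N) (min c1 (1 / N * c2)) 2"
  proof
    show "s \<in> borel_measurable borel" unfolding s_def by measurable
    show "0 \<le> s x" for x unfolding s_def by (intro add_nonneg_nonneg sinc4_nonneg)
    show "s x \<le> 2" for x unfolding s_def using sinc4_le_1[of "1 / 4 * x"] sinc4_le_1[of "N * x"] by linarith
    show "integrable lborel (\<lambda>x. (1 + x\<^sup>2) * s x)"
      unfolding s_def using weighted[of "1 / 4"] weighted[of N] N by (simp add: distrib_left)
    show "(CLBINT x. s x * iexp (u * x)) = of_real (B u)" for u
    proof -
      have "(CLBINT x. s x * iexp (u * x)) = (CLBINT x. sinc4 (1 / 4 * x) * iexp (u * x) + sinc4 (N * x) * iexp (u * x))"
        by (simp add: s_def distrib_right)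
      also have "\<dots> = (CLBINT x. sinc4 (1 / 4 * x) * iexp (u * x)) + (CLBINT x. sinc4 (N * x) * iexp (u * x))"
        using N by (intro Bochner_Integration.integral_add int1) auto
      also have "\<dots> = of_real (B u)"
        using N fourier[of "1 / 4" u] fourier[of N u] by (simp add: B_def mult.commute)
      finally show ?thesis .
    qed
    show "0 \<le> B u" for u unfolding B_def using spline_nonneg N by auto
    show "B u = 0" if "5 * N \<le> \<bar>u\<bar>" for u
    proof -
      have "4 < \<bar>4 * u\<bar>" using that N by auto
      moreover have "4 < \<bar>u / N\<bar>" using that N by (auto simp: field_simps)
      ultimately show ?thesis by (simp add: B_def spline_eq_0)
    qed
    show "0 < min c1 (1 / N * c2)" using c1 c2 N by auto
    show "min c1 (1 / N * c2) \<le> s x" if "\<bar>x\<bar> \<le> pi" for x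
    proof -
      have "c1 \<le> sinc4 (1 / 4 * x)" using that pi_less_4 by (intro c1) auto
      then show ?thesis unfolding s_def using sinc4_nonneg[of "N * x"] by linarith
    qed
    show "min c1 (1 / N * c2) \<le> B u" if "\<bar>u\<bar> \<le> 1" for u
    proof -
      have "\<bar>u / N\<bar> \<le> 1 / N" using that N by (simp add: divide_right_mono)
      then have "c2 \<le> spline (u / N)" using N by (intro c2) auto
      then have "1 / N * c2 \<le> 1 / N * spline (u / N)" using N by (intro mult_left_mono) auto
      then show ?thesis unfolding B_def using spline_nonneg[of "4 * u"] by linarith
    qed
    show "1 \<le> 5 * N" using N by simp
  qed
  then show ?thesis by blast
qed

subsection \<open>Fourier transforms of modulated kernels\<close>

text \<open>The factor 2 makes \<open>a j\<close> the modulus of the coefficients of both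
  exponentials of frequencies j and - j.\<close>

definition trig :: "(nat \<Rightarrow> real) \<Rightarrow> (nat \<Rightarrow> real) \<Rightarrow> real \<Rightarrow> real" where
  "trig a \<theta> x = (\<Sum>j. 2 * a j * cos (real j * x - \<theta> j))"

lemma trig_measurable [measurable]: "trig a \<theta> \<in> borel_measurable borel"
  unfolding trig_def by measurable

lemma summable_trig:
  assumes "summable a" "\<And>j. 0 \<le> a j"
  shows "summable (\<lambda>j. \<bar>2 * a j * cos (real j * x - \<theta> j)\<bar>)"
proof (rule summable_comparison_test'[where N = 0])
  show "summable (\<lambda>j. 2 * a j)" by (intro summable_mult assms)
  show "norm \<bar>2 * a j * cos (real j * x - \<theta> j)\<bar> \<le> 2 * a j" for j
    using assms(2)[of j] by (simp add: abs_mult mult_left_le)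
qed

lemma abs_trig_le:
  assumes "summable a" "\<And>j. 0 \<le> a j"
  shows "\<bar>trig a \<theta> x\<bar> \<le> 2 * suminf a"
proof -
  note S = summable_trig[of a x \<theta>, OF assms]
  have "\<bar>trig a \<theta> x\<bar> \<le> (\<Sum>j. \<bar>2 * a j * cos (real j * x - \<theta> j)\<bar>)"
    unfolding trig_def by (rule summable_rabs[OF S])
  also have "\<dots> \<le> (\<Sum>j. 2 * a j)"
    using assms(2) by (intro suminf_le[OF _ S] summable_mult assms(1)) (simp add: abs_mult mult_left_le)
  also have "\<dots> = 2 * suminf a" by (rule suminf_mult[OF assms(1)])
  finally show ?thesis .
qed

definition phase :: "nat \<Rightarrow> real \<Rightarrow> nat \<Rightarrow> real" where
  "phase m \<tau> j = (if m \<le> j then \<tau> else 0)"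

context band_limited_kernel
begin

lemma integrable_s: "integrable lborel s" "integrable lborel (\<lambda>x. x\<^sup>2 * s x)"
  by (rule Bochner_Integration.integrable_bound[OF integrable_s_weighted];
      simp add: abs_mult s_nonneg algebra_simps)+

lemma integrable_s_mult:
  assumes [measurable]: "p \<in> borel_measurable borel" and "\<And>x. \<bar>p x\<bar> \<le> k"
  shows "integrable lborel (\<lambda>x. s x * p x)"
proof (rule Bochner_Integration.integrable_bound)
  show "integrable lborel (\<lambda>x. s x * k)" using integrable_s by simp
  show "AE x in lborel. norm (s x * p x) \<le> norm (s x * k)"
    using assms(2) order_trans[OF abs_ge_zero assms(2)]
    by (intro AE_I2) (auto simp: abs_mult s_nonneg intro!: mult_left_mono)
qed measurable

lemma integrable_s_mult_iexp:
  assumes "p \<in> borel_measurable borel" and "\<And>x. \<bar>p x\<bar> \<le> k"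
  shows "complex_integrable lborel (\<lambda>x. s x * p x * iexp (u * x))"
  using assms(1)
  by (intro Bochner_Integration.integrable_bound[OF integrable_s_mult[OF assms]])
    (auto simp: norm_mult abs_mult simp del: of_real_mult)

lemma integral_s: "(LBINT x. s x) = B 0"
proof -
  have "complex_of_real (LBINT x. s x) = of_real (B 0)"
    using fourier_s[of 0] by (simp flip: integral_complex_of_real)
  then show ?thesis by (simp only: of_real_eq_iff)
qed

lemma B_0_pos: "0 < B 0"
  using B_ge[of 0] c_pos by simp

lemma B_le: "B u \<le> B 0"
proof -
  have "norm (CLBINT x. s x * iexp (u * x)) \<le> (LBINT x. norm (s x * iexp (u * x)))"
    by (rule integral_norm_bound)
  then show ?thesis
    by (simp add: fourier_s norm_mult s_nonneg integral_s B_nonneg del: of_real_mult)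
qed

lemma B_minus: "B (- u) = B u"
proof -
  have "complex_of_real (B (- u)) = cnj (CLBINT x. s x * iexp (u * x))"
    unfolding fourier_s[symmetric]
    by (subst Bochner_Integration.integral_cnj[symmetric], rule Bochner_Integration.integral_cong) (auto simp: exp_cnj)
  then show ?thesis
    by (simp only: fourier_s complex_cnj_complex_of_real of_real_eq_iff)
qed

text \<open>A cosine of frequency j moves the transform \<open>B\<close> to j and to - j, with
  conjugate phases. Summability of \<open>a\<close> justifies integration term by term.\<close>

lemma fourier_trig:
  fixes u :: real
  assumes "summable a" "\<And>j. 0 \<le> a j"
  shows "(\<lambda>j. of_real (a j) * (cis (\<theta> j) * of_real (B (u - j)) + cis (- \<theta> j) * of_real (B (u + j))))
    sums (CLBINT x. s x * trig a \<theta> x * iexp (u * x))"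
proof -
  define f where "f = (\<lambda>(j::nat) (x::real). s x * (2 * a j * cos (real j * x - \<theta> j)) * iexp (u * x))"
  have bound: "\<bar>2 * a j * cos (real j * x - \<theta> j)\<bar> \<le> 2 * a j" for j x
    using assms(2)[of j] by (simp add: abs_mult mult_left_le)
  have int_f: "integrable lborel (f j)" for j
    unfolding f_def by (rule integrable_s_mult_iexp[OF _ bound]) measurable
  have norm_f: "norm (f j x) = s x * \<bar>2 * a j * cos (real j * x - \<theta> j)\<bar>" for j x
    unfolding f_def by (simp add: norm_mult s_nonneg abs_mult del: of_real_mult)
  have "(\<lambda>j. integral\<^sup>L lborel (f j)) sums (CLBINT x. (\<Sum>j. f j x))"
  proof (rule sums_integral[OF int_f])
    show "AE x in lborel. summable (\<lambda>j. norm (f j x))"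
      unfolding norm_f by (intro AE_I2 summable_mult summable_trig assms)
    show "summable (\<lambda>j. LBINT x. norm (f j x))"
    proof (rule summable_comparison_test'[where N = 0])
      show "summable (\<lambda>j. B 0 * (2 * a j))" by (intro summable_mult assms)
      fix j
      have "(LBINT x. norm (f j x)) \<le> (LBINT x. s x * (2 * a j))"
        using bound[of j] integrable_norm[OF int_f[of j]] integrable_s(1) unfolding norm_f
        by (intro integral_mono) (auto intro!: mult_left_mono s_nonneg)
      also have "\<dots> = B 0 * (2 * a j)" by (simp add: integral_s)
      finally show "norm (LBINT x. norm (f j x)) \<le> B 0 * (2 * a j)"
        by (simp add: integral_nonneg_AE)
    qed
  qed
  moreover have "(\<Sum>j. f j x) = s x * trig a \<theta> x * iexp (u * x)" for x
  proof -
    define T where "T = (\<lambda>j. complex_of_real (2 * a j * cos (real j * x - \<theta> j)))"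
    have "T sums of_real (trig a \<theta> x)"
      unfolding T_def trig_def
      by (intro sums_of_real summable_sums summable_rabs_cancel[OF summable_trig] assms)
    then have "(\<lambda>j. of_real (s x) * T j * iexp (u * x)) sums (of_real (s x) * of_real (trig a \<theta> x) * iexp (u * x))"
      by (intro sums_mult2 sums_mult)
    moreover have "f j x = of_real (s x) * T j * iexp (u * x)" for j
      by (simp add: f_def T_def)
    ultimately show ?thesis by (simp add: sums_unique[symmetric])
  qed
  moreover have "integral\<^sup>L lborel (f j) = of_real (a j) * (cis (\<theta> j) * of_real (B (u - j)) + cis (- \<theta> j) * of_real (B (u + j)))" for j
  proof -
    have int1: "complex_integrable lborel (\<lambda>x. s x * iexp (v * x))" for v
      using integrable_s_mult_iexp[of "\<lambda>_. 1" 1 v] by simp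
    have "f j x = of_real (a j) * cis (\<theta> j) * (s x * iexp ((u - j) * x)) + of_real (a j) * cis (- \<theta> j) * (s x * iexp ((u + j) * x))" for x
    proof -
      have "complex_of_real (2 * cos y) = cis y + cis (- y)" for y
        by (simp add: complex_eq_iff)
      then have "of_real (2 * cos (real j * x - \<theta> j)) * cis (u * x) = cis (\<theta> j) * cis ((u - j) * x) + cis (- \<theta> j) * cis ((u + j) * x)"
        by (simp only: distrib_right cis_mult) (simp add: algebra_simps)
      moreover have "f j x = of_real (a j) * of_real (s x) * (of_real (2 * cos (real j * x - \<theta> j)) * cis (u * x))"
        by (simp add: f_def cis_conv_exp)
      ultimately show ?thesis by (simp add: cis_conv_exp algebra_simps)
    qed
    then have "f j = (\<lambda>x. of_real (a j) * cis (\<theta> j) * (s x * iexp ((u - j) * x)) + of_real (a j) * cis (- \<theta> j) * (s x * iexp ((u + j) * x)))"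
      by (rule ext)
    then have "integral\<^sup>L lborel (f j) = of_real (a j) * cis (\<theta> j) * (CLBINT x. s x * iexp ((u - j) * x))
        + of_real (a j) * cis (- \<theta> j) * (CLBINT x. s x * iexp ((u + j) * x))"
      using int1[of "u - j"] int1[of "u + j"]
      by (simp only: Bochner_Integration.integral_add integral_mult_right_zero integrable_mult_right)
    then show ?thesis by (simp only: fourier_s) (simp add: algebra_simps)
  qed
  ultimately show ?thesis by simp
qed

definition lo :: "(nat \<Rightarrow> real) \<Rightarrow> nat \<Rightarrow> real \<Rightarrow> real" where
  "lo a m u = (\<Sum>j. if j < m then a j * (B (u - j) + B (u + j)) else 0)"

text \<open>Only the copies of \<open>B\<close> centred at + j are collected, since those at - j
  carry the conjugate phase. By evenness of \<open>B\<close> the latter sum to \<open>hi\<close> at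
  - u. In \<open>lo\<close> both copies have phase 0 and can be merged.\<close>

definition hi :: "(nat \<Rightarrow> real) \<Rightarrow> nat \<Rightarrow> real \<Rightarrow> real" where
  "hi a m u = (\<Sum>j. if m \<le> j then a j * B (u - j) else 0)"

lemma lo_hi_summable:
  fixes u :: real
  assumes "summable a" "\<And>j. 0 \<le> a j"
  shows "summable (\<lambda>j. if j < m then a j * (B (u - j) + B (u + j)) else 0)"
    and "summable (\<lambda>j. if m \<le> j then a j * B (u - j) else 0)"
proof -
  show "summable (\<lambda>j. if j < m then a j * (B (u - j) + B (u + j)) else 0)"
    by (rule summable_finite[of "{..<m}"]) auto
  show "summable (\<lambda>j. if m \<le> j then a j * B (u - j) else 0)"
  proof (rule summable_comparison_test'[where N = 0])
    show "summable (\<lambda>j. a j * B 0)" by (intro summable_mult2 assms)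
    show "norm (if m \<le> j then a j * B (u - j) else 0) \<le> a j * B 0" for j
      using assms(2)[of j] B_nonneg B_le[of "u - j"] by (auto simp: abs_mult intro!: mult_left_mono)
  qed
qed

lemma
  assumes "summable a" "\<And>j. 0 \<le> a j"
  shows lo_nonneg: "0 \<le> lo a m u" and hi_nonneg: "0 \<le> hi a m u"
proof -
  show "0 \<le> lo a m u"
    unfolding lo_def by (rule suminf_nonneg[OF lo_hi_summable(1)[OF assms]])
      (auto intro!: mult_nonneg_nonneg add_nonneg_nonneg B_nonneg assms)
  show "0 \<le> hi a m u"
    unfolding hi_def by (rule suminf_nonneg[OF lo_hi_summable(2)[OF assms]])
      (auto intro!: mult_nonneg_nonneg B_nonneg assms)
qed

lemma lo_minus: "lo a m (- u) = lo a m u"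
proof -
  have "B (- u - j) + B (- u + j) = B (u - j) + B (u + j)" for j :: real
    using B_minus[of "u + j"] B_minus[of "u - j"] by simp
  then show ?thesis unfolding lo_def by (simp only:)
qed

lemma fourier_trig_phase:
  assumes "summable a" "\<And>j. 0 \<le> a j"
  shows "(CLBINT x. s x * trig a (phase m \<tau>) x * iexp (u * x)) =
    of_real (lo a m u) + cis \<tau> * of_real (hi a m u) + cis (- \<tau>) * of_real (hi a m (- u))"
proof (rule sums_unique2[OF fourier_trig[OF assms]])
  let ?l = "\<lambda>j. if j < m then a j * (B (u - j) + B (u + j)) else 0"
  let ?h = "\<lambda>(u::real) j. if m \<le> j then a j * B (u - j) else 0"
  have "(\<lambda>j. of_real (?l j) + cis \<tau> * of_real (?h u j) + cis (- \<tau>) * of_real (?h (- u) j)) sums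
      (of_real (lo a m u) + cis \<tau> * of_real (hi a m u) + cis (- \<tau>) * of_real (hi a m (- u)))"
    unfolding lo_def hi_def
    by (intro sums_add sums_mult sums_of_real summable_sums lo_hi_summable assms)
  moreover have "B (- u - j) = B (u + j)" for j :: real
    using B_minus[of "u + j"] by simp
  ultimately show "(\<lambda>j. of_real (a j) * (cis (phase m \<tau> j) * of_real (B (u - j)) + cis (- phase m \<tau> j) * of_real (B (u + j)))) sums
      (of_real (lo a m u) + cis \<tau> * of_real (hi a m u) + cis (- \<tau>) * of_real (hi a m (- u)))"
    by (elim sums_cong[THEN iffD1, rotated]) (auto simp: phase_def algebra_simps)
qed

lemma hi_eq_0:
  assumes "u \<le> m - L"
  shows "hi a m u = 0"
proof -
  have "(if m \<le> j then a j * B (u - j) else 0) = 0" for j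
    using assms B_eq_0[of "u - j"] by auto
  then show ?thesis unfolding hi_def by simp
qed

lemma lo_eq_0:
  assumes "m + L \<le> \<bar>u\<bar>"
  shows "lo a m u = 0"
proof -
  have "(if j < m then a j * (B (u - j) + B (u + j)) else 0) = 0" for j
    using assms B_eq_0[of "u - j"] B_eq_0[of "u + j"] by auto
  then show ?thesis unfolding lo_def by simp
qed

text \<open>If |u| is within \<open>L\<close> of \<open>m\<close>, a frequency enters only when it
  is within \<open>L\<close> of |u|, hence within 2 L \<le> W of \<open>m\<close>. Here 2 L \<le> m
  excludes contributions from the mirror image on the other side of 0.\<close>

lemma lo_hi_restrict:
  assumes "\<bar>\<bar>u\<bar> - m\<bar> < L" "2 * L \<le> real m" "2 * L \<le> real W"
    and a': "\<And>j. a' j = (if j \<le> m + W \<and> m \<le> j + W then a j else 0)"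
  shows "lo a' m u = lo a m u" "hi a' m u = hi a m u"
proof -
  have "a' j * B (u - j) = a j * B (u - j)" "a' j * B (u + j) = a j * B (u + j)" for j
  proof -
    have "j \<le> m + W \<and> m \<le> j + W" if "\<bar>u - j\<bar> < L \<or> \<bar>u + j\<bar> < L"
    proof -
      have "real j \<le> real m + real W \<and> real m \<le> real j + real W"
        using that assms(1-3) L_pos by (auto simp: abs_if split: if_splits)
      then show ?thesis by linarith
    qed
    then show "a' j * B (u - j) = a j * B (u - j)" "a' j * B (u + j) = a j * B (u + j)"
      unfolding a' using B_eq_0[of "u - j"] B_eq_0[of "u + j"] by (auto simp: not_less[symmetric])
  qed
  then show "lo a' m u = lo a m u" "hi a' m u = hi a m u"
    unfolding lo_def hi_def by (simp_all only: distrib_left)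
qed

end

text \<open>The hypotheses leave at most one nonzero summand, so the phase enters only through its
  K-th power, and \<open>cis \<tau>\<close> and \<open>cis (- \<tau>)\<close> both have K-th power -
  1.\<close>

lemma power_cis_eq:
  fixes X Y Y' :: real
  assumes "real K * \<tau> = pi" and "X = 0 \<or> Y = 0 \<and> Y' = 0" and "Y = 0 \<or> Y' = 0"
  shows "(X + cis \<tau> * Y + cis (- \<tau>) * Y') ^ K = (X + cis (- \<tau>) * Y + cis \<tau> * Y') ^ K"
proof -
  have "cis (- pi) = - 1" by (simp add: complex_eq_iff)
  then have "cis \<tau> ^ K = - 1" and "cis (- \<tau>) ^ K = - 1"
    unfolding Complex.DeMoivre by (simp_all only: assms(1) mult_minus_right cis_pi)
  then show ?thesis using assms(2,3) by (auto simp: power_mult_distrib)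
qed

text \<open>For cos \<tau> \<ge> 0 the two vectors enclose at most a right angle, so they cannot
  cancel.\<close>

lemma norm_cis_combination_ge:
  fixes X Y :: real
  assumes "0 \<le> X" "0 \<le> Y" "0 \<le> cos \<tau>"
  shows "(X + Y) / 2 \<le> norm (X + cis \<tau> * Y)"
proof -
  have "2 * (X * Y) \<le> X\<^sup>2 + Y\<^sup>2"
    using zero_le_power2[of "X - Y"] by (simp add: power2_eq_square algebra_simps)
  moreover have "((X + Y) / 2)\<^sup>2 = (X\<^sup>2 + 2 * (X * Y) + Y\<^sup>2) / 4"
    by (simp add: power2_eq_square field_simps)
  ultimately have "((X + Y) / 2)\<^sup>2 \<le> X\<^sup>2 + Y\<^sup>2"
    using zero_le_power2[of X] zero_le_power2[of Y] by (simp only:) argo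
  also have "\<dots> \<le> X\<^sup>2 + Y\<^sup>2 + 2 * (X * Y * cos \<tau>)" using assms by simp
  also have "\<dots> = X\<^sup>2 + 2 * (X * Y * cos \<tau>) + Y\<^sup>2 * ((cos \<tau>)\<^sup>2 + (sin \<tau>)\<^sup>2)" by simp
  also have "\<dots> = (norm (X + cis \<tau> * Y))\<^sup>2"
    by (simp only: cmod_power2 plus_complex.sel times_complex.sel Re_complex_of_real Im_complex_of_real cis.sel) algebra
  finally show ?thesis by (rule power2_le_imp_le) simp
qed

subsection \<open>Decay conditions and sine series\<close>

lemma abs_sinc_less:
  assumes "0 < R"
  obtains \<rho> where "0 < \<rho>" "\<rho> < 1" "\<And>u. R \<le> \<bar>u\<bar> \<Longrightarrow> \<bar>sinc u\<bar> \<le> \<rho>"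
proof -
  \<comment> \<open>The cap at 1 keeps the compact interval [r, 2] nonempty for large R; beyond 2
    the crude bound 1 / |u| takes over.\<close>
  define r where "r = min R 1"
  have r: "0 < r" "r \<le> 1" "r \<le> R" using assms by (auto simp: r_def)
  have "\<exists>x\<in>{r..2}. \<forall>y\<in>{r..2}. \<bar>sinc y\<bar> \<le> \<bar>sinc x\<bar>"
    using r by (intro continuous_attains_sup continuous_intros) auto
  then obtain z where z: "z \<in> {r..2}" "\<And>y. y \<in> {r..2} \<Longrightarrow> \<bar>sinc y\<bar> \<le> \<bar>sinc z\<bar>" by blast
  have z0: "0 < z" using z r by auto
  have "\<bar>sin z\<bar> = 2 * \<bar>sin (z / 2)\<bar> * \<bar>cos (z / 2)\<bar>"
    using sin_double[of "z / 2"] by (simp add: abs_mult)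
  also have "\<dots> \<le> 2 * \<bar>z / 2\<bar> * \<bar>cos (z / 2)\<bar>"
    by (intro mult_right_mono mult_left_mono abs_sin_x_le_abs_x) auto
  also have "\<dots> < z"
  proof -
    have "cos (z / 2) < cos 0" using z z0 pi_gt3 by (intro cos_monotone_0_pi) auto
    moreover have "0 \<le> cos (z / 2)" using z z0 pi_gt3 by (intro cos_ge_zero) auto
    ultimately have "z * \<bar>cos (z / 2)\<bar> < z * 1" using z0 by (intro mult_strict_left_mono) auto
    then show ?thesis using z0 by simp
  qed
  finally have "\<bar>sinc z\<bar> < 1" using z0 by simp
  show thesis
  proof (rule that[of "max (1 / 2) \<bar>sinc z\<bar>"])
    show "max (1 / 2) \<bar>sinc z\<bar> < 1" using \<open>\<bar>sinc z\<bar> < 1\<close> by (simp only: max_less_iff_conj) simp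
    fix u assume u: "R \<le> \<bar>u\<bar>"
    show "\<bar>sinc u\<bar> \<le> max (1 / 2) \<bar>sinc z\<bar>"
    proof (cases "\<bar>u\<bar> \<le> 2")
      case True
      have "\<bar>sinc u\<bar> = \<bar>sinc \<bar>u\<bar>\<bar>" by (auto simp: abs_if)
      also have "\<dots> \<le> \<bar>sinc z\<bar>" using True u r by (intro z) auto
      finally show ?thesis by (rule max.coboundedI2)
    next
      case False
      have "\<bar>sin u\<bar> \<le> 1" by simp
      then have "\<bar>sin u\<bar> \<le> \<bar>u\<bar> / 2" using False by linarith
      then have "\<bar>sinc u\<bar> \<le> 1 / 2" using False by (auto simp: divide_simps)
      then show ?thesis by (rule max.coboundedI1)
    qed
  qed simp
qed

text \<open>Split off from \<open>f\<close> a uniform component of mass 2 l on [-1, 1]. It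
  contributes 2 l sinc u, and the nonnegative remainder contributes at most its mass 1 - 2
  l.\<close>

lemma norm_char_le_sinc:
  assumes [measurable]: "f \<in> borel_measurable borel" and f0: "\<And>x. 0 \<le> f x" and "prob_space (law_of f)"
    and lb: "\<And>x. \<bar>x\<bar> \<le> 1 \<Longrightarrow> l \<le> f x" and l: "0 \<le> l"
  shows "norm (char (law_of f) u) \<le> 1 - 2 * l * (1 - \<bar>sinc u\<bar>)"
proof -
  interpret prob_space "law_of f" by fact
  have "(\<integral>\<^sup>+x. ennreal (f x) \<partial>lborel) = 1"
    using emeasure_space_1 by (simp add: emeasure_density cong: nn_integral_cong_simp)
  then have int_f: "integrable lborel f" and f1: "(LBINT x. f x) = 1"
    using f0 by (auto intro!: integrableI_nonneg simp: integral_eq_nn_integral)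
  let ?g = "\<lambda>x. indicator {-1..1::real} x / 2 :: real"
  have int_g: "integrable lborel ?g" by simp
  let ?h = "\<lambda>x. f x - 2 * l * ?g x"
  have h0: "0 \<le> ?h x" for x
    using f0[of x] lb[of x] by (auto simp: indicator_def abs_le_iff)
  have int_h: "integrable lborel ?h" using int_f int_g by simp
  have int_e: "complex_integrable lborel (\<lambda>x. p x *\<^sub>R iexp (u * x))" if "integrable lborel p" for p
    by (rule Bochner_Integration.integrable_bound[OF that]) (use that in \<open>auto simp del: of_real_mult\<close>)
  have "char (law_of f) u = (CLBINT x. f x *\<^sub>R iexp (u * x))"
    unfolding char_def by (rule integral_density) (auto simp: f0)
  also have "\<dots> = (CLBINT x. ?h x *\<^sub>R iexp (u * x) + (2 * l) *\<^sub>R (?g x *\<^sub>R iexp (u * x)))"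
    by (intro Bochner_Integration.integral_cong) (auto simp: algebra_simps)
  also have "\<dots> = (CLBINT x. ?h x *\<^sub>R iexp (u * x)) + (2 * l) *\<^sub>R (CLBINT x. ?g x *\<^sub>R iexp (u * x))"
    using int_e[OF int_h] int_e[OF int_g]
    by (simp only: Bochner_Integration.integral_add integrable_scaleR_right integral_scaleR_right)
  also have "(CLBINT x. ?g x *\<^sub>R iexp (u * x)) = of_real (sinc u)"
    unfolding char_uniform_law[symmetric] char_def uniform_law_def
    by (rule integral_density[symmetric]) auto
  finally have eq: "char (law_of f) u = (CLBINT x. ?h x *\<^sub>R iexp (u * x)) + (2 * l) *\<^sub>R complex_of_real (sinc u)" .
  have "norm (char (law_of f) u) \<le> norm (CLBINT x. ?h x *\<^sub>R iexp (u * x)) + norm ((2 * l) *\<^sub>R complex_of_real (sinc u))"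
    unfolding eq by (rule norm_triangle_ineq)
  also have "norm (CLBINT x. ?h x *\<^sub>R iexp (u * x)) \<le> (LBINT x. norm (?h x *\<^sub>R iexp (u * x)))"
    by (rule integral_norm_bound)
  also have "\<dots> = (LBINT x. ?h x)"
    using h0 by (intro Bochner_Integration.integral_cong) (auto simp del: of_real_mult)
  also have "\<dots> = 1 - 2 * l"
    using int_f int_g by (subst Bochner_Integration.integral_diff) (auto simp: f1)
  finally show ?thesis using l by (simp add: abs_mult algebra_simps)
qed

lemma powr_neg_ge:
  fixes x y \<beta> :: real
  assumes "0 < \<beta>" "0 < x" "0 < y" "x \<le> y powr (- 1 / \<beta>)"
  shows "y \<le> x powr (- \<beta>)"
proof -
  have "y = (y powr (- 1 / \<beta>)) powr (- \<beta>)" using assms by (simp add: powr_powr)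
  also have "\<dots> \<le> x powr (- \<beta>)" using assms by (intro powr_mono2') auto
  finally show ?thesis .
qed

text \<open>Converts bounds with arbitrary multiplicative constants into the normalised form used in
  the class, whose two sides equal 1 at u = 0. The constants are chosen before \<psi>, so that one
  choice serves the characteristic functions for all m.\<close>

lemma polynomial_decay_constants:
  fixes \<beta> b R \<rho> k\<^sub>1 k\<^sub>2 U V :: real
  assumes "1 < \<beta>" "\<beta> \<le> b" "0 < R" "0 < \<rho>" "\<rho> < 1" "0 < k\<^sub>1" "0 < k\<^sub>2" "0 < V"
  obtains C\<^sub>0 C\<^sub>0' where "0 < C\<^sub>0" "0 < C\<^sub>0'"
    "\<And>C C' \<psi> u. \<lbrakk>C\<^sub>0 \<le> C; 0 < C'; C' \<le> C\<^sub>0'; \<And>u. 1 - u\<^sup>2 * V / 2 \<le> \<psi> u;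
      \<And>u. k\<^sub>1 * (1 + \<bar>u\<bar>) powr (- b) \<le> \<psi> u; \<And>u. R \<le> \<bar>u\<bar> \<Longrightarrow> \<psi> u \<le> \<rho>;
      \<And>u. U \<le> \<bar>u\<bar> \<Longrightarrow> \<psi> u \<le> k\<^sub>2 * \<bar>u\<bar> powr (- \<beta>)\<rbrakk> \<Longrightarrow>
      (1 + C * \<bar>u\<bar>) powr (- b) \<le> \<psi> u \<and> (R \<le> \<bar>u\<bar> \<longrightarrow> \<psi> u \<le> (1 + C' * \<bar>u\<bar>) powr (- \<beta>))"
proof -
  \<comment> \<open>Beyond \<open>U\<^sub>1\<close> the polynomial bound applies, and 1 + C' |u|
    \<le> 2 |u| / U_1 is at most the power - 1 / \<beta> of that bound.\<close>
  define U\<^sub>1 where "U\<^sub>1 = max 1 (max U (2 * k\<^sub>2 powr (1 / \<beta>)))"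
  have U1: "1 \<le> U\<^sub>1" "U \<le> U\<^sub>1" "2 * k\<^sub>2 powr (1 / \<beta>) \<le> U\<^sub>1" by (auto simp: U\<^sub>1_def)
  \<comment> \<open>Solves (1 + q) powr - \<beta> = \<rho>. For R \<le> |u| \<le> U_1 the upper
    bound then holds as soon as C' |u| \<le> q.\<close>
  define q where "q = \<rho> powr (- 1 / \<beta>) - 1"
  have q: "0 < q"
  proof -
    have "1 powr (- 1 / \<beta>) < \<rho> powr (- 1 / \<beta>)"
      using assms by (intro powr_less_mono2_neg) auto
    then show ?thesis by (simp add: q_def)
  qed
  define C\<^sub>0' where "C\<^sub>0' = min (1 / U\<^sub>1) (q / U\<^sub>1)"
  define C\<^sub>0 where "C\<^sub>0 = max (sqrt V) ((sqrt V + 1) * k\<^sub>1 powr (- 1 / b))"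
  show thesis
  proof (rule that[of C\<^sub>0 C\<^sub>0'])
    show "0 < C\<^sub>0" unfolding C\<^sub>0_def using assms by (intro max.strict_coboundedI1) simp
    show "0 < C\<^sub>0'" using q U1 by (simp add: C\<^sub>0'_def)
    fix C C' \<psi> u
    assume C: "C\<^sub>0 \<le> C" and C': "0 < C'" "C' \<le> C\<^sub>0'" and \<psi>V: "\<And>u. 1 - u\<^sup>2 * V / 2 \<le> \<psi> u"
      and \<psi>b: "\<And>u. k\<^sub>1 * (1 + \<bar>u\<bar>) powr (- b) \<le> \<psi> u" and \<psi>R: "\<And>u. R \<le> \<bar>u\<bar> \<Longrightarrow> \<psi> u \<le> \<rho>"
      and \<psi>U: "\<And>u. U \<le> \<bar>u\<bar> \<Longrightarrow> \<psi> u \<le> k\<^sub>2 * \<bar>u\<bar> powr (- \<beta>)"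
    have CV: "sqrt V \<le> C" "(sqrt V + 1) * k\<^sub>1 powr (- 1 / b) \<le> C" using C by (auto simp: C\<^sub>0_def)
    have C0: "0 < C" using CV(1) assms real_sqrt_gt_zero[of V] by linarith
    have "(1 + C * \<bar>u\<bar>) powr (- b) \<le> \<psi> u"
    \<comment> \<open>Near 0 the bound with \<open>k\<^sub>1\<close> may stay below 1, so the moment
      bound is used, which leaves 1 only quadratically. Further out, enlarging C absorbs
      \<open>k\<^sub>1\<close>.\<close>
    proof (cases "\<bar>u\<bar> * sqrt V \<le> 1")
      case True
      let ?x = "C * \<bar>u\<bar>"
      have x0: "0 \<le> ?x" using C0 by simp
      have uV: "u\<^sup>2 * V = (\<bar>u\<bar> * sqrt V)\<^sup>2" using assms by (simp add: power_mult_distrib)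
      have "(1 + ?x) powr (- b) \<le> (1 + ?x) powr (- 1)"
        using assms x0 by (intro powr_mono) auto
      also have "\<dots> = 1 / (1 + ?x)" using x0 by (simp add: powr_minus_divide)
      also have "\<dots> \<le> 1 - u\<^sup>2 * V / 2"
      proof (cases "?x \<le> 1")
        case x1: True
        have "?x * ?x \<le> ?x * 1" by (intro mult_left_mono x1 x0)
        then have "1 \<le> (1 - ?x / 2) * (1 + ?x)" by (simp add: algebra_simps)
        then have "1 / (1 + ?x) \<le> 1 - ?x / 2" using x0 by (simp add: pos_divide_le_eq)
        moreover have "u\<^sup>2 * V \<le> ?x"
        proof -
          have "u\<^sup>2 * V = (\<bar>u\<bar> * sqrt V) * (\<bar>u\<bar> * sqrt V)" unfolding uV by (rule power2_eq_square)
          also have "\<dots> \<le> 1 * (\<bar>u\<bar> * sqrt V)"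
            using assms by (intro mult_right_mono True mult_nonneg_nonneg) auto
          also have "\<dots> \<le> \<bar>u\<bar> * C" using CV by (simp add: mult_left_mono)
          finally show ?thesis by (simp add: mult.commute)
        qed
        ultimately show ?thesis by linarith
      next
        case x1: False
        have "1 / (1 + ?x) \<le> 1 / 2" using x1 by (intro divide_left_mono) auto
        moreover have "(\<bar>u\<bar> * sqrt V)\<^sup>2 \<le> 1"
          using True assms by (intro power_le_one) auto
        ultimately show ?thesis unfolding uV by linarith
      qed
      also have "\<dots> \<le> \<psi> u" by (rule \<psi>V)
      finally show ?thesis .
    next
      case False
      have k: "0 < k\<^sub>1 powr (1 / b)" using assms by simp
      have "1 + \<bar>u\<bar> \<le> (sqrt V + 1) * \<bar>u\<bar>" using False by (simp add: algebra_simps)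
      also have "\<dots> = k\<^sub>1 powr (1 / b) * (((sqrt V + 1) * k\<^sub>1 powr (- 1 / b)) * \<bar>u\<bar>)"
        using assms by (simp add: powr_minus field_simps)
      also have "\<dots> \<le> k\<^sub>1 powr (1 / b) * (C * \<bar>u\<bar>)"
        using CV by (intro mult_left_mono mult_right_mono) auto
      also have "\<dots> \<le> k\<^sub>1 powr (1 / b) * (1 + C * \<bar>u\<bar>)"
        by (intro mult_left_mono) auto
      finally have le: "1 + \<bar>u\<bar> \<le> k\<^sub>1 powr (1 / b) * (1 + C * \<bar>u\<bar>)" .
      have "(k\<^sub>1 powr (1 / b) * (1 + C * \<bar>u\<bar>)) powr (- b) \<le> (1 + \<bar>u\<bar>) powr (- b)"
        using le assms by (intro powr_mono2') auto
      moreover have "(k\<^sub>1 powr (1 / b) * (1 + C * \<bar>u\<bar>)) powr (- b) = inverse k\<^sub>1 * (1 + C * \<bar>u\<bar>) powr (- b)"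
        using assms C0 by (simp add: powr_mult powr_powr powr_minus)
      ultimately have "inverse k\<^sub>1 * (1 + C * \<bar>u\<bar>) powr (- b) \<le> (1 + \<bar>u\<bar>) powr (- b)"
        by (simp only:)
      then have "k\<^sub>1 * (inverse k\<^sub>1 * (1 + C * \<bar>u\<bar>) powr (- b)) \<le> k\<^sub>1 * (1 + \<bar>u\<bar>) powr (- b)"
        using assms by (intro mult_left_mono) auto
      moreover have "k\<^sub>1 * inverse k\<^sub>1 = 1" using assms by simp
      ultimately have "(1 + C * \<bar>u\<bar>) powr (- b) \<le> k\<^sub>1 * (1 + \<bar>u\<bar>) powr (- b)"
        by (simp only: mult.assoc[symmetric] mult_1_left)
      also have "\<dots> \<le> \<psi> u" by (rule \<psi>b)
      finally show ?thesis .
    qed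
    moreover have "\<psi> u \<le> (1 + C' * \<bar>u\<bar>) powr (- \<beta>)" if "R \<le> \<bar>u\<bar>"
    proof (cases "\<bar>u\<bar> \<le> U\<^sub>1")
      case True
      have "C' * \<bar>u\<bar> \<le> q / U\<^sub>1 * U\<^sub>1" using C' True q U1 by (intro mult_mono) (auto simp: C\<^sub>0'_def)
      then have "1 + C' * \<bar>u\<bar> \<le> \<rho> powr (- 1 / \<beta>)" using U1 by (simp add: q_def)
      then have "\<rho> \<le> (1 + C' * \<bar>u\<bar>) powr (- \<beta>)"
        using assms C' by (intro powr_neg_ge) (auto simp: add_pos_nonneg)
      with \<psi>R[OF that] show ?thesis by linarith
    next
      case False
      have u: "0 < \<bar>u\<bar>" using False U1 by linarith
      have "C' * \<bar>u\<bar> \<le> 1 / U\<^sub>1 * \<bar>u\<bar>" using C' by (intro mult_right_mono) (auto simp: C\<^sub>0'_def)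
      moreover have "1 \<le> 1 / U\<^sub>1 * \<bar>u\<bar>" using False U1 by simp
      ultimately have "1 + C' * \<bar>u\<bar> \<le> 2 / U\<^sub>1 * \<bar>u\<bar>" by simp
      also have "\<dots> \<le> k\<^sub>2 powr (- 1 / \<beta>) * \<bar>u\<bar>"
      proof (rule mult_right_mono)
        have "k\<^sub>2 powr (- 1 / \<beta>) = 1 / k\<^sub>2 powr (1 / \<beta>)" by (simp add: powr_minus_divide)
        also have "\<dots> \<ge> 2 / U\<^sub>1" using U1 assms by (simp add: field_simps)
        finally show "2 / U\<^sub>1 \<le> k\<^sub>2 powr (- 1 / \<beta>)" .
      qed simp
      also have "\<dots> = (k\<^sub>2 * \<bar>u\<bar> powr (- \<beta>)) powr (- 1 / \<beta>)"
        using u assms by (simp add: powr_mult powr_powr)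
      finally have "k\<^sub>2 * \<bar>u\<bar> powr (- \<beta>) \<le> (1 + C' * \<bar>u\<bar>) powr (- \<beta>)"
        using assms C' u by (intro powr_neg_ge) (auto simp: add_pos_nonneg)
      moreover have "\<psi> u \<le> k\<^sub>2 * \<bar>u\<bar> powr (- \<beta>)" using False U1 by (intro \<psi>U) auto
      ultimately show ?thesis by linarith
    qed
    ultimately show "(1 + C * \<bar>u\<bar>) powr (- b) \<le> \<psi> u \<and> (R \<le> \<bar>u\<bar> \<longrightarrow> \<psi> u \<le> (1 + C' * \<bar>u\<bar>) powr (- \<beta>))"
      by blast
  qed
qed

section \<open>Orthogonality of sines and Bessel's inequality\<close>

lemma integral_cos_Icc_pi:
  assumes "k \<in> \<int>"
  shows "(LBINT x. cos (k * x) * indicator {-pi..pi} x) = (if k = 0 then 2 * pi else 0)"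
proof (cases "k = 0")
  case False
  have s0: "sin (k * pi) = 0"
    using assms by (auto elim!: Ints_cases simp: sin_npi_int mult.commute[of _ pi])
  have "(LBINT x. cos (k * x) * indicator {-pi..pi} x) = sin (k * pi) / k - sin (k * (-pi)) / k"
    by (rule integral_FTC_Icc_real) (use False in \<open>auto intro!: derivative_eq_intros\<close>)
  with s0 False show ?thesis by simp
qed simp

lemma sine_orthogonality:
  fixes i j :: nat
  assumes "0 < j"
  shows "(LBINT x. sin (real i * x) * sin (real j * x) * indicator {-pi..pi} x) = (if i = j then pi else 0)"
proof -
  have int: "integrable lborel (\<lambda>x. cos (k * x) * indicator {-pi..pi} x)" for k :: real
    using borel_integrable_atLeastAtMost'[of "-pi" pi "\<lambda>x. cos (k * x)"]
    by (simp add: set_integrable_def mult.commute continuous_intros)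
  have "sin (real i * x) * sin (real j * x) * indicator {-pi..pi} x =
      (cos ((real i - real j) * x) * indicator {-pi..pi} x - cos ((real i + real j) * x) * indicator {-pi..pi} x) / 2" for x
    by (simp add: sin_times_sin left_diff_distrib[symmetric] distrib_right[symmetric] divide_simps)
  then have "(LBINT x. sin (real i * x) * sin (real j * x) * indicator {-pi..pi} x) =
      ((LBINT x. cos ((real i - real j) * x) * indicator {-pi..pi} x) - (LBINT x. cos ((real i + real j) * x) * indicator {-pi..pi} x)) / 2"
    using int by (simp only: Bochner_Integration.integral_diff integral_divide_zero)
  also have "\<dots> = (if i = j then pi else 0)"
    using assms by (subst (1 2) integral_cos_Icc_pi) auto
  finally show ?thesis .
qed

lemma integral_sine_series:
  fixes w v :: "nat \<Rightarrow> real"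
  assumes w: "summable (\<lambda>j. \<bar>w j\<bar>)" and J: "finite J" "0 \<notin> J"
  shows "integrable lborel (\<lambda>x. (\<Sum>j. w j * sin (real j * x)) * (\<Sum>j\<in>J. v j * sin (real j * x)) * indicator {-pi..pi} x)"
    and "(LBINT x. (\<Sum>j. w j * sin (real j * x)) * (\<Sum>j\<in>J. v j * sin (real j * x)) * indicator {-pi..pi} x) = pi * (\<Sum>j\<in>J. w j * v j)"
proof -
  have abs: "\<bar>w j * sin (real j * x)\<bar> \<le> \<bar>w j\<bar>" for j x
    by (simp add: abs_mult mult_left_le)
  have S: "summable (\<lambda>j. \<bar>w j * sin (real j * x)\<bar>)" for x
    by (rule summable_comparison_test'[OF w, of 0]) (use abs in auto)
  have Wb: "\<bar>\<Sum>j. w j * sin (real j * x)\<bar> \<le> (\<Sum>j. \<bar>w j\<bar>)" for x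
    by (rule order_trans[OF summable_rabs[OF S]]) (intro suminf_le abs S w)
  have ind: "integrable lborel (\<lambda>x. k * indicator {-pi..pi} x :: real)" for k by simp
  have int1: "integrable lborel (\<lambda>x. (\<Sum>i. w i * sin (real i * x)) * sin (real j * x) * indicator {-pi..pi} x)" for j
  proof (rule Bochner_Integration.integrable_bound[OF ind[of "\<Sum>j. \<bar>w j\<bar>"]])
    show "AE x in lborel. norm ((\<Sum>i. w i * sin (real i * x)) * sin (real j * x) * indicator {-pi..pi} x) \<le> norm ((\<Sum>j. \<bar>w j\<bar>) * indicator {-pi..pi} x)"
    proof (rule AE_I2)
      fix x
      have "\<bar>(\<Sum>i. w i * sin (real i * x))\<bar> * \<bar>sin (real j * x)\<bar> \<le> (\<Sum>j. \<bar>w j\<bar>) * 1"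
        by (intro mult_mono Wb) (auto intro!: suminf_nonneg w)
      then show "norm ((\<Sum>i. w i * sin (real i * x)) * sin (real j * x) * indicator {-pi..pi} x) \<le> norm ((\<Sum>j. \<bar>w j\<bar>) * indicator {-pi..pi} x)"
        by (auto simp: indicator_def abs_mult)
    qed
  qed measurable
  have coeff: "(LBINT x. (\<Sum>i. w i * sin (real i * x)) * sin (real j * x) * indicator {-pi..pi} x) = pi * w j" if "0 < j" for j
  proof -
    define f where "f = (\<lambda>(i::nat) x. w i * (sin (real i * x) * sin (real j * x) * indicator {-pi..pi} x))"
    have f_le: "\<bar>f i x\<bar> \<le> \<bar>w i\<bar> * indicator {-pi..pi} x" for i x
      unfolding f_def by (auto simp: abs_mult indicator_def mult_le_one intro!: mult_left_le)
    have int_f: "integrable lborel (f i)" for i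
      by (rule Bochner_Integration.integrable_bound[OF ind[of "\<bar>w i\<bar>"]])
        (use f_le in \<open>auto simp: f_def abs_mult\<close>)
    have "(\<lambda>i. integral\<^sup>L lborel (f i)) sums (LBINT x. (\<Sum>i. f i x))"
    proof (rule sums_integral[OF int_f])
      show "AE x in lborel. summable (\<lambda>i. norm (f i x))"
        by (intro AE_I2 summable_comparison_test'[OF w, of 0])
          (use f_le in \<open>auto simp: indicator_def split: if_splits intro: order_trans[OF f_le]\<close>)
      show "summable (\<lambda>i. LBINT x. norm (f i x))"
      proof (rule summable_comparison_test'[where N = 0])
        show "summable (\<lambda>i. \<bar>w i\<bar> * (2 * pi))" by (intro summable_mult2 w)
        fix i
        have "(LBINT x. norm (f i x)) \<le> (LBINT x. \<bar>w i\<bar> * indicator {-pi..pi} x)"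
          using f_le int_f[of i] by (intro integral_mono integrable_norm ind) auto
        then show "norm (LBINT x. norm (f i x)) \<le> \<bar>w i\<bar> * (2 * pi)"
          by (simp add: integral_nonneg_AE)
      qed
    qed
    moreover have "(\<Sum>i. f i x) = (\<Sum>i. w i * sin (real i * x)) * sin (real j * x) * indicator {-pi..pi} x" for x
      unfolding f_def using suminf_mult2[OF summable_rabs_cancel[OF S[of x]], of "sin (real j * x) * indicator {-pi..pi} x"]
      by (simp add: mult_ac)
    moreover have "integral\<^sup>L lborel (f i) = (if i = j then pi * w j else 0)" for i
      unfolding f_def using sine_orthogonality[OF that, of i] by simp
    ultimately have "(\<lambda>i. if i = j then pi * w j else 0) sums (LBINT x. (\<Sum>i. w i * sin (real i * x)) * sin (real j * x) * indicator {-pi..pi} x)"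
      by simp
    then show ?thesis
      by (rule sums_unique2) (rule sums_single)
  qed
  have eq: "(\<Sum>j. w j * sin (real j * x)) * (\<Sum>j\<in>J. v j * sin (real j * x)) * indicator {-pi..pi} x =
      (\<Sum>j\<in>J. v j * ((\<Sum>i. w i * sin (real i * x)) * sin (real j * x) * indicator {-pi..pi} x))" for x
    by (simp add: sum_distrib_left sum_distrib_right mult_ac)
  show "integrable lborel (\<lambda>x. (\<Sum>j. w j * sin (real j * x)) * (\<Sum>j\<in>J. v j * sin (real j * x)) * indicator {-pi..pi} x)"
    unfolding eq by (intro Bochner_Integration.integrable_sum integrable_mult_right int1)
  have "(LBINT x. (\<Sum>j. w j * sin (real j * x)) * (\<Sum>j\<in>J. v j * sin (real j * x)) * indicator {-pi..pi} x) =
      (\<Sum>j\<in>J. v j * (pi * w j))"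
    unfolding eq
  proof (subst Bochner_Integration.integral_sum)
    show "(\<Sum>j\<in>J. LBINT x. v j * ((\<Sum>i. w i * sin (real i * x)) * sin (real j * x) * indicator {-pi..pi} x)) = (\<Sum>j\<in>J. v j * (pi * w j))"
      using J by (intro sum.cong refl) (subst integral_mult_right_zero, subst coeff, auto intro: gr0I)
  qed (intro integrable_mult_right int1)
  then show "(LBINT x. (\<Sum>j. w j * sin (real j * x)) * (\<Sum>j\<in>J. v j * sin (real j * x)) * indicator {-pi..pi} x) = pi * (\<Sum>j\<in>J. w j * v j)"
    by (simp add: sum_distrib_left mult_ac)
qed

text \<open>Bessel's inequality, from (W - v)^2 \<ge> 0 for the finite part \<open>v\<close> over
  \<open>J\<close>: the integrals of W v and of v^2 over one period are both \<pi> times the sum of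
  the squared coefficients.\<close>

lemma bessel_sine_series:
  fixes w :: "nat \<Rightarrow> real"
  assumes w: "summable (\<lambda>j. \<bar>w j\<bar>)" and J: "finite J" "0 \<notin> J"
    and int: "integrable lborel (\<lambda>x. (\<Sum>j. w j * sin (real j * x))\<^sup>2 * indicator {-pi..pi} x)"
  shows "pi * (\<Sum>j\<in>J. (w j)\<^sup>2) \<le> (LBINT x. (\<Sum>j. w j * sin (real j * x))\<^sup>2 * indicator {-pi..pi} x)"
proof -
  define W where "W x = (\<Sum>j. w j * sin (real j * x))" for x
  define v where "v x = (\<Sum>j\<in>J. w j * sin (real j * x))" for x
  note WV = integral_sine_series[OF w J, of w, folded W_def v_def]
  \<comment> \<open>Written as a series, the finite sum can play the first role in
    \<open>integral_sine_series\<close>, which yields the integral of v^2.\<close>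
  have v_eq: "v x = (\<Sum>j. (if j \<in> J then w j else 0) * sin (real j * x))" for x
  proof -
    have "(\<Sum>j. (if j \<in> J then w j else 0) * sin (real j * x)) = (\<Sum>j\<in>J. (if j \<in> J then w j else 0) * sin (real j * x))"
      by (intro suminf_finite J) auto
    then show ?thesis by (simp add: v_def)
  qed
  have "summable (\<lambda>j. \<bar>if j \<in> J then w j else 0\<bar>)"
    by (rule summable_finite[OF J(1)]) auto
  note VV = integral_sine_series[OF this J, of w, folded v_eq v_def]
  have "(\<Sum>j\<in>J. (if j \<in> J then w j else 0) * w j) = (\<Sum>j\<in>J. w j * w j)" by simp
  with WV VV have "pi * (\<Sum>j\<in>J. (w j)\<^sup>2) = (LBINT x. 2 * (W x * v x * indicator {-pi..pi} x) - v x * v x * indicator {-pi..pi} x)"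
    by (simp add: power2_eq_square)
  also have "\<dots> \<le> (LBINT x. (W x)\<^sup>2 * indicator {-pi..pi} x)"
  proof (rule integral_mono)
    show "integrable lborel (\<lambda>x. 2 * (W x * v x * indicator {-pi..pi} x) - v x * v x * indicator {-pi..pi} x)"
      using WV VV by simp
    show "integrable lborel (\<lambda>x. (W x)\<^sup>2 * indicator {-pi..pi} x)" using int by (simp add: W_def)
    fix x
    have "0 \<le> (W x - v x)\<^sup>2" by simp
    then show "2 * (W x * v x * indicator {-pi..pi} x) - v x * v x * indicator {-pi..pi} x \<le> (W x)\<^sup>2 * indicator {-pi..pi} x"
      by (auto simp: indicator_def power2_eq_square algebra_simps)
  qed
  finally show ?thesis by (simp add: W_def)
qed

subsection \<open>The perturbed densities\<close>

lemma summable_shifted_powr: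
  assumes "1 < \<beta>"
  shows "summable (\<lambda>j::nat. (1 + real j) powr (- \<beta>))"
proof -
  have "summable (\<lambda>j::nat. real (Suc j) powr (- \<beta>))"
    using assms by (subst summable_Suc_iff) (simp add: summable_real_powr_iff)
  then show ?thesis by (simp add: add.commute)
qed

text \<open>An open interval of length 2 L \<le> W contains at most W + 1 integers.\<close>

lemma suminf_window_le:
  fixes g :: "nat \<Rightarrow> real"
  assumes L: "0 \<le> L" "2 * L \<le> real W" "L \<le> v" and M: "0 \<le> M"
    and g: "\<And>j. \<bar>v - real j\<bar> < L \<Longrightarrow> g j \<le> M" "\<And>j. L \<le> \<bar>v - real j\<bar> \<Longrightarrow> g j = 0"
  shows "suminf g \<le> (real W + 1) * M"
proof -
  \<comment> \<open>As L \<le> v, truncation by \<open>nat\<close> is harmless. Indices above k + W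
    exceed v - L + W, which is at least v + L.\<close>
  define k where "k = nat \<lfloor>v - L\<rfloor>"
  have k: "real k \<le> v - L" "v - L < real k + 1" using L by (auto simp: k_def)
  have "suminf g = (\<Sum>j\<in>{k..k + W}. g j)"
  proof (rule suminf_finite)
    fix j assume "j \<notin> {k..k + W}"
    then have "real j + 1 \<le> real k \<or> real k + real W + 1 \<le> real j"
      by (auto simp: not_le)
    then show "g j = 0" using k L by (intro g) linarith
  qed simp
  also have "\<dots> \<le> (\<Sum>j\<in>{k..k + W}. M)"
    using g M by (intro sum_mono) (metis not_le)
  also have "\<dots> = (real W + 1) * M" by simp
  finally show ?thesis .
qed

text \<open>The amplitudes sum to at most 1 / 4, so the trigonometric series stays within 1 / 2 and
  \<open>P\<close> between 1 / 2 and 3 / 2. The lower bound on \<open>m\<close> keeps the window in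
  the range j \<ge> m / 2, below 2 m and away from the support of \<open>B\<close>. Only
  \<open>m\<close> will grow with the sample size.\<close>

locale phase_perturbation = band_limited_kernel +
  fixes \<beta> b \<kappa> :: real and W m :: nat
  assumes beta: "1 < \<beta>" "\<beta> \<le> b"
    and kappa: "0 < \<kappa>" "\<kappa> \<le> 1" "\<kappa> * (\<Sum>j. (1 + real j) powr (- \<beta>)) \<le> 1 / 4"
    and W: "2 * L \<le> real W" and m: "2 * W + 2 \<le> m"
begin

definition amp :: "nat \<Rightarrow> real" where
  "amp j = (if j = 0 then 0 else \<kappa> * (1 + real j) powr (- (if j \<le> m + W \<and> m \<le> j + W then b else \<beta>)))"

text \<open>These are the only amplitudes visible in the overlap zone ||u| - m| < L. The correcting
  functions of the likelihood are built from them, which is why their total size governs the number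
  of observations allowed.\<close>

definition near :: "nat \<Rightarrow> real" where
  "near j = (if j \<le> m + W \<and> m \<le> j + W then amp j else 0)"

definition P :: "real \<Rightarrow> real \<Rightarrow> real" where
  "P \<tau> x = 1 + trig amp (phase m \<tau>) x"

text \<open>The normalisation is the same for all \<tau>, because the phase-shifted frequencies do
  not reach u = 0. Otherwise the K-th powers of the characteristic functions could not agree off the
  overlap zone.\<close>

definition Z :: real where
  "Z = B 0 + lo amp m 0"

definition f :: "real \<Rightarrow> real \<Rightarrow> real" where
  "f \<tau> x = s x * P \<tau> x / Z"

lemma m_ge: "2 * L \<le> real m" "2 * real W \<le> real m" "2 \<le> real m"
proof -
  have "real (2 * W + 2) \<le> real m" using m by (simp only: of_nat_le_iff)
  then show "2 * L \<le> real m" "2 * real W \<le> real m" "2 \<le> real m" using W by auto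
qed

lemma amp_nonneg: "0 \<le> amp j"
  using kappa by (auto simp: amp_def)

lemma amp_le: "amp j \<le> \<kappa> * (1 + real j) powr (- \<beta>)"
  using kappa beta unfolding amp_def by (auto intro!: mult_left_mono powr_mono)

lemma amp_ge: "0 < j \<Longrightarrow> \<kappa> * (1 + real j) powr (- b) \<le> amp j"
  using kappa beta unfolding amp_def by (auto intro!: mult_left_mono powr_mono)

lemma summable_amp: "summable amp"
  by (rule summable_comparison_test'[where N = 0 and g = "\<lambda>j. \<kappa> * (1 + real j) powr (- \<beta>)"])
    (use amp_le amp_nonneg in \<open>auto intro!: summable_mult summable_shifted_powr beta\<close>)

lemma suminf_amp: "suminf amp \<le> 1 / 4"
proof -
  have "suminf amp \<le> (\<Sum>j. \<kappa> * (1 + real j) powr (- \<beta>))"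
    by (intro suminf_le amp_le summable_amp summable_mult summable_shifted_powr beta)
  also have "\<dots> = \<kappa> * (\<Sum>j. (1 + real j) powr (- \<beta>))"
    by (intro suminf_mult summable_shifted_powr beta)
  finally show ?thesis using kappa by linarith
qed

lemma near_nonneg: "0 \<le> near j"
  by (simp add: near_def amp_nonneg)

lemma summable_near: "summable near"
  by (rule summable_finite[of "{..m + W}"]) (auto simp: near_def)

text \<open>The window holds 2 W + 1 indices, all with 1 + j \<ge> m / 2, and W does not depend on
  m; hence the order m powr - b.\<close>

lemma suminf_near: "suminf near \<le> (2 * real W + 1) * (2 powr b * real m powr (- b))"
proof -
  have le: "near j \<le> 2 powr b * real m powr (- b)" for j
  proof (cases "j \<le> m + W \<and> m \<le> j + W \<and> j \<noteq> 0")
    case True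
    have "real m \<le> real (j + W)" using True by (simp only: of_nat_le_iff)
    then have j: "real m / 2 \<le> 1 + real j" using m_ge by simp
    have "near j = \<kappa> * (1 + real j) powr (- b)" using True by (simp add: near_def amp_def)
    also have "\<dots> \<le> 1 * (real m / 2) powr (- b)"
      using kappa beta j m_ge by (intro mult_mono powr_mono2') auto
    also have "\<dots> = 2 powr b * real m powr (- b)"
      using m_ge by (simp add: powr_divide powr_minus divide_simps)
    finally show ?thesis .
  qed (auto simp: near_def amp_def)
  have "suminf near = (\<Sum>j\<in>{m - W..m + W}. near j)"
    by (rule suminf_finite) (auto simp: near_def)
  also have "\<dots> \<le> (\<Sum>j\<in>{m - W..m + W}. 2 powr b * real m powr (- b))"
    by (intro sum_mono le)
  also have "\<dots> = (2 * real W + 1) * (2 powr b * real m powr (- b))"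
    using m by (simp add: of_nat_diff)
  finally show ?thesis .
qed

lemma P_measurable [measurable]: "P \<tau> \<in> borel_measurable borel"
  unfolding P_def[abs_def] by measurable

lemma f_measurable [measurable]: "f \<tau> \<in> borel_measurable borel"
  unfolding f_def[abs_def] by measurable

lemma P_bounds: "1 / 2 \<le> P \<tau> x" "P \<tau> x \<le> 3 / 2"
  using abs_trig_le[OF summable_amp amp_nonneg, of "phase m \<tau>" x] suminf_amp
  unfolding P_def by linarith+

lemma abs_P_le: "\<bar>P \<tau> x\<bar> \<le> 3 / 2"
  using P_bounds[of \<tau> x] by (simp add: abs_le_iff)

lemma fourier_P: "(CLBINT x. s x * P \<tau> x * iexp (u * x)) =
    of_real (B u + lo amp m u) + cis \<tau> * of_real (hi amp m u) + cis (- \<tau>) * of_real (hi amp m (- u))"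
proof -
  have 1: "complex_integrable lborel (\<lambda>x. s x * iexp (u * x))"
    using integrable_s_mult_iexp[of "\<lambda>_. 1" 1 u] by simp
  have 2: "complex_integrable lborel (\<lambda>x. s x * trig amp (phase m \<tau>) x * iexp (u * x))"
    by (rule integrable_s_mult_iexp[OF _ abs_trig_le[OF summable_amp amp_nonneg]]) measurable
  have "(CLBINT x. s x * P \<tau> x * iexp (u * x)) =
      (CLBINT x. s x * iexp (u * x) + s x * trig amp (phase m \<tau>) x * iexp (u * x))"
    by (intro Bochner_Integration.integral_cong) (auto simp: P_def algebra_simps)
  also have "\<dots> = (CLBINT x. s x * iexp (u * x)) + (CLBINT x. s x * trig amp (phase m \<tau>) x * iexp (u * x))"
    by (rule Bochner_Integration.integral_add[OF 1 2])
  finally show ?thesis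
    by (simp only: fourier_s fourier_trig_phase[OF summable_amp amp_nonneg]) simp
qed

lemma integral_s_P: "(LBINT x. s x * P \<tau> x) = Z"
proof -
  have "complex_of_real (LBINT x. s x * P \<tau> x) = (CLBINT x. s x * P \<tau> x * iexp (0 * x))"
    by (simp flip: integral_complex_of_real)
  also have "\<dots> = of_real Z"
    unfolding fourier_P using m_ge L_pos by (simp add: Z_def hi_eq_0)
  finally show ?thesis by (simp only: of_real_eq_iff)
qed

lemma Z_bounds: "B 0 / 2 \<le> Z" "Z \<le> 3 / 2 * B 0"
proof -
  have int: "integrable lborel (\<lambda>x. s x * P 0 x)"
    by (rule integrable_s_mult[OF _ abs_P_le]) measurable
  have "(LBINT x. s x * (1 / 2)) \<le> (LBINT x. s x * P 0 x)"
    using integrable_s int by (intro integral_mono mult_left_mono P_bounds s_nonneg) auto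
  then show "B 0 / 2 \<le> Z" by (simp add: integral_s_P integral_s)
  have "(LBINT x. s x * P 0 x) \<le> (LBINT x. s x * (3 / 2))"
    using integrable_s int by (intro integral_mono mult_left_mono P_bounds s_nonneg) auto
  then show "Z \<le> 3 / 2 * B 0" by (simp add: integral_s_P integral_s)
qed

lemma Z_pos: "0 < Z"
  using Z_bounds B_0_pos by linarith

lemma f_nonneg: "0 \<le> f \<tau> x"
  unfolding f_def using s_nonneg[of x] P_bounds[of \<tau> x] Z_pos by simp

lemma f_le: "f \<tau> x \<le> 3 / B 0 * s x"
proof -
  have "f \<tau> x \<le> s x * (3 / 2) / (B 0 / 2)"
    unfolding f_def using Z_bounds B_0_pos s_nonneg[of x] P_bounds[of \<tau> x]
    by (intro frac_le mult_left_mono mult_nonneg_nonneg) auto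
  then show ?thesis using B_0_pos by (simp add: field_simps)
qed

lemma f_ge: "s x / (3 * B 0) \<le> f \<tau> x"
proof -
  have "s x * (1 / 2) / (3 / 2 * B 0) \<le> f \<tau> x"
    unfolding f_def using Z_bounds Z_pos s_nonneg[of x] P_bounds[of \<tau> x]
    by (intro frac_le mult_left_mono mult_nonneg_nonneg) auto
  then show ?thesis using B_0_pos by (simp add: field_simps)
qed

lemma integrable_f: "integrable lborel (f \<tau>)"
  using integrable_s_mult[OF P_measurable abs_P_le, of \<tau>] by (simp add: f_def[abs_def])

lemma prob_space_f: "prob_space (law_of (f \<tau>))"
proof (rule prob_spaceI)
  have "(\<integral>\<^sup>+x. ennreal (f \<tau> x) \<partial>lborel) = ennreal (LBINT x. f \<tau> x)"
    by (rule nn_integral_eq_integral[OF integrable_f]) (simp add: f_nonneg)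
  also have "(LBINT x. f \<tau> x) = 1"
    unfolding f_def using Z_pos by (simp add: integral_s_P)
  finally show "emeasure (law_of (f \<tau>)) (space (law_of (f \<tau>))) = 1"
    by (simp add: emeasure_density cong: nn_integral_cong_simp)
qed

lemma is_density_f: "is_density (f \<tau>)"
  unfolding is_density_def using prob_space_f f_nonneg by simp

lemma integral_law_f:
  fixes g :: "real \<Rightarrow> complex"
  assumes [measurable]: "g \<in> borel_measurable borel"
  shows "(CLINT x|law_of (f \<tau>). g x) = (CLBINT x. s x * P \<tau> x * g x) / of_real Z"
proof -
  have "(CLINT x|law_of (f \<tau>). g x) = (CLBINT x. f \<tau> x *\<^sub>R g x)"
    by (rule integral_density) (auto simp: f_nonneg)
  also have "\<dots> = (CLBINT x. s x * P \<tau> x * g x / of_real Z)"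
    by (intro Bochner_Integration.integral_cong) (auto simp: f_def scaleR_conv_of_real)
  finally show ?thesis by simp
qed

lemma char_f: "char (law_of (f \<tau>)) u =
    (of_real (B u + lo amp m u) + cis \<tau> * of_real (hi amp m u) + cis (- \<tau>) * of_real (hi amp m (- u))) / of_real Z"
  unfolding char_def by (subst integral_law_f) (simp_all only: fourier_P, measurable)

text \<open>All transforms are nonnegative, and at any u at most one of the phases \<tau>, - \<tau>
  is present, so the acute angle prevents cancellation and one single frequency close to |u|
  suffices.\<close>

lemma norm_char_f_ge:
  assumes "0 \<le> cos \<tau>"
  shows "\<kappa> * c / (3 * B 0) * (1 + \<bar>u\<bar>) powr (- b) \<le> norm (char (law_of (f \<tau>)) u)"
proof -
  define X where "X = B \<bar>u\<bar> + lo amp m \<bar>u\<bar>"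
  define Y where "Y = hi amp m \<bar>u\<bar>"
  have nonneg: "0 \<le> lo amp m \<bar>u\<bar>" "0 \<le> Y" "0 \<le> X"
    using lo_nonneg[OF summable_amp amp_nonneg] hi_nonneg[OF summable_amp amp_nonneg] B_nonneg
    by (auto simp: X_def Y_def)
  have Bu: "B u = B \<bar>u\<bar>" "lo amp m u = lo amp m \<bar>u\<bar>"
    using B_minus[of u] lo_minus[of amp m u] by (auto simp: abs_if)
  have "\<kappa> * c * (1 + \<bar>u\<bar>) powr (- b) \<le> X + Y"
  proof (cases "\<bar>u\<bar> \<le> 1")
    case True
    have "(1 + \<bar>u\<bar>) powr (- b) \<le> 1 powr (- b)" using beta by (intro powr_mono2') auto
    then have "\<kappa> * c * (1 + \<bar>u\<bar>) powr (- b) \<le> 1 * c * 1"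
      using kappa c_pos by (intro mult_mono) auto
    also have "\<dots> \<le> B \<bar>u\<bar>" using True by (simp add: B_ge)
    finally show ?thesis using nonneg unfolding X_def by linarith
  next
    case False
    \<comment> \<open>The nearest integer below |u| lies within distance 1, where \<open>B\<close>
      is at least \<open>c\<close>; for |u| \<le> 1 the unmodulated kernel did this job.\<close>
    define j where "j = nat \<lfloor>\<bar>u\<bar>\<rfloor>"
    have j: "real j \<le> \<bar>u\<bar>" "\<bar>u\<bar> < real j + 1" "0 < j" using False by (auto simp: j_def)
    have "\<kappa> * (1 + \<bar>u\<bar>) powr (- b) \<le> \<kappa> * (1 + real j) powr (- b)"
      using kappa beta j by (intro mult_left_mono powr_mono2') auto
    also have "\<dots> \<le> amp j" by (rule amp_ge[OF j(3)])
    finally have "\<kappa> * (1 + \<bar>u\<bar>) powr (- b) * c \<le> amp j * B (\<bar>u\<bar> - j)"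
      using j c_pos amp_nonneg[of j] by (intro mult_mono B_ge) auto
    also have "\<dots> \<le> lo amp m \<bar>u\<bar> + Y"
    proof (cases "j < m")
      case True
      let ?g = "\<lambda>j. if j < m then amp j * (B (\<bar>u\<bar> - j) + B (\<bar>u\<bar> + j)) else 0"
      have "amp j * B (\<bar>u\<bar> - j) \<le> ?g j" using True amp_nonneg B_nonneg by (simp add: mult_left_mono)
      also have "\<dots> = (\<Sum>i\<in>{j}. ?g i)" by simp
      also have "\<dots> \<le> suminf ?g"
        by (intro sum_le_suminf lo_hi_summable summable_amp amp_nonneg) (auto intro!: mult_nonneg_nonneg add_nonneg_nonneg amp_nonneg B_nonneg)
      finally show ?thesis using nonneg unfolding lo_def by linarith
    next
      case False
      let ?g = "\<lambda>j. if m \<le> j then amp j * B (\<bar>u\<bar> - j) else 0"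
      have "amp j * B (\<bar>u\<bar> - j) = (\<Sum>i\<in>{j}. ?g i)" using False by simp
      also have "\<dots> \<le> suminf ?g"
        by (intro sum_le_suminf lo_hi_summable summable_amp amp_nonneg) (auto intro!: mult_nonneg_nonneg amp_nonneg B_nonneg)
      finally show ?thesis using nonneg unfolding Y_def hi_def by linarith
    qed
    finally show ?thesis using B_nonneg[of "\<bar>u\<bar>"] unfolding X_def by (simp add: mult_ac)
  qed
  moreover have "(X + Y) / 2 \<le> norm (of_real (B u + lo amp m u) + cis \<tau> * of_real (hi amp m u) + cis (- \<tau>) * of_real (hi amp m (- u)))"
  proof (cases "0 \<le> u")
    case True
    have "hi amp m (- u) = 0" using True m_ge L_pos by (intro hi_eq_0) auto
    then show ?thesis
      using norm_cis_combination_ge[OF nonneg(3,2) assms] True by (simp add: X_def Y_def)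
  next
    case False
    have "hi amp m u = 0" using False m_ge L_pos by (intro hi_eq_0) auto
    then show ?thesis
      using norm_cis_combination_ge[OF nonneg(3,2), of "- \<tau>"] False assms by (simp add: X_def Y_def Bu)
  qed
  ultimately have le: "\<kappa> * c * (1 + \<bar>u\<bar>) powr (- b) / 2 \<le> norm (of_real (B u + lo amp m u) + cis \<tau> * of_real (hi amp m u) + cis (- \<tau>) * of_real (hi amp m (- u)))"
    by (elim order_trans[rotated] divide_right_mono) simp
  have "\<kappa> * c / (3 * B 0) * (1 + \<bar>u\<bar>) powr (- b) = \<kappa> * c * (1 + \<bar>u\<bar>) powr (- b) / 2 / (3 / 2 * B 0)"
    using B_0_pos by (simp add: field_simps)
  also have "\<dots> \<le> norm (of_real (B u + lo amp m u) + cis \<tau> * of_real (hi amp m u) + cis (- \<tau>) * of_real (hi amp m (- u))) / Z"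
    using le Z_bounds Z_pos by (intro frac_le) auto
  also have "\<dots> = norm (char (law_of (f \<tau>)) u)"
    unfolding char_f using Z_pos by (simp add: norm_divide)
  finally show ?thesis .
qed

text \<open>Only frequencies within \<open>L\<close> of |u| contribute. There are at most W + 1 of
  them, each at least |u| / 2 after the shift by 1. The 8 is made of two copies of \<open>B\<close>
  in \<open>lo\<close>, one in each of the two \<open>hi\<close>, and the factor 2 from Z \<ge> B 0
  / 2.\<close>

lemma norm_char_f_le:
  assumes "2 * L \<le> \<bar>u\<bar>"
  shows "norm (char (law_of (f \<tau>)) u) \<le> 8 * (real W + 1) * 2 powr \<beta> * \<bar>u\<bar> powr (- \<beta>)"
proof -
  define M where "M = 2 powr \<beta> * \<bar>u\<bar> powr (- \<beta>)"
  have M0: "0 \<le> M" by (simp add: M_def)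
  have u: "L \<le> \<bar>u\<bar>" "0 < \<bar>u\<bar>" using assms L_pos by auto
  have amp_M: "amp j \<le> M" if "\<bar>\<bar>u\<bar> - real j\<bar> < L" for j
  proof -
    have j: "\<bar>u\<bar> / 2 \<le> 1 + real j" using that assms by linarith
    have "amp j \<le> \<kappa> * (1 + real j) powr (- \<beta>)" by (rule amp_le)
    also have "\<dots> \<le> 1 * (\<bar>u\<bar> / 2) powr (- \<beta>)"
      using kappa beta j u by (intro mult_mono powr_mono2') auto
    also have "\<dots> = M" using u by (simp add: M_def powr_divide powr_minus divide_simps)
    finally show ?thesis .
  qed
  have win: "\<bar>u - real j\<bar> < L \<Longrightarrow> \<bar>\<bar>u\<bar> - real j\<bar> < L" "\<bar>u + real j\<bar> < L \<Longrightarrow> \<bar>\<bar>u\<bar> - real j\<bar> < L" for j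
    by linarith+
  have B0: "B (u - real j) = 0" "B (u + real j) = 0" if "L \<le> \<bar>\<bar>u\<bar> - real j\<bar>" for j
    using that win[of j] by (auto intro!: B_eq_0 simp: not_less[symmetric])
  have lo_le: "lo amp m u \<le> (real W + 1) * (M * (B 0 + B 0))"
    unfolding lo_def
  proof (rule suminf_window_le[of L W "\<bar>u\<bar>"])
    fix j assume "\<bar>\<bar>u\<bar> - real j\<bar> < L"
    then show "(if j < m then amp j * (B (u - j) + B (u + j)) else 0) \<le> M * (B 0 + B 0)"
      using amp_M amp_nonneg B_nonneg B_0_pos M0 B_le[of "u - j"] B_le[of "u + j"]
      by (auto intro!: mult_mono add_nonneg_nonneg)
  qed (use L_pos W u M0 B_0_pos B0 in auto)
  have hi_le: "hi amp m v \<le> (real W + 1) * (M * B 0)" if v: "v = u \<or> v = - u" for v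
    unfolding hi_def
  proof (rule suminf_window_le[of L W "\<bar>u\<bar>"])
    fix j assume "\<bar>\<bar>u\<bar> - real j\<bar> < L"
    then show "(if m \<le> j then amp j * B (v - j) else 0) \<le> M * B 0"
      using amp_M amp_nonneg B_nonneg B_0_pos M0 by (auto intro!: mult_mono B_le)
  next
    fix j assume "L \<le> \<bar>\<bar>u\<bar> - real j\<bar>"
    then show "(if m \<le> j then amp j * B (v - j) else 0) = 0"
      using B0[of j] B_minus[of "u + j"] v by auto
  qed (use L_pos W u M0 B_0_pos in auto)
  have sum: "lo amp m u + hi amp m u + hi amp m (- u) \<le> 4 * (real W + 1) * M * B 0"
    using lo_le hi_le[of u] hi_le[of "- u"] by (simp add: algebra_simps)
  have "norm (char (law_of (f \<tau>)) u) = norm (of_real (lo amp m u) + cis \<tau> * of_real (hi amp m u) + cis (- \<tau>) * of_real (hi amp m (- u))) / Z"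
    unfolding char_f using Z_pos u by (simp add: norm_divide B_eq_0)
  also have "\<dots> \<le> (4 * (real W + 1) * M * B 0) / (B 0 / 2)"
  proof (intro frac_le)
    have "norm (of_real (lo amp m u) + cis \<tau> * of_real (hi amp m u) + cis (- \<tau>) * of_real (hi amp m (- u)))
        \<le> norm (complex_of_real (lo amp m u)) + norm (cis \<tau> * of_real (hi amp m u)) + norm (cis (- \<tau>) * of_real (hi amp m (- u)))"
      by (intro norm_triangle_le add_mono norm_triangle_ineq order_refl)
    also have "\<dots> = lo amp m u + hi amp m u + hi amp m (- u)"
      using lo_nonneg[OF summable_amp amp_nonneg] hi_nonneg[OF summable_amp amp_nonneg] by (simp add: norm_mult)
    finally show "norm (of_real (lo amp m u) + cis \<tau> * of_real (hi amp m u) + cis (- \<tau>) * of_real (hi amp m (- u)))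
        \<le> 4 * (real W + 1) * M * B 0" using sum by linarith
  qed (use B_0_pos M0 Z_bounds in auto)
  also have "\<dots> = 8 * (real W + 1) * 2 powr \<beta> * \<bar>u\<bar> powr (- \<beta>)"
    using B_0_pos by (simp add: M_def)
  finally show ?thesis .
qed

text \<open>Covers moderate |u|, where polynomial decay gives nothing below 1: the bound stays away
  from 1 on |u| \<ge> R, uniformly in m and \<tau>.\<close>

lemma norm_char_f_le_sinc: "norm (char (law_of (f \<tau>)) u) \<le> 1 - 2 * (c / (3 * B 0)) * (1 - \<bar>sinc u\<bar>)"
proof (rule norm_char_le_sinc)
  fix x :: real assume "\<bar>x\<bar> \<le> 1"
  then have "c \<le> s x" using pi_gt3 by (intro s_ge) auto
  then have "c / (3 * B 0) \<le> s x / (3 * B 0)" using B_0_pos by (intro divide_right_mono) auto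
  then show "c / (3 * B 0) \<le> f \<tau> x" using f_ge[of x \<tau>] by linarith
qed (use f_nonneg prob_space_f c_pos B_0_pos in auto)

lemma second_moment_f:
  "integrable (law_of (f \<tau>)) (\<lambda>x. x\<^sup>2)"
  "(LINT x|law_of (f \<tau>). x\<^sup>2) \<le> 3 / B 0 * (LBINT x. x\<^sup>2 * s x)"
proof -
  have le: "f \<tau> x * x\<^sup>2 \<le> 3 / B 0 * (x\<^sup>2 * s x)" for x
    using mult_right_mono[OF f_le[of \<tau> x], of "x\<^sup>2"] by (simp add: mult_ac)
  have int: "integrable lborel (\<lambda>x. f \<tau> x * x\<^sup>2)"
    by (rule Bochner_Integration.integrable_bound[OF integrable_mult_right[OF integrable_s(2), of "3 / B 0"]])
      (use le f_nonneg B_0_pos s_nonneg in \<open>auto simp: abs_mult\<close>)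
  then show "integrable (law_of (f \<tau>)) (\<lambda>x. x\<^sup>2)"
    by (subst integrable_density) (auto simp: f_nonneg)
  have "(LINT x|law_of (f \<tau>). x\<^sup>2) = (LBINT x. f \<tau> x * x\<^sup>2)"
    by (subst integral_density) (auto simp: f_nonneg)
  also have "\<dots> \<le> (LBINT x. 3 / B 0 * (x\<^sup>2 * s x))"
    by (intro integral_mono int integrable_mult_right integrable_s le)
  finally show "(LINT x|law_of (f \<tau>). x\<^sup>2) \<le> 3 / B 0 * (LBINT x. x\<^sup>2 * s x)" by simp
qed

lemma square_integrable_f:
  "integrable lborel (\<lambda>x. (f \<tau> x)\<^sup>2)" "(LBINT x. (f \<tau> x)\<^sup>2) \<le> 3 * D / B 0"
proof -
  have le: "(f \<tau> x)\<^sup>2 \<le> 3 * D / B 0 * f \<tau> x" for x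
  proof -
    have "3 / B 0 * s x \<le> 3 / B 0 * D" using B_0_pos by (intro mult_left_mono s_le) auto
    then have "f \<tau> x \<le> 3 * D / B 0" using f_le[of \<tau> x] by simp
    then show ?thesis using f_nonneg[of \<tau> x] by (simp add: power2_eq_square mult_right_mono del: times_divide_eq_left)
  qed
  show int: "integrable lborel (\<lambda>x. (f \<tau> x)\<^sup>2)"
    by (rule Bochner_Integration.integrable_bound[OF integrable_mult_right[OF integrable_f[of \<tau>], of "3 * D / B 0"]])
      (use order_trans[OF le abs_ge_self] in auto)
  have "(LBINT x. (f \<tau> x)\<^sup>2) \<le> (LBINT x. 3 * D / B 0 * f \<tau> x)"
    by (intro integral_mono int integrable_mult_right integrable_f le)
  also have "\<dots> = 3 * D / B 0"
    unfolding f_def using Z_pos by (simp add: integral_s_P)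
  finally show "(LBINT x. (f \<tau> x)\<^sup>2) \<le> 3 * D / B 0" .
qed

end

text \<open>The 8 collects three factors 2: from (a - b)^2 \<le> 2 a^2 + 2 b^2, from the overlap of
  the two sample laws, and from bounding the sum of two risks by twice the supremum.\<close>

lemma minimax_risk_two_points:
  fixes f\<^sub>0 f\<^sub>1 r\<^sub>0 r\<^sub>1 :: "real \<Rightarrow> real"
  assumes F: "f\<^sub>0 \<in> F" "f\<^sub>1 \<in> F" and dens: "is_density f\<^sub>0" "is_density f\<^sub>1"
    and r: "r\<^sub>0 \<in> borel_measurable borel" "r\<^sub>1 \<in> borel_measurable borel"
      "\<And>x. \<bar>r\<^sub>0 x\<bar> \<le> \<delta>" "\<And>x. \<bar>r\<^sub>1 x\<bar> \<le> \<delta>"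
    and eq: "\<And>u. char (law_of f\<^sub>1) u ^ K - char (law_of f\<^sub>0) u ^ K =
      (CLINT x|law_of f\<^sub>0. r\<^sub>1 x * iexp (u * x)) ^ K - (CLINT x|law_of f\<^sub>0. r\<^sub>0 x * iexp (u * x)) ^ K"
    and n: "0 < n" "0 < K" "real n * (2 * \<delta> ^ K)\<^sup>2 \<le> 1 / 2"
  shows "(\<integral>\<^sup>+x. ennreal ((f\<^sub>0 x - f\<^sub>1 x)\<^sup>2) \<partial>lborel) / 8 \<le> minimax_risk F K n"
proof -
  have [measurable]: "f\<^sub>0 \<in> borel_measurable borel" "f\<^sub>1 \<in> borel_measurable borel"
    and p: "prob_space (law_of f\<^sub>0)" "prob_space (law_of f\<^sub>1)"
    using dens by (auto simp: is_density_def)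
  have rd: "real_distribution (law_of f\<^sub>0)" "real_distribution (law_of f\<^sub>1)"
    using p by (auto simp: real_distribution_def real_distribution_axioms_def)
  let ?e = "(2 * \<delta> ^ K)\<^sup>2"
  have "1 * ?e \<le> real n * ?e" using n by (intro mult_right_mono) auto
  then have "?e \<le> 1\<^sup>2" using n by simp
  then have small: "2 * \<delta> ^ K \<le> 1" by (rule power2_le_imp_le) simp
  have e2: "(1 + ?e) ^ n \<le> 2"
  proof -
    have "(1 + ?e) ^ n \<le> exp ?e ^ n"
      by (intro power_mono exp_ge_add_one_self) simp
    also have "\<dots> = exp (real n * ?e)" by (simp add: exp_of_nat_mult)
    also have "\<dots> \<le> exp (1 / 2)" using n by simp
    also have "\<dots> \<le> 1 / (1 - 1 / 2)"
    proof -
      have "1 - 1 / 2 \<le> exp (- (1 / 2) :: real)" using exp_ge_add_one_self[of "- (1 / 2)"] by simp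
      then have "inverse (exp (- (1 / 2) :: real)) \<le> inverse (1 - 1 / 2)"
        by (intro le_imp_inverse_le) auto
      then show ?thesis by (simp add: exp_minus)
    qed
    finally show ?thesis by simp
  qed
  interpret pp: prob_space "\<Pi>\<^sub>M k\<in>{..<K}. law_of f\<^sub>0"
    using p by (intro prob_space_PiM) auto
  obtain h where h: "h \<in> borel_measurable (\<Pi>\<^sub>M k\<in>{..<K}. law_of f\<^sub>0)" "\<And>\<omega>. 0 \<le> h \<omega>"
    "(\<integral>\<^sup>+\<omega>. ennreal (h \<omega>) \<partial>(\<Pi>\<^sub>M k\<in>{..<K}. law_of f\<^sub>0)) = 1"
    "(\<integral>\<^sup>+\<omega>. ennreal ((h \<omega>)\<^sup>2) \<partial>(\<Pi>\<^sub>M k\<in>{..<K}. law_of f\<^sub>0)) \<le> ennreal (1 + ?e)"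
    "sum_law K (law_of f\<^sub>1) = distr (density (\<Pi>\<^sub>M k\<in>{..<K}. law_of f\<^sub>0) (\<lambda>\<omega>. ennreal (h \<omega>))) borel (\<lambda>\<omega>. \<Sum>k<K. \<omega> k)"
    using sum_law_perturbation[OF rd r small eq] by blast
  let ?D = "(\<integral>\<^sup>+x. ennreal ((f\<^sub>0 x - f\<^sub>1 x)\<^sup>2) \<partial>lborel)"
  show ?thesis
    unfolding minimax_risk_def
  proof (rule INF_greatest)
    fix t assume "t \<in> estimators n"
    then have [measurable]: "(\<lambda>(y, x). t y x) \<in> borel_measurable ((\<Pi>\<^sub>M j\<in>{..<n}. borel) \<Otimes>\<^sub>M borel)"
      by (simp add: estimators_def)
    define loss where "loss g y = (\<integral>\<^sup>+x. ennreal ((g x - t y x)\<^sup>2) \<partial>lborel)" for g y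
    have loss_meas: "loss g \<in> borel_measurable (\<Pi>\<^sub>M j\<in>{..<n}. borel)"
      if [measurable]: "g \<in> borel_measurable borel" for g
      unfolding loss_def by measurable
    have t_meas: "t y \<in> borel_measurable borel" if "y \<in> space (\<Pi>\<^sub>M j\<in>{..<n}. borel :: real measure)" for y
      using measurable_Pair2[of "\<lambda>(y, x). t y x" "\<Pi>\<^sub>M j\<in>{..<n}. borel" borel borel y] that by simp
    \<comment> \<open>The two-point lemma wants its pointwise inequality for every y, but
      \<open>t y\<close> is known to be measurable only for y in the product space. Adding
      \<open>?D\<close> off the space makes the inequality trivial there and leaves the integral
      unchanged.\<close>
    define A where "A y = loss f\<^sub>0 y + (if y \<in> space (\<Pi>\<^sub>M j\<in>{..<n}. borel :: real measure) then 0 else ?D)" for y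
    have A_meas: "A \<in> borel_measurable (\<Pi>\<^sub>M j\<in>{..<n}. borel)"
    proof (subst measurable_cong)
      show "A y = loss f\<^sub>0 y" if "y \<in> space (\<Pi>\<^sub>M j\<in>{..<n}. borel)" for y
        using that by (simp add: A_def)
    qed (rule loss_meas, measurable)
    have "?D / 2 \<le> A y + loss f\<^sub>1 y" for y
    proof (cases "y \<in> space (\<Pi>\<^sub>M j\<in>{..<n}. borel :: real measure)")
      case True
      note [measurable] = t_meas[OF True]
      have "?D \<le> (\<integral>\<^sup>+x. 2 * ennreal ((f\<^sub>0 x - t y x)\<^sup>2) + 2 * ennreal ((f\<^sub>1 x - t y x)\<^sup>2) \<partial>lborel)"
      proof (rule nn_integral_mono)
        fix x
        have "0 \<le> ((f\<^sub>0 x - t y x) + (f\<^sub>1 x - t y x))\<^sup>2" by simp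
        then have "(f\<^sub>0 x - f\<^sub>1 x)\<^sup>2 \<le> 2 * (f\<^sub>0 x - t y x)\<^sup>2 + 2 * (f\<^sub>1 x - t y x)\<^sup>2"
          by (simp add: power2_eq_square algebra_simps)
        then have "ennreal ((f\<^sub>0 x - f\<^sub>1 x)\<^sup>2) \<le> ennreal (2 * (f\<^sub>0 x - t y x)\<^sup>2 + 2 * (f\<^sub>1 x - t y x)\<^sup>2)"
          by (rule ennreal_leI)
        then show "ennreal ((f\<^sub>0 x - f\<^sub>1 x)\<^sup>2) \<le> 2 * ennreal ((f\<^sub>0 x - t y x)\<^sup>2) + 2 * ennreal ((f\<^sub>1 x - t y x)\<^sup>2)"
          by (simp add: ennreal_plus ennreal_mult)
      qed
      also have "\<dots> = 2 * (loss f\<^sub>0 y + loss f\<^sub>1 y)"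
        unfolding loss_def by (simp add: nn_integral_add nn_integral_cmult distrib_left)
      finally have "?D / 2 \<le> 2 * (loss f\<^sub>0 y + loss f\<^sub>1 y) / 2" by (rule divide_right_mono_ennreal)
      also have "\<dots> = loss f\<^sub>0 y + loss f\<^sub>1 y"
        by (subst mult.commute) (rule ennreal_mult_divide_eq, auto)
      finally show ?thesis using True by (simp add: A_def)
    next
      case False
      have "?D / 2 \<le> ?D" by (simp add: divide_le_posI_ennreal mult_2 mult.commute)
      also have "\<dots> \<le> loss f\<^sub>0 y + ?D" by (rule add_increasing) auto
      also have "\<dots> \<le> A y + loss f\<^sub>1 y" using False by (simp add: A_def add_increasing2)
      finally show ?thesis .
    qed
    then have "?D / 2 / 2 \<le> (\<integral>\<^sup>+y. A y \<partial>(\<Pi>\<^sub>M j\<in>{..<n}. sum_law K (law_of f\<^sub>0))) + (\<integral>\<^sup>+y. loss f\<^sub>1 y \<partial>(\<Pi>\<^sub>M j\<in>{..<n}. sum_law K (law_of f\<^sub>1)))"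
      by (intro two_point_lower_bound[OF pp.prob_space_axioms h(1) measurable_sum_coordinates h(2,3,4) _ e2 sum_law_def h(5) A_meas loss_meas])
        auto
    also have "(\<integral>\<^sup>+y. A y \<partial>(\<Pi>\<^sub>M j\<in>{..<n}. sum_law K (law_of f\<^sub>0))) = (\<integral>\<^sup>+y. loss f\<^sub>0 y \<partial>(\<Pi>\<^sub>M j\<in>{..<n}. sum_law K (law_of f\<^sub>0)))"
    proof (rule nn_integral_cong)
      fix y assume "y \<in> space (\<Pi>\<^sub>M j\<in>{..<n}. sum_law K (law_of f\<^sub>0))"
      then show "A y = loss f\<^sub>0 y" by (simp add: A_def space_PiM sum_law_def)
    qed
    also have "\<dots> = risk K n f\<^sub>0 t"
      by (simp add: risk_def loss_def obs_law_eq_PiM p n)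
    also have "(\<integral>\<^sup>+y. loss f\<^sub>1 y \<partial>(\<Pi>\<^sub>M j\<in>{..<n}. sum_law K (law_of f\<^sub>1))) = risk K n f\<^sub>1 t"
      by (simp add: risk_def loss_def obs_law_eq_PiM p n)
    also have "risk K n f\<^sub>0 t + risk K n f\<^sub>1 t \<le> (SUP f\<in>F. risk K n f t) + (SUP f\<in>F. risk K n f t)"
      by (intro add_mono SUP_upper F)
    also have "\<dots> = (SUP f\<in>F. risk K n f t) * 2" by (simp add: mult_2_right)
    finally have "?D / 2 / 2 / 2 \<le> (SUP f\<in>F. risk K n f t) * 2 / 2" by (rule divide_right_mono_ennreal)
    also have "\<dots> = (SUP f\<in>F. risk K n f t)" by (simp add: ennreal_mult_divide_eq)
    also have "?D / 2 / 2 / 2 = ?D / 8"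
      by (simp add: ennreal_divide_times[symmetric] divide_ennreal_def mult.assoc ennreal_inverse_mult[symmetric])
    finally show "?D / 8 \<le> (SUP f\<in>F. risk K n f t)" .
  qed
qed

section \<open>Separation and indistinguishability of the two hypotheses\<close>

context phase_perturbation
begin

text \<open>Since cos (y - \<tau>) - cos (y + \<tau>) = 2 sin \<tau> sin y, only sines remain, and
  only from frequency m on.\<close>

lemma P_diff: "P \<tau> x - P (- \<tau>) x = (\<Sum>j. (if m \<le> j then 4 * sin \<tau> * amp j else 0) * sin (real j * x))"
proof -
  note S = summable_rabs_cancel[OF summable_trig[OF summable_amp amp_nonneg]]
  have "P \<tau> x - P (- \<tau>) x = (\<Sum>j. 2 * amp j * cos (real j * x - phase m \<tau> j) - 2 * amp j * cos (real j * x - phase m (- \<tau>) j))"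
    unfolding P_def trig_def using suminf_diff[OF S S] by simp
  moreover have "2 * amp j * cos (real j * x - phase m \<tau> j) - 2 * amp j * cos (real j * x - phase m (- \<tau>) j)
      = (if m \<le> j then 4 * sin \<tau> * amp j else 0) * sin (real j * x)" for j
    by (simp add: phase_def cos_diff cos_add algebra_simps)
  ultimately show ?thesis by (simp only:)
qed

text \<open>On [-\<pi>, \<pi>] the factor s / Z is at least c / (3 / 2 B 0), and Bessel's inequality
  bounds the rest from below: about m frequencies of amplitude m powr - \<beta> each.\<close>

lemma L2_distance_f:
  "4 * c\<^sup>2 / (9 * (B 0)\<^sup>2) * (pi * (16 * \<kappa>\<^sup>2 * (sin \<tau>)\<^sup>2 * 3 powr (- 2 * \<beta>))) * real m powr (1 - 2 * \<beta>)
    \<le> (LBINT x. (f \<tau> x - f (- \<tau>) x)\<^sup>2)"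
  "integrable lborel (\<lambda>x. (f \<tau> x - f (- \<tau>) x)\<^sup>2)"
proof -
  define w where "w j = (if m \<le> j then 4 * sin \<tau> * amp j else 0)" for j
  define W' where "W' x = (\<Sum>j. w j * sin (real j * x))" for x
  have W': "P \<tau> x - P (- \<tau>) x = W' x" for x unfolding P_diff W'_def w_def ..
  have [measurable]: "W' \<in> borel_measurable borel" unfolding W'[symmetric, abs_def] by measurable
  have W'_le: "\<bar>W' x\<bar> \<le> 1" for x
    using P_bounds[of \<tau> x] P_bounds[of "- \<tau>" x] unfolding W'[symmetric] by linarith
  have diff: "f \<tau> x - f (- \<tau>) x = s x * W' x / Z" for x
    unfolding f_def W'[symmetric] by (simp add: diff_divide_distrib[symmetric] right_diff_distrib)
  show int: "integrable lborel (\<lambda>x. (f \<tau> x - f (- \<tau>) x)\<^sup>2)"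
  proof (rule Bochner_Integration.integrable_bound)
    show "integrable lborel (\<lambda>x. 2 * (f \<tau> x)\<^sup>2 + 2 * (f (- \<tau>) x)\<^sup>2)"
      using square_integrable_f(1) by simp
    show "AE x in lborel. norm ((f \<tau> x - f (- \<tau>) x)\<^sup>2) \<le> norm (2 * (f \<tau> x)\<^sup>2 + 2 * (f (- \<tau>) x)\<^sup>2)"
    proof (rule AE_I2)
      fix x
      have "0 \<le> (f \<tau> x + f (- \<tau>) x)\<^sup>2" by simp
      then have "(f \<tau> x - f (- \<tau>) x)\<^sup>2 \<le> 2 * (f \<tau> x)\<^sup>2 + 2 * (f (- \<tau>) x)\<^sup>2"
        by (simp add: power2_eq_square algebra_simps)
      then show "norm ((f \<tau> x - f (- \<tau>) x)\<^sup>2) \<le> norm (2 * (f \<tau> x)\<^sup>2 + 2 * (f (- \<tau>) x)\<^sup>2)"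
        by (auto intro: order_trans[OF _ abs_ge_self])
    qed
  qed measurable
  have sw: "summable (\<lambda>j. \<bar>w j\<bar>)"
    by (rule summable_comparison_test'[where N = 0 and g = "\<lambda>j. 4 * \<bar>sin \<tau>\<bar> * amp j"])
      (auto simp: w_def abs_mult amp_nonneg intro!: summable_mult summable_amp)
  have intW: "integrable lborel (\<lambda>x. (W' x)\<^sup>2 * indicator {-pi..pi} x)"
  proof (rule Bochner_Integration.integrable_bound)
    show "integrable lborel (indicator {-pi..pi} :: real \<Rightarrow> real)" by simp
    show "AE x in lborel. norm ((W' x)\<^sup>2 * indicator {-pi..pi} x) \<le> norm (indicator {-pi..pi} x :: real)"
      using power_le_one[OF abs_ge_zero W'_le, of _ 2] by (intro AE_I2) (auto simp: indicator_def)
  qed measurable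
  \<comment> \<open>These m frequencies lie above the window, as m > W, so they have the large
    amplitudes; they are also at most 3 m - 1, which bounds those amplitudes from below.\<close>
  let ?J = "{2 * m..<3 * m}"
  have "real m * (4 * sin \<tau> * (\<kappa> * (3 * real m) powr (- \<beta>)))\<^sup>2 = (\<Sum>j\<in>?J. (4 * sin \<tau> * (\<kappa> * (3 * real m) powr (- \<beta>)))\<^sup>2)"
    by simp
  also have "\<dots> \<le> (\<Sum>j\<in>?J. (w j)\<^sup>2)"
  proof (rule sum_mono)
    fix j assume j: "j \<in> ?J"
    then have "real j + 1 \<le> 3 * real m" by auto
    moreover have "amp j = \<kappa> * (1 + real j) powr (- \<beta>)" using j m by (simp add: amp_def)
    ultimately have "\<kappa> * (3 * real m) powr (- \<beta>) \<le> amp j"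
      using kappa beta by (auto intro!: mult_left_mono powr_mono2')
    then have "(\<kappa> * (3 * real m) powr (- \<beta>))\<^sup>2 \<le> (amp j)\<^sup>2"
      using kappa by (intro power_mono) auto
    then have "(4 * sin \<tau>)\<^sup>2 * (\<kappa> * (3 * real m) powr (- \<beta>))\<^sup>2 \<le> (4 * sin \<tau>)\<^sup>2 * (amp j)\<^sup>2"
      by (intro mult_left_mono) auto
    then show "(4 * sin \<tau> * (\<kappa> * (3 * real m) powr (- \<beta>)))\<^sup>2 \<le> (w j)\<^sup>2"
      using j by (simp add: w_def power_mult_distrib)
  qed
  finally have "pi * (real m * (4 * sin \<tau> * (\<kappa> * (3 * real m) powr (- \<beta>)))\<^sup>2) \<le> pi * (\<Sum>j\<in>?J. (w j)\<^sup>2)"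
    by (intro mult_left_mono) auto
  also have "\<dots> \<le> (LBINT x. (W' x)\<^sup>2 * indicator {-pi..pi} x)"
    unfolding W'_def
  proof (rule bessel_sine_series[OF sw])
    show "0 \<notin> ?J" using m by auto
  qed (use intW in \<open>simp_all add: W'_def\<close>)
  finally have low: "pi * (real m * (4 * sin \<tau> * (\<kappa> * (3 * real m) powr (- \<beta>)))\<^sup>2) \<le> (LBINT x. (W' x)\<^sup>2 * indicator {-pi..pi} x)" .
  have eq: "real m * (4 * sin \<tau> * (\<kappa> * (3 * real m) powr (- \<beta>)))\<^sup>2 = 16 * \<kappa>\<^sup>2 * (sin \<tau>)\<^sup>2 * 3 powr (- 2 * \<beta>) * real m powr (1 - 2 * \<beta>)"
  proof -
    have m0: "0 < real m" using m by simp
    have "((3 * real m) powr (- \<beta>))\<^sup>2 = (3 * real m) powr (- 2 * \<beta>)"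
      by (simp add: power2_eq_square flip: powr_add)
    also have "\<dots> = 3 powr (- 2 * \<beta>) * real m powr (- 2 * \<beta>)" using m0 by (simp add: powr_mult)
    finally have p: "((3 * real m) powr (- \<beta>))\<^sup>2 = 3 powr (- 2 * \<beta>) * real m powr (- 2 * \<beta>)" .
    have "real m powr (1 - 2 * \<beta>) = real m * real m powr (- 2 * \<beta>)"
      using m0 powr_add[of "real m" 1 "- 2 * \<beta>"] by simp
    then show ?thesis by (simp only: power_mult_distrib p) simp
  qed
  have "4 * c\<^sup>2 / (9 * (B 0)\<^sup>2) * (pi * (16 * \<kappa>\<^sup>2 * (sin \<tau>)\<^sup>2 * 3 powr (- 2 * \<beta>))) * real m powr (1 - 2 * \<beta>)
      = (c / (3 / 2 * B 0))\<^sup>2 * (pi * (real m * (4 * sin \<tau> * (\<kappa> * (3 * real m) powr (- \<beta>)))\<^sup>2))"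
    unfolding eq by (simp add: power_divide power_mult_distrib)
  also have "\<dots> \<le> (c / (3 / 2 * B 0))\<^sup>2 * (LBINT x. (W' x)\<^sup>2 * indicator {-pi..pi} x)"
    by (intro mult_left_mono low) auto
  also have "\<dots> = (LBINT x. (c / (3 / 2 * B 0))\<^sup>2 * ((W' x)\<^sup>2 * indicator {-pi..pi} x))"
    by simp
  also have "\<dots> \<le> (LBINT x. (f \<tau> x - f (- \<tau>) x)\<^sup>2)"
  proof (intro integral_mono int integrable_mult_right intW)
    fix x
    show "(c / (3 / 2 * B 0))\<^sup>2 * ((W' x)\<^sup>2 * indicator {-pi..pi} x) \<le> (f \<tau> x - f (- \<tau>) x)\<^sup>2"
    proof (cases "x \<in> {-pi..pi}")
      case True
      then have "c \<le> s x" by (intro s_ge) auto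
      then have "c / (3 / 2 * B 0) \<le> s x / Z"
        using Z_bounds Z_pos c_pos by (intro frac_le) auto
      then have "(c / (3 / 2 * B 0))\<^sup>2 \<le> (s x / Z)\<^sup>2"
        using c_pos B_0_pos by (intro power_mono) auto
      then have "(c / (3 / 2 * B 0))\<^sup>2 * (W' x)\<^sup>2 \<le> (s x / Z)\<^sup>2 * (W' x)\<^sup>2"
        by (intro mult_right_mono) auto
      also have "\<dots> = (f \<tau> x - f (- \<tau>) x)\<^sup>2"
        unfolding diff by (simp add: power_mult_distrib power_divide)
      finally show ?thesis using True by simp
    qed simp
  qed
  finally show "4 * c\<^sup>2 / (9 * (B 0)\<^sup>2) * (pi * (16 * \<kappa>\<^sup>2 * (sin \<tau>)\<^sup>2 * 3 powr (- 2 * \<beta>))) * real m powr (1 - 2 * \<beta>)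
    \<le> (LBINT x. (f \<tau> x - f (- \<tau>) x)\<^sup>2)" .
qed

text \<open>
  Where the characteristic functions of \<open>f \<tau>\<close> and \<open>f (- \<tau>)\<close> have different \<open>K\<close>-th powers, both are
  sums over the frequencies near \<open>m\<close> only, where the amplitudes are of the small order \<open>m powr - b\<close>.
\<close>
lemma char_power_diff_f:
  assumes "real K * \<tau> = pi"
  shows "char (law_of (f (- \<tau>))) u ^ K - char (law_of (f \<tau>)) u ^ K =
    (CLINT x|law_of (f \<tau>). (trig near (phase m (- \<tau>)) x / P \<tau> x) * iexp (u * x)) ^ K -
    (CLINT x|law_of (f \<tau>). (trig near (phase m \<tau>) x / P \<tau> x) * iexp (u * x)) ^ K"
proof -
  have near: "(CLINT x|law_of (f \<tau>). (trig near (phase m t) x / P \<tau> x) * iexp (u * x)) =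
      (of_real (lo near m u) + cis t * of_real (hi near m u) + cis (- t) * of_real (hi near m (- u))) / of_real Z" for t
  proof -
    have "(CLINT x|law_of (f \<tau>). (trig near (phase m t) x / P \<tau> x) * iexp (u * x)) =
        (CLBINT x. s x * P \<tau> x * ((trig near (phase m t) x / P \<tau> x) * iexp (u * x))) / of_real Z"
      by (rule integral_law_f) measurable
    \<comment> \<open>Dividing by \<open>P \<tau>\<close> turns both correcting functions into
      integrals against \<open>s\<close> alone, although they are integrated under the same law
      \<open>f \<tau>\<close>.\<close>
    also have "(CLBINT x. s x * P \<tau> x * ((trig near (phase m t) x / P \<tau> x) * iexp (u * x))) = (CLBINT x. s x * trig near (phase m t) x * iexp (u * x))"
    proof (intro Bochner_Integration.integral_cong refl)
      fix x
      have "P \<tau> x \<noteq> 0" using P_bounds(1)[of \<tau> x] by auto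
      then show "s x * P \<tau> x * ((trig near (phase m t) x / P \<tau> x) * iexp (u * x)) = s x * trig near (phase m t) x * iexp (u * x)"
        by simp
    qed
    finally show ?thesis by (simp only: fourier_trig_phase[OF summable_near near_nonneg])
  qed
  show ?thesis
  proof (cases "\<bar>\<bar>u\<bar> - m\<bar> < L")
    case True
    \<comment> \<open>In the overlap zone the unmodulated kernel is gone and the window contains
      every active frequency, so \<open>near\<close> reproduces both characteristic functions
      exactly.\<close>
    have "B u = 0" using True m_ge by (intro B_eq_0) linarith
    moreover have "\<bar>\<bar>- u\<bar> - m\<bar> < L" using True by simp
    ultimately show ?thesis
      unfolding near char_f
      using lo_hi_restrict[OF True m_ge(1) W near_def] lo_hi_restrict[OF \<open>\<bar>\<bar>- u\<bar> - m\<bar> < L\<close> m_ge(1) W near_def]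
      by simp
  next
    case False
    \<comment> \<open>Off the zone u meets either unshifted frequencies only or shifted ones of a
      single sign, so both differences of K-th powers vanish.\<close>
    have one: "hi a m u = 0 \<or> hi a m (- u) = 0" for a
      using hi_eq_0[of u m a] hi_eq_0[of "- u" m a] m_ge L_pos by linarith
    have "B u + lo amp m u = 0 \<and> lo near m u = 0 \<or> (\<forall>a. hi a m u = 0 \<and> hi a m (- u) = 0)"
    proof (cases "m + L \<le> \<bar>u\<bar>")
      case True
      then show ?thesis using lo_eq_0[OF True] B_eq_0[of u] by auto
    next
      case f: False
      then have "u \<le> m - L" "- u \<le> m - L" using False by linarith+
      then show ?thesis using hi_eq_0 by blast
    qed
    then have "B u + lo amp m u = 0 \<or> hi amp m u = 0 \<and> hi amp m (- u) = 0"
      "lo near m u = 0 \<or> hi near m u = 0 \<and> hi near m (- u) = 0" by auto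
    from power_cis_eq[OF assms this(1) one] power_cis_eq[OF assms this(2) one]
    show ?thesis unfolding near char_f by (simp add: power_divide)
  qed
qed

lemma minimax_risk_ge:
  assumes F: "\<And>\<tau>. 0 \<le> cos \<tau> \<Longrightarrow> f \<tau> \<in> F" and K: "2 \<le> K" and n: "0 < n"
    and e: "real n * (2 * (4 * (2 * real W + 1) * 2 powr b * real m powr (- b)) ^ K)\<^sup>2 \<le> 1 / 2"
  shows "ennreal (4 * c\<^sup>2 / (9 * (B 0)\<^sup>2) * (pi * (16 * \<kappa>\<^sup>2 * (sin (pi / K))\<^sup>2 * 3 powr (- 2 * \<beta>))) * real m powr (1 - 2 * \<beta>) / 8)
    \<le> minimax_risk F K n"
proof -
  define \<tau> where "\<tau> = pi / real K"
  have K\<tau>: "real K * \<tau> = pi" using K by (simp add: \<tau>_def)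
  have "\<tau> \<le> pi / 2" unfolding \<tau>_def using K by (intro divide_left_mono) auto
  moreover have "0 \<le> \<tau>" by (simp add: \<tau>_def)
  ultimately have cos: "0 \<le> cos \<tau>" using pi_gt_zero by (intro cos_ge_zero) linarith+
  \<comment> \<open>Twice the bound on the sum of \<open>near\<close>, and twice again because 1 / P
    \<le> 2.\<close>
  define \<delta> where "\<delta> = 4 * (2 * real W + 1) * 2 powr b * real m powr (- b)"
  have r_le: "\<bar>trig near (phase m t) x / P \<tau> x\<bar> \<le> \<delta>" for t x
  proof -
    have "\<bar>trig near (phase m t) x / P \<tau> x\<bar> = \<bar>trig near (phase m t) x\<bar> / P \<tau> x"
      using P_bounds(1)[of \<tau> x] by (simp add: abs_of_pos)
    also have "\<dots> \<le> (2 * suminf near) / (1 / 2)"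
      using P_bounds(1)[of \<tau> x] by (intro frac_le abs_trig_le summable_near near_nonneg mult_nonneg_nonneg suminf_nonneg) auto
    also have "\<dots> \<le> \<delta>" using suminf_near by (simp add: \<delta>_def algebra_simps)
    finally show ?thesis .
  qed
  have "ennreal (LBINT x. (f \<tau> x - f (- \<tau>) x)\<^sup>2) / 8 = (\<integral>\<^sup>+x. ennreal ((f \<tau> x - f (- \<tau>) x)\<^sup>2) \<partial>lborel) / 8"
    by (subst nn_integral_eq_integral[OF L2_distance_f(2)]) auto
  also have "\<dots> \<le> minimax_risk F K n"
  proof (rule minimax_risk_two_points[OF F[OF cos] F is_density_f is_density_f _ _ r_le r_le char_power_diff_f[OF K\<tau>]])
    show "0 \<le> cos (- \<tau>)" using cos by simp
    show "real n * (2 * \<delta> ^ K)\<^sup>2 \<le> 1 / 2" using e by (simp add: \<delta>_def)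
  qed (use K n in auto)
  finally have le: "ennreal (LBINT x. (f \<tau> x - f (- \<tau>) x)\<^sup>2) / 8 \<le> minimax_risk F K n" .
  have eq: "ennreal (LBINT x. (f \<tau> x - f (- \<tau>) x)\<^sup>2) / 8 = ennreal ((LBINT x. (f \<tau> x - f (- \<tau>) x)\<^sup>2) / 8)"
    using divide_ennreal[of "LBINT x. (f \<tau> x - f (- \<tau>) x)\<^sup>2" 8] by simp
  have "ennreal (4 * c\<^sup>2 / (9 * (B 0)\<^sup>2) * (pi * (16 * \<kappa>\<^sup>2 * (sin (pi / K))\<^sup>2 * 3 powr (- 2 * \<beta>))) * real m powr (1 - 2 * \<beta>) / 8)
      \<le> ennreal ((LBINT x. (f \<tau> x - f (- \<tau>) x)\<^sup>2) / 8)"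
    using L2_distance_f(1)[of \<tau>] by (intro ennreal_leI divide_right_mono) (auto simp: \<tau>_def)
  then show ?thesis using le unfolding eq by (rule order_trans)
qed

text \<open>The premise \<open>decay\<close> has the shape of
  \<open>polynomial_decay_constants\<close> with its constants already fixed, so nothing about C and
  C' depends on m or \<tau> here.\<close>

lemma f_in_density_class:
  assumes "0 \<le> cos \<tau>" and "3 / B 0 * (LBINT x. x\<^sup>2 * s x) \<le> V" "V \<le> C\<^sub>X" "sqrt (3 * D / B 0) \<le> C\<^sub>f"
    and \<rho>: "\<And>u. R \<le> \<bar>u\<bar> \<Longrightarrow> \<bar>sinc u\<bar> \<le> \<rho>"
    and decay: "\<And>\<psi> u. \<lbrakk>\<And>u. 1 - u\<^sup>2 * V / 2 \<le> \<psi> u;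
      \<And>u. \<kappa> * c / (3 * B 0) * (1 + \<bar>u\<bar>) powr (- b) \<le> \<psi> u;
      \<And>u. R \<le> \<bar>u\<bar> \<Longrightarrow> \<psi> u \<le> 1 - 2 * (c / (3 * B 0)) * (1 - \<rho>);
      \<And>u. 2 * L \<le> \<bar>u\<bar> \<Longrightarrow> \<psi> u \<le> 8 * (real W + 1) * 2 powr \<beta> * \<bar>u\<bar> powr (- \<beta>)\<rbrakk> \<Longrightarrow>
      (1 + C * \<bar>u\<bar>) powr (- b) \<le> \<psi> u \<and> (R \<le> \<bar>u\<bar> \<longrightarrow> \<psi> u \<le> (1 + C' * \<bar>u\<bar>) powr (- \<beta>))"
  shows "f \<tau> \<in> density_class R \<beta> b C C' C\<^sub>X C\<^sub>f"
proof -
  have "(1 + C * \<bar>u\<bar>) powr (- b) \<le> norm (char (law_of (f \<tau>)) u) \<and>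
      (R \<le> \<bar>u\<bar> \<longrightarrow> norm (char (law_of (f \<tau>)) u) \<le> (1 + C' * \<bar>u\<bar>) powr (- \<beta>))" for u
  proof (rule decay)
    fix u
    have "1 - u\<^sup>2 * V / 2 \<le> 1 - u\<^sup>2 * (LINT x|law_of (f \<tau>). x\<^sup>2) / 2"
      using order_trans[OF second_moment_f(2) assms(2)] by (simp add: mult_left_mono)
    also have "\<dots> \<le> norm (char (law_of (f \<tau>)) u)"
      by (rule char_ge_second_moment[OF prob_space_f _ second_moment_f(1)]) simp
    finally show "1 - u\<^sup>2 * V / 2 \<le> norm (char (law_of (f \<tau>)) u)" .
  next
    fix u assume "R \<le> \<bar>u\<bar>"
    then have "2 * (c / (3 * B 0)) * (1 - \<rho>) \<le> 2 * (c / (3 * B 0)) * (1 - \<bar>sinc u\<bar>)"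
      using \<rho> c_pos B_0_pos by (intro mult_left_mono) auto
    then show "norm (char (law_of (f \<tau>)) u) \<le> 1 - 2 * (c / (3 * B 0)) * (1 - \<rho>)"
      using norm_char_f_le_sinc[of \<tau> u] by linarith
  qed (use norm_char_f_ge[OF assms(1)] norm_char_f_le in auto)
  moreover have "sqrt (LBINT x. (f \<tau> x)\<^sup>2) \<le> C\<^sub>f"
    using square_integrable_f(2)[of \<tau>] assms(4) by (meson order_trans real_sqrt_le_mono)
  ultimately show ?thesis
    using is_density_f second_moment_f[of \<tau>] square_integrable_f(1) assms(2,3)
    unfolding density_class_def by auto
qed

end

text \<open>Larger C, C_X, C_f and smaller C' only enlarge the class; the thresholds ensure that it
  contains the hypotheses. They are independent of K and n, whereas d may depend on K. R is positive
  because for R = 0 the class is empty.\<close>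

theorem theorem2:
  fixes \<beta> b R :: real
  assumes "1 < \<beta>" and "\<beta> \<le> b" and "0 < R"
  shows "\<exists>C0 > 0. \<exists>C0' > 0. \<exists>CX0 > 0. \<exists>Cf0 > 0.
    \<forall>C \<ge> C0. \<forall>C' \<in> {0<..C0'}. \<forall>C\<^sub>X \<ge> CX0. \<forall>C\<^sub>f \<ge> Cf0. \<forall>K::nat. 2 \<le> K \<longrightarrow>
      (\<exists>d::real. 0 < d \<and>
        ennreal d \<le> liminf (\<lambda>n. minimax_risk (density_class R \<beta> b C C' C\<^sub>X C\<^sub>f) K n
                                   * ennreal (real n powr ((2 * \<beta> - 1) / (2 * b * real K)))))"
proof -
  obtain s B L c D where "band_limited_kernel s B L c D"
    using band_limited_kernel_exists by blast
  then interpret band_limited_kernel s B L c D .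
  obtain \<rho> where \<rho>: "0 < \<rho>" "\<rho> < 1" "\<And>u. R \<le> \<bar>u\<bar> \<Longrightarrow> \<bar>sinc u\<bar> \<le> \<rho>"
    using abs_sinc_less[OF \<open>0 < R\<close>] by blast
  define W where "W = nat \<lceil>2 * L\<rceil>"
  have W: "2 * L \<le> real W" unfolding W_def by (rule real_nat_ceiling_ge)
  define \<sigma> where "\<sigma> = (\<Sum>j. (1 + real j) powr (- \<beta>))"
  have "0 \<le> \<sigma>" unfolding \<sigma>_def by (intro suminf_nonneg summable_shifted_powr assms) simp
  define \<kappa> where "\<kappa> = 1 / (4 * (1 + \<sigma>))"
  have \<kappa>: "0 < \<kappa>" "\<kappa> \<le> 1" "\<kappa> * \<sigma> \<le> 1 / 4"
    using \<open>0 \<le> \<sigma>\<close> by (auto simp: \<kappa>_def field_simps)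
  define V where "V = max 1 (3 / B 0 * (LBINT x. x\<^sup>2 * s x))"
  define Cf0 where "Cf0 = max 1 (sqrt (3 * D / B 0))"
  have perturb: "phase_perturbation s B L c D \<beta> b \<kappa> W m" if "2 * W + 2 \<le> m" for m
    using assms \<kappa> W that by unfold_locales (auto simp: \<sigma>_def)
  have cB: "c \<le> B 0" by (rule B_ge) simp
  have l: "0 < 2 * (c / (3 * B 0)) * (1 - \<rho>)" "2 * (c / (3 * B 0)) * (1 - \<rho>) < 1"
  proof -
    show "0 < 2 * (c / (3 * B 0)) * (1 - \<rho>)" using c_pos B_0_pos \<rho> by simp
    have "2 * (c / (3 * B 0)) * (1 - \<rho>) \<le> 2 / 3 * 1"
      using cB c_pos B_0_pos \<rho> by (intro mult_mono) (auto simp: field_simps)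
    then show "2 * (c / (3 * B 0)) * (1 - \<rho>) < 1" by (rule order.strict_trans1) simp
  qed
  obtain C\<^sub>0 C\<^sub>0' where C: "0 < C\<^sub>0" "0 < C\<^sub>0'"
    "\<And>C C' \<psi> u. \<lbrakk>C\<^sub>0 \<le> C; 0 < C'; C' \<le> C\<^sub>0'; \<And>u. 1 - u\<^sup>2 * V / 2 \<le> \<psi> u;
      \<And>u. \<kappa> * c / (3 * B 0) * (1 + \<bar>u\<bar>) powr (- b) \<le> \<psi> u;
      \<And>u. R \<le> \<bar>u\<bar> \<Longrightarrow> \<psi> u \<le> 1 - 2 * (c / (3 * B 0)) * (1 - \<rho>);
      \<And>u. 2 * L \<le> \<bar>u\<bar> \<Longrightarrow> \<psi> u \<le> 8 * (real W + 1) * 2 powr \<beta> * \<bar>u\<bar> powr (- \<beta>)\<rbrakk> \<Longrightarrow>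
      (1 + C * \<bar>u\<bar>) powr (- b) \<le> \<psi> u \<and> (R \<le> \<bar>u\<bar> \<longrightarrow> \<psi> u \<le> (1 + C' * \<bar>u\<bar>) powr (- \<beta>))"
    by (rule polynomial_decay_constants[OF assms, where \<rho> = "1 - 2 * (c / (3 * B 0)) * (1 - \<rho>)" and V = V
        and k\<^sub>1 = "\<kappa> * c / (3 * B 0)" and k\<^sub>2 = "8 * (real W + 1) * 2 powr \<beta>" and U = "2 * L"])
      (use l c_pos B_0_pos \<kappa> in \<open>auto simp: V_def\<close>)
  have main: "\<exists>d::real. 0 < d \<and> ennreal d \<le> liminf (\<lambda>n. minimax_risk (density_class R \<beta> b C C' C\<^sub>X C\<^sub>f) K n
      * ennreal (real n powr ((2 * \<beta> - 1) / (2 * b * real K))))"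
    if par: "C\<^sub>0 \<le> C" "C' \<in> {0<..C\<^sub>0'}" "V \<le> C\<^sub>X" "Cf0 \<le> C\<^sub>f" and K: "2 \<le> K" for C C' C\<^sub>X C\<^sub>f and K :: nat
  proof -
    define F where "F = density_class R \<beta> b C C' C\<^sub>X C\<^sub>f"
    define A where "A = 4 * (2 * real W + 1) * 2 powr b"
    \<comment> \<open>With x = (\<gamma> n) powr q one has x powr (- 2 b K) = 1 / (\<gamma> n); the
      factor 8 then gives n * 4 A^(2 K) / (\<gamma> n) = 1 / 2, the chi-square budget.\<close>
    define \<gamma> where "\<gamma> = 8 * A ^ (2 * K)"
    define q where "q = 1 / (2 * b * real K)"
    define k where "k = 4 * c\<^sup>2 / (9 * (B 0)\<^sup>2) * (pi * (16 * \<kappa>\<^sup>2 * (sin (pi / K))\<^sup>2 * 3 powr (- 2 * \<beta>)))"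
    have A: "0 < A" by (simp add: A_def add_nonneg_pos)
    have \<gamma>: "0 < \<gamma>" using A by (simp add: \<gamma>_def)
    have q: "0 < q" using assms K by (simp add: q_def)
    have "0 < sin (pi / K)" using K by (intro sin_gt_zero) (auto simp: divide_less_eq)
    then have k: "0 < k" using c_pos B_0_pos \<kappa> by (simp add: k_def)
    \<comment> \<open>The exponent 1 - 2 \<beta> is negative, so rounding x up to an integer m \<le>
      2 x costs the factor 2 inside the power.\<close>
    define d where "d = k * (2 * \<gamma> powr q) powr (1 - 2 * \<beta>) / 8"
    have d: "0 < d" using k \<gamma> by (simp add: d_def)
    \<comment> \<open>Needed for the window to fit below m; smaller n do not affect the limit
      inferior.\<close>
    have ev: "\<forall>\<^sub>F n in sequentially. real (2 * W + 2) \<le> (\<gamma> * real n) powr q"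
      using eventually_ge_at_top[of "nat \<lceil>real (2 * W + 2) powr (1 / q) / \<gamma>\<rceil>"]
    proof eventually_elim
      case (elim n)
      then have "real (2 * W + 2) powr (1 / q) / \<gamma> \<le> real n" by (simp only: nat_ceiling_le_eq)
      then have "real (2 * W + 2) powr (1 / q) \<le> \<gamma> * real n"
        using \<gamma> by (simp add: pos_divide_le_eq mult.commute)
      then have "(real (2 * W + 2) powr (1 / q)) powr q \<le> (\<gamma> * real n) powr q"
        using q by (intro powr_mono2) auto
      moreover have "(real (2 * W + 2) powr (1 / q)) powr q = real (2 * W + 2)"
        unfolding powr_powr using q by simp
      ultimately show ?case by simp
    qed
    have "\<forall>\<^sub>F n in sequentially. ennreal d \<le> minimax_risk F K n * ennreal (real n powr ((2 * \<beta> - 1) / (2 * b * real K)))"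
      using ev eventually_gt_at_top[of 0]
    proof eventually_elim
      case (elim n)
      define x where "x = (\<gamma> * real n) powr q"
      define m where "m = nat \<lceil>x\<rceil>"
      have x: "real (2 * W + 2) \<le> x" using elim by (simp add: x_def)
      have n0: "0 < \<gamma> * real n" using \<gamma> elim by simp
      have xm: "x \<le> real m" unfolding m_def by (rule real_nat_ceiling_ge)
      have "real m \<le> x + 1" unfolding m_def using x by linarith
      then have mx: "real m \<le> 2 * x" using x by simp
      have m: "2 * W + 2 \<le> m" using x xm by (simp only: of_nat_le_iff[symmetric, where ?'a = real])
      interpret phase_perturbation s B L c D \<beta> b \<kappa> W m by (rule perturb[OF m])
      have x0: "0 < x" using x by simp
      have fF: "f t \<in> F" if "0 \<le> cos t" for t
        unfolding F_def
      proof (rule f_in_density_class[OF that, where V = V and \<rho> = \<rho>], goal_cases)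
        case (5 \<psi> u)
        show ?case by (rule C(3)[OF par(1) _ _ 5]) (use par(2) in auto)
      qed (use par \<rho> in \<open>auto simp: V_def Cf0_def\<close>)
      have e: "real n * (2 * (A * real m powr (- b)) ^ K)\<^sup>2 \<le> 1 / 2"
      proof -
        have "real m powr (- b) \<le> x powr (- b)"
          using xm x0 assms by (intro powr_mono2') auto
        then have "A * real m powr (- b) \<le> A * x powr (- b)" using A by (intro mult_left_mono) auto
        then have "(2 * (A * real m powr (- b)) ^ K)\<^sup>2 \<le> (2 * (A * x powr (- b)) ^ K)\<^sup>2"
          using A by (intro power_mono mult_left_mono) auto
        also have "\<dots> = 4 * A ^ (2 * K) * x powr (- (2 * b * real K))"
        proof -
          have "((x powr (- b)) ^ K)\<^sup>2 = (x powr (- b)) ^ (K * 2)" by (rule power_mult[symmetric])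
          also have "\<dots> = (x powr (- b)) powr (real (K * 2))" using x0 by (intro powr_realpow[symmetric]) simp
          also have "\<dots> = x powr (- (2 * b * real K))" by (simp add: powr_powr mult_ac)
          finally show ?thesis by (simp add: power_mult_distrib power_mult mult.commute)
        qed
        also have "x powr (- (2 * b * real K)) = 1 / (\<gamma> * real n)"
        proof -
          have "x powr (- (2 * b * real K)) = (\<gamma> * real n) powr (- 1)"
            unfolding x_def powr_powr using assms K by (simp add: q_def)
          then show ?thesis using n0 by (simp add: powr_minus_divide)
        qed
        finally have "(2 * (A * real m powr (- b)) ^ K)\<^sup>2 \<le> 4 * A ^ (2 * K) * (1 / (\<gamma> * real n))" .
        then have "real n * (2 * (A * real m powr (- b)) ^ K)\<^sup>2 \<le> real n * (4 * A ^ (2 * K) * (1 / (\<gamma> * real n)))"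
          by (intro mult_left_mono) auto
        also have "\<dots> = 1 / 2" using elim A by (simp add: \<gamma>_def)
        finally show ?thesis .
      qed
      have low: "ennreal (k * real m powr (1 - 2 * \<beta>) / 8) \<le> minimax_risk F K n"
        using minimax_risk_ge[OF fF K elim(2)] e unfolding k_def A_def by (simp add: mult.assoc)
      have "(2 * x) powr (1 - 2 * \<beta>) \<le> real m powr (1 - 2 * \<beta>)"
        using mx xm x0 assms by (intro powr_mono2') auto
      moreover have "(2 * x) powr (1 - 2 * \<beta>) = (2 * \<gamma> powr q) powr (1 - 2 * \<beta>) * real n powr (- ((2 * \<beta> - 1) / (2 * b * real K)))"
      proof -
        have "2 * x = (2 * \<gamma> powr q) * real n powr q" using \<gamma> by (simp add: x_def powr_mult)
        then have "(2 * x) powr (1 - 2 * \<beta>) = (2 * \<gamma> powr q) powr (1 - 2 * \<beta>) * (real n powr q) powr (1 - 2 * \<beta>)"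
          by (simp add: powr_mult)
        also have "(real n powr q) powr (1 - 2 * \<beta>) = real n powr (- ((2 * \<beta> - 1) / (2 * b * real K)))"
          unfolding powr_powr by (rule arg_cong[where f = "\<lambda>y. real n powr y"]) (simp add: q_def minus_divide_left)
        finally show ?thesis .
      qed
      ultimately have "(2 * \<gamma> powr q) powr (1 - 2 * \<beta>) * real n powr (- ((2 * \<beta> - 1) / (2 * b * real K))) \<le> real m powr (1 - 2 * \<beta>)"
        by simp
      then have "d * real n powr (- ((2 * \<beta> - 1) / (2 * b * real K))) \<le> k * real m powr (1 - 2 * \<beta>) / 8"
        using mult_left_mono[OF _ less_imp_le[OF k]] by (simp add: d_def mult.assoc)
      then have "ennreal (d * real n powr (- ((2 * \<beta> - 1) / (2 * b * real K)))) \<le> minimax_risk F K n"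
        using low by (meson ennreal_leI order_trans)
      then have "ennreal (d * real n powr (- ((2 * \<beta> - 1) / (2 * b * real K)))) * ennreal (real n powr ((2 * \<beta> - 1) / (2 * b * real K)))
          \<le> minimax_risk F K n * ennreal (real n powr ((2 * \<beta> - 1) / (2 * b * real K)))"
        by (rule mult_right_mono) simp
      moreover have "ennreal (d * real n powr (- ((2 * \<beta> - 1) / (2 * b * real K)))) * ennreal (real n powr ((2 * \<beta> - 1) / (2 * b * real K))) = ennreal d"
        using d elim by (simp add: ennreal_mult[symmetric] mult.assoc powr_add[symmetric])
      ultimately show ?case by simp
    qed
    then have "ennreal d \<le> liminf (\<lambda>n. minimax_risk F K n * ennreal (real n powr ((2 * \<beta> - 1) / (2 * b * real K))))"
      by (rule Liminf_bounded)
    with d show ?thesis unfolding F_def by blast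
  qed
  have pos: "0 < V" "0 < Cf0" by (auto simp: V_def Cf0_def)
  show ?thesis
    by (rule exI[of _ C\<^sub>0], rule conjI[OF C(1)], rule exI[of _ C\<^sub>0'], rule conjI[OF C(2)],
        rule exI[of _ V], rule conjI[OF pos(1)], rule exI[of _ Cf0], rule conjI[OF pos(2)])
      (intro allI ballI impI main)
qed

end
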